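(* Let $(M,g)$ be a quaternionic Kähler manifold of dimension $4m$, with canonical parallel $4$-form $\Omega$ and associated (locally defined) Grassmann structure $T^{*\mathbb C}M=E\otimes H$. A connection $\nabla$ in a vector bundle $W\to M$ is half-flat, i.e. its curvature satisfies $F^\nabla\in S^2E\otimes\wedge^2H\otimes\mathrm{End}\,W$, if and only if it is $\lambda_1$-self-dual, i.e. $B_\Omega F^\nabla=\lambda_1F^\nabla$. Hence any such connection is a Yang-Mills connection, i.e. $d^\nabla*F^\nabla=0$.
   Context: A quaternionic Kähler manifold is a Riemannian manifold $(M,g)$ of dimension $4m$ with holonomy group contained in $\mathrm{Sp}(m)\mathrm{Sp}(1)$. It carries a parallel rank $3$ subbundle $Q\subset\mathrm{End}\,TM$ locally spanned by skew-symmetric almost complex structures $J_1,J_2,J_3=J_1J_2=-J_2J_1$; with $\omega_\alpha=g(J_\alpha\cdot,\cdot)$, the $4$-form $\Omega=\sum_\alpha\omega_\alpha\wedge\omega_\alpha$ (up to a constant nonzero normalisation factor) is globally defined and parallel. $M$ has a locally defined Grassmann structure $T^{*\mathbb C}M=E\otimes H$, where $E,H$ are complex vector bundles of ranks $2m$ and $2$, with the holonomy group contained in $\mathrm{Sp}(E)\otimes\mathrm{Sp}(H)$, and $g^{\mathbb C}=\omega_E\otimes\omega_H$ with $\omega_E\in\Gamma(\wedge^2E)$, $\omega_H\in\Gamma(\wedge^2H)$ fibrewise symplectic forms on $E^*$, $H^*$. Define $B_\Omega:\wedge^2T^*M\to\wedge^2T^*M$ by $B_\Omega\omega=*( *\Omega\wedge\omega)$,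 extended complex linearly and to $\mathrm{End}\,W$-valued forms. Its eigenspaces on $\wedge^2T^{*\mathbb C}M$ are $V_{\lambda_1}=S^2E\otimes\omega_H$, $V_{\lambda_2}=\wedge^2_0E\otimes S^2H$ (with $\wedge_0^2E$ the $\omega_E$-traceless part of $\wedge^2E$), $V_{\lambda_3}=\omega_E\otimes S^2H$, with eigenvalues, for $\Omega$ suitably normalised, $\lambda_1=1$, $\lambda_2=-1/3$, $\lambda_3=-(2m+1)/3$. $F^\nabla$ is the curvature and $d^\nabla$ the covariant exterior derivative on $\mathrm{End}\,W$-valued forms. *)

theory Defs
  imports "HOL-Analysis.Analysis"
begin

section \<open>Smooth maps between open sets\<close>

text \<open>On open sets of a finite-dimensional space, continuity of all iterated directional
  derivatives up to order k is the usual \<open>C\<^sup>k\<close> condition.\<close>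

primrec Ck_on :: "nat \<Rightarrow> 'a::real_normed_vector set \<Rightarrow> ('a \<Rightarrow> 'b::real_normed_vector) \<Rightarrow> bool" where
  "Ck_on 0 S f \<longleftrightarrow> continuous_on S f"
| "Ck_on (Suc k) S f \<longleftrightarrow> (\<forall>x\<in>S. f differentiable (at x)) \<and>
     (\<forall>v. Ck_on k S (\<lambda>x. frechet_derivative f (at x) v))"

definition smooth_on :: "'a::real_normed_vector set \<Rightarrow> ('a \<Rightarrow> 'b::real_normed_vector) \<Rightarrow> bool" where
  "smooth_on S f \<longleftrightarrow> (\<forall>k. Ck_on k S f)"


section \<open>Manifolds, metrics and the Levi-Civita connection\<close>

text \<open>A manifold is a Hausdorff, second countable space (the whole type \<open>'a\<close>) with a smooth
  atlas, whose charts take values in \<open>real ^ 'n\<close>. A chart is a pair of a domain and a coordinate map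
  that is only meaningful on that domain. A tensor field is the family of its coordinate
  expressions, indexed by the charts, subject to the tensorial transformation law.\<close>

type_synonym ('a, 'n) chart = "'a set \<times> ('a \<Rightarrow> real ^ 'n)"

abbreviation cdom :: "('a, 'n) chart \<Rightarrow> 'a set" where "cdom c \<equiv> fst c"
abbreviation coord :: "('a, 'n) chart \<Rightarrow> 'a \<Rightarrow> real ^ 'n" where "coord c \<equiv> snd c"

definition img :: "('a, 'n) chart \<Rightarrow> (real ^ 'n) set" where
  "img c = coord c ` cdom c"

definition param :: "('a, 'n) chart \<Rightarrow> real ^ 'n \<Rightarrow> 'a" where
  "param c = inv_into (cdom c) (coord c)"

definition transition :: "('a, 'n) chart \<Rightarrow> ('a, 'n) chart \<Rightarrow> real ^ 'n \<Rightarrow> real ^ 'n" where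
  "transition c d = coord d \<circ> param c"

definition overlap :: "('a, 'n) chart \<Rightarrow> ('a, 'n) chart \<Rightarrow> (real ^ 'n) set" where
  "overlap c d = coord c ` (cdom c \<inter> cdom d)"

definition jac :: "('a, 'n::finite) chart \<Rightarrow> ('a, 'n) chart \<Rightarrow> real ^ 'n \<Rightarrow> real ^ 'n ^ 'n" where
  "jac c d x = matrix (frechet_derivative (transition c d) (at x))"

definition smooth_atlas ::
  "('a::{t2_space, second_countable_topology}, 'n::finite) chart set \<Rightarrow> bool" where
  "smooth_atlas \<A> \<longleftrightarrow>
     (\<forall>c\<in>\<A>. open (cdom c) \<and> open (img c) \<and> homeomorphism (cdom c) (img c) (coord c) (param c)) \<and>
     (\<Union>c\<in>\<A>. cdom c) = UNIV \<and>
     (\<forall>c\<in>\<A>. \<forall>d\<in>\<A>. smooth_on (overlap c d) (transition c d))"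

type_synonym ('a, 'n) metric = "('a, 'n) chart \<Rightarrow> real ^ 'n \<Rightarrow> real ^ 'n ^ 'n"

definition riemannian_metric ::
  "('a, 'n::finite) chart set \<Rightarrow> ('a, 'n) metric \<Rightarrow> bool" where
  "riemannian_metric \<A> g \<longleftrightarrow>
     (\<forall>c\<in>\<A>. smooth_on (img c) (g c) \<and>
        (\<forall>x\<in>img c. transpose (g c x) = g c x \<and> (\<forall>v. v \<noteq> 0 \<longrightarrow> v \<bullet> (g c x *v v) > 0))) \<and>
     (\<forall>c\<in>\<A>. \<forall>d\<in>\<A>. \<forall>x\<in>overlap c d.
        g c x = transpose (jac c d x) ** g d (transition c d x) ** jac c d x)"

text \<open>The Christoffel symbols as a bilinear map: the Levi-Civita derivative of a vector field
  \<open>Y\<close> in direction \<open>u\<close> is \<open>D\<^sub>u Y + christoffel G x u Y\<close>.\<close>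

definition christoffel ::
  "(real ^ 'n \<Rightarrow> real ^ 'n ^ 'n) \<Rightarrow> real ^ 'n::finite \<Rightarrow> real ^ 'n \<Rightarrow> real ^ 'n \<Rightarrow> real ^ 'n" where
  "christoffel G x u v =
     (let D = frechet_derivative G (at x) in
      matrix_inv (G x) *v
        (\<chi> l. (v \<bullet> (D u *v axis l 1) + u \<bullet> (D v *v axis l 1) - u \<bullet> (D (axis l 1) *v v)) / 2))"

definition cov_deriv_endo ::
  "(real ^ 'n \<Rightarrow> real ^ 'n ^ 'n) \<Rightarrow> (real ^ 'n \<Rightarrow> real ^ 'n ^ 'n) \<Rightarrow> real ^ 'n::finite \<Rightarrow> real ^ 'n
     \<Rightarrow> real ^ 'n ^ 'n" where
  "cov_deriv_endo G S x u =
     frechet_derivative S (at x) u + matrix (christoffel G x u) ** S x - S x ** matrix (christoffel G x u)"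


section \<open>Parallel transport and holonomy\<close>

definition piecewise_C1_curve :: "('a::topological_space, 'n::finite) chart set \<Rightarrow> (real \<Rightarrow> 'a) \<Rightarrow> bool" where
  "piecewise_C1_curve \<A> \<gamma> \<longleftrightarrow> path \<gamma> \<and>
     (\<forall>c\<in>\<A>. \<forall>s t. 0 \<le> s \<and> s \<le> t \<and> t \<le> 1 \<and> \<gamma> ` {s..t} \<subseteq> cdom c \<longrightarrow>
        (coord c \<circ> \<gamma>) piecewise_C1_differentiable_on {s..t})"

definition parallel_along ::
  "('a, 'n::finite) chart set \<Rightarrow> ('a, 'n) metric \<Rightarrow> (real \<Rightarrow> 'a)
     \<Rightarrow> (('a, 'n) chart \<Rightarrow> real \<Rightarrow> real ^ 'n) \<Rightarrow> bool" where
  "parallel_along \<A> g \<gamma> V \<longleftrightarrow>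
     (\<forall>c\<in>\<A>. \<forall>d\<in>\<A>. \<forall>t\<in>{0..1}. \<gamma> t \<in> cdom c \<inter> cdom d \<longrightarrow>
        V d t = jac c d (coord c (\<gamma> t)) *v V c t) \<and>
     (\<forall>c\<in>\<A>. \<forall>s t. 0 \<le> s \<and> s \<le> t \<and> t \<le> 1 \<and> \<gamma> ` {s..t} \<subseteq> cdom c \<longrightarrow>
        continuous_on {s..t} (V c) \<and>
        (\<exists>S. finite S \<and> (\<forall>r\<in>{s<..<t} - S.
           (V c has_vector_derivative
             - christoffel (g c) (coord c (\<gamma> r)) (vector_derivative (coord c \<circ> \<gamma>) (at r)) (V c r)) (at r))))"

text \<open>The holonomy group at the point with coordinates \<open>x\<close> in the chart \<open>c\<close>, acting on the tangent
  space by matrices with respect to the coordinate basis of \<open>c\<close>.\<close>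

definition holonomy_group ::
  "('a::topological_space, 'n::finite) chart set \<Rightarrow> ('a, 'n) metric \<Rightarrow> ('a, 'n) chart \<Rightarrow> real ^ 'n
     \<Rightarrow> (real ^ 'n ^ 'n) set" where
  "holonomy_group \<A> g c x =
     {P. \<exists>\<gamma>. piecewise_C1_curve \<A> \<gamma> \<and> pathstart \<gamma> = param c x \<and> pathfinish \<gamma> = param c x \<and>
         (\<forall>v. \<exists>V. parallel_along \<A> g \<gamma> V \<and> V c 0 = v \<and> V c 1 = P *v v)}"


section \<open>Quaternionic Kaehler structures\<close>

text \<open>Here \<open>G\<close> is the matrix of an inner product on one tangent space and \<open>Q\<close> a set of
  endomorphisms of it.\<close>

definition skew_wrt :: "real ^ 'n ^ 'n \<Rightarrow> real ^ 'n ^ 'n::finite \<Rightarrow> bool" where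
  "skew_wrt G J \<longleftrightarrow> (\<forall>u v. (J *v u) \<bullet> (G *v v) = - (u \<bullet> (G *v (J *v v))))"

definition admissible_basis ::
  "real ^ 'n ^ 'n \<Rightarrow> (real ^ 'n ^ 'n) set \<Rightarrow> real ^ 'n ^ 'n \<Rightarrow> real ^ 'n ^ 'n \<Rightarrow> real ^ 'n ^ 'n::finite \<Rightarrow> bool" where
  "admissible_basis G Q J1 J2 J3 \<longleftrightarrow>
     J1 ** J1 = - mat 1 \<and> J2 ** J2 = - mat 1 \<and> J3 = J1 ** J2 \<and> J1 ** J2 = - (J2 ** J1) \<and>
     skew_wrt G J1 \<and> skew_wrt G J2 \<and> skew_wrt G J3 \<and> Q = span {J1, J2, J3}"

definition Sp_group ::
  "real ^ 'n ^ 'n \<Rightarrow> real ^ 'n ^ 'n \<Rightarrow> real ^ 'n ^ 'n \<Rightarrow> real ^ 'n ^ 'n \<Rightarrow> (real ^ 'n ^ 'n::finite) set" where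
  "Sp_group G J1 J2 J3 =
     {P. transpose P ** G ** P = G \<and> P ** J1 = J1 ** P \<and> P ** J2 = J2 ** P \<and> P ** J3 = J3 ** P}"

definition Sp1_group ::
  "real ^ 'n ^ 'n \<Rightarrow> real ^ 'n ^ 'n \<Rightarrow> real ^ 'n ^ 'n \<Rightarrow> (real ^ 'n ^ 'n::finite) set" where
  "Sp1_group J1 J2 J3 =
     {a *\<^sub>R mat 1 + b1 *\<^sub>R J1 + b2 *\<^sub>R J2 + b3 *\<^sub>R J3 | a b1 b2 b3. a^2 + b1^2 + b2^2 + b3^2 = 1}"

definition SpSp1_group ::
  "real ^ 'n ^ 'n \<Rightarrow> real ^ 'n ^ 'n \<Rightarrow> real ^ 'n ^ 'n \<Rightarrow> real ^ 'n ^ 'n \<Rightarrow> (real ^ 'n ^ 'n::finite) set" where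
  "SpSp1_group G J1 J2 J3 = {P ** R | P R. P \<in> Sp_group G J1 J2 J3 \<and> R \<in> Sp1_group J1 J2 J3}"

type_synonym ('a, 'n) endo_bundle = "('a, 'n) chart \<Rightarrow> real ^ 'n \<Rightarrow> (real ^ 'n ^ 'n) set"

text \<open>A rank 3 subbundle of the endomorphism bundle, locally spanned by smooth admissible bases
  (whose members are automatically linearly independent).\<close>

definition quaternionic_bundle ::
  "('a, 'n::finite) chart set \<Rightarrow> ('a, 'n) metric \<Rightarrow> ('a, 'n) endo_bundle \<Rightarrow> bool" where
  "quaternionic_bundle \<A> g Q \<longleftrightarrow>
     (\<forall>c\<in>\<A>. \<forall>d\<in>\<A>. \<forall>x\<in>overlap c d.
        Q d (transition c d x) = (\<lambda>J. jac c d x ** J ** matrix_inv (jac c d x)) ` Q c x) \<and>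
     (\<forall>c\<in>\<A>. \<forall>x\<in>img c. \<exists>N J1 J2 J3. open N \<and> x \<in> N \<and> N \<subseteq> img c \<and>
        smooth_on N J1 \<and> smooth_on N J2 \<and> smooth_on N J3 \<and>
        (\<forall>y\<in>N. admissible_basis (g c y) (Q c y) (J1 y) (J2 y) (J3 y)))"

definition parallel_subbundle ::
  "('a, 'n::finite) chart set \<Rightarrow> ('a, 'n) metric \<Rightarrow> ('a, 'n) endo_bundle \<Rightarrow> bool" where
  "parallel_subbundle \<A> g Q \<longleftrightarrow>
     (\<forall>c\<in>\<A>. \<forall>N S. open N \<and> N \<subseteq> img c \<and> smooth_on N S \<and> (\<forall>y\<in>N. S y \<in> Q c y) \<longrightarrow>
        (\<forall>y\<in>N. \<forall>u. cov_deriv_endo (g c) S y u \<in> Q c y))"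

definition quaternionic_kaehler ::
  "('a::{t2_space, second_countable_topology}, 'n::finite) chart set \<Rightarrow> ('a, 'n) metric
     \<Rightarrow> ('a, 'n) endo_bundle \<Rightarrow> bool" where
  "quaternionic_kaehler \<A> g Q \<longleftrightarrow>
     smooth_atlas \<A> \<and> riemannian_metric \<A> g \<and> quaternionic_bundle \<A> g Q \<and> parallel_subbundle \<A> g Q \<and>
     (\<forall>c\<in>\<A>. \<forall>x\<in>img c. \<exists>J1 J2 J3. admissible_basis (g c x) (Q c x) J1 J2 J3 \<and>
        holonomy_group \<A> g c x \<subseteq> SpSp1_group (g c x) J1 J2 J3)"


section \<open>Exterior calculus in coordinates\<close>

type_synonym 'n rmat = "real ^ 'n ^ 'n"

text \<open>The value of a k-form at a point is an alternating multilinear function of lists of k vectors;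
  its values on lists of other lengths are irrelevant.\<close>

type_synonym ('n, 'v) form = "(real ^ 'n) list \<Rightarrow> 'v"

definition wedge ::
  "('u \<Rightarrow> 'v \<Rightarrow> 'w) \<Rightarrow> nat \<Rightarrow> nat \<Rightarrow> ('n, 'u) form \<Rightarrow> ('n, 'v) form \<Rightarrow> ('n, 'w::real_vector) form" where
  "wedge prd k l \<alpha> \<beta> vs =
     (1 / (fact k * fact l)) *\<^sub>R
       (\<Sum>\<sigma> | \<sigma> permutes {..<k + l}. of_int (sign \<sigma>) *\<^sub>R
          prd (\<alpha> (map (\<lambda>i. vs ! \<sigma> i) [0..<k])) (\<beta> (map (\<lambda>i. vs ! \<sigma> i) [k..<k + l])))"

definition ext_deriv ::
  "nat \<Rightarrow> (real ^ 'n \<Rightarrow> ('n, 'v) form) \<Rightarrow> real ^ 'n::finite \<Rightarrow> ('n, 'v::real_normed_vector) form" where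
  "ext_deriv k \<alpha> x vs =
     (\<Sum>i\<le>k. (-1) ^ i *\<^sub>R frechet_derivative (\<lambda>y. \<alpha> y (take i vs @ drop (Suc i) vs)) (at x) (vs ! i))"

text \<open>The volume form of the coordinate orientation. The operator \<open>B_op\<close> below and the vanishing of
  the covariant derivative of the Hodge dual do not depend on the orientation.\<close>

definition vol_form :: "'n rmat \<Rightarrow> ('n::{finite, linorder}, real) form" where
  "vol_form G vs = sqrt (det G) * det (\<chi> i. vs ! card {j. j < i})"

text \<open>In index notation: \<open>1/k!\<close> times \<open>\<alpha>\<close> with all k indices raised, contracted with the first k
  slots of the volume form; equivalently, \<open>\<beta> \<and> \<star>\<alpha> = \<langle>\<beta>, \<alpha>\<rangle> vol\<close>.\<close>

definition hodge ::
  "'n rmat \<Rightarrow> nat \<Rightarrow> ('n, 'v) form \<Rightarrow> ('n::{finite, linorder}, 'v::real_vector) form" where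
  "hodge G k \<alpha> vs =
     (1 / fact k) *\<^sub>R
       (\<Sum>is | length is = k. \<Sum>js | length js = k.
          ((\<Prod>a<k. matrix_inv G $ (is ! a) $ (js ! a)) * vol_form G (map (\<lambda>j. axis j 1) js @ vs))
            *\<^sub>R \<alpha> (map (\<lambda>i. axis i 1) is))"

definition kaehler_form :: "real ^ 'n ^ 'n \<Rightarrow> real ^ 'n ^ 'n \<Rightarrow> ('n::finite, real) form" where
  "kaehler_form G J vs = (J *v (vs ! 0)) \<bullet> (G *v (vs ! 1))"

text \<open>The fundamental 4-form at one point. It does not depend on the choice of the admissible basis.
  The factor \<open>-1/6\<close> is the normalisation for which \<open>B_op\<close> has the eigenvalues
  \<open>1\<close>, \<open>-1/3\<close>, \<open>-(2m+1)/3\<close>.\<close>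

definition fundamental_form :: "real ^ 'n ^ 'n \<Rightarrow> (real ^ 'n ^ 'n) set \<Rightarrow> ('n::finite, real) form" where
  "fundamental_form G Q =
     (SOME \<Omega>. \<exists>J1 J2 J3. admissible_basis G Q J1 J2 J3 \<and>
        \<Omega> = (\<lambda>vs. - (1/6) * (\<Sum>J\<leftarrow>[J1, J2, J3]. wedge (*) 2 2 (kaehler_form G J) (kaehler_form G J) vs)))"

definition B_op ::
  "'n rmat \<Rightarrow> ('n, real) form \<Rightarrow> ('n, 'v) form \<Rightarrow> ('n::{finite, linorder}, 'v::real_vector) form" where
  "B_op G \<Omega> \<alpha> =
     hodge G (CARD('n) - 2) (wedge (*\<^sub>R) (CARD('n) - 4) 2 (hodge G 4 \<Omega>) \<alpha>)"


section \<open>Vector bundles and connections\<close>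

text \<open>The scalars of a vector bundle are either the real or the complex numbers.\<close>

class bundle_scalar = real_normed_field +
  fixes to_complex :: "'a \<Rightarrow> complex"
  assumes to_complex_add: "to_complex (x + y) = to_complex x + to_complex y"
    and to_complex_mult: "to_complex (x * y) = to_complex x * to_complex y"
    and to_complex_scaleR: "to_complex (scaleR r x) = scaleR r (to_complex x)"
    and norm_to_complex: "norm (to_complex x) = norm x"

instantiation real :: bundle_scalar
begin
definition to_complex_real :: "real \<Rightarrow> complex" where "to_complex_real = complex_of_real"
instance by standard (auto simp: to_complex_real_def scaleR_conv_of_real)
end

instantiation complex :: bundle_scalar
begin
definition to_complex_complex :: "complex \<Rightarrow> complex" where "to_complex_complex = (\<lambda>z. z)"
instance by standard (auto simp: to_complex_complex_def)
end

text \<open>A vector bundle of rank \<open>CARD('r)\<close> is given by its projection \<open>\<pi>\<close> from the total space and a set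
  of local trivialisations, each a pair of an open set and the fibre component of the
  trivialisation over it. The topology, smooth structure and fibrewise linear structure of the
  total space are those induced by the trivialisations.\<close>

type_synonym ('a, 'w, 'k, 'r) triv = "'a set \<times> ('w \<Rightarrow> 'k ^ 'r)"

abbreviation tdom :: "('a, 'w, 'k, 'r) triv \<Rightarrow> 'a set" where "tdom t \<equiv> fst t"

definition bundle_transition ::
  "('w \<Rightarrow> 'a) \<Rightarrow> ('a, 'w, 'k::field, 'r::finite) triv \<Rightarrow> ('a, 'w, 'k, 'r) triv \<Rightarrow> 'a \<Rightarrow> 'k ^ 'r ^ 'r" where
  "bundle_transition \<pi> s t p =
     matrix (\<lambda>v. snd t (inv_into (\<pi> -` tdom s) (\<lambda>w. (\<pi> w, snd s w)) (p, v)))"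

definition vector_bundle ::
  "('a::topological_space, 'n::finite) chart set \<Rightarrow> ('w \<Rightarrow> 'a)
     \<Rightarrow> ('a, 'w, 'k::bundle_scalar, 'r::finite) triv set \<Rightarrow> bool" where
  "vector_bundle \<A> \<pi> \<T> \<longleftrightarrow>
     (\<forall>t\<in>\<T>. open (tdom t) \<and> bij_betw (\<lambda>w. (\<pi> w, snd t w)) (\<pi> -` tdom t) (tdom t \<times> UNIV)) \<and>
     (\<Union>t\<in>\<T>. tdom t) = UNIV \<and>
     (\<forall>s\<in>\<T>. \<forall>t\<in>\<T>.
        (\<forall>w. \<pi> w \<in> tdom s \<inter> tdom t \<longrightarrow> snd t w = bundle_transition \<pi> s t (\<pi> w) *v snd s w) \<and>
        (\<forall>c\<in>\<A>. smooth_on (coord c ` (cdom c \<inter> tdom s \<inter> tdom t)) (bundle_transition \<pi> s t \<circ> param c)))"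

text \<open>A connection is given by its local connection forms, one for each chart and trivialisation: if a
  section is expressed in the trivialisation \<open>t\<close> by the vector-valued function \<open>f\<close>, its covariant
  derivative in direction \<open>u\<close> is \<open>D\<^sub>u f + A c t x [u] f\<close>.\<close>

type_synonym ('a, 'n, 'w, 'k, 'r) conn =
  "('a, 'n) chart \<Rightarrow> ('a, 'w, 'k, 'r) triv \<Rightarrow> real ^ 'n \<Rightarrow> ('n, 'k ^ 'r ^ 'r) form"

definition connection ::
  "('a::topological_space, 'n::finite) chart set \<Rightarrow> ('w \<Rightarrow> 'a)
     \<Rightarrow> ('a, 'w, 'k::bundle_scalar, 'r::finite) triv set \<Rightarrow> ('a, 'n, 'w, 'k, 'r) conn \<Rightarrow> bool" where
  "connection \<A> \<pi> \<T> A \<longleftrightarrow>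
     (\<forall>c\<in>\<A>. \<forall>t\<in>\<T>.
        (\<forall>u. smooth_on (coord c ` (cdom c \<inter> tdom t)) (\<lambda>x. A c t x [u])) \<and>
        (\<forall>x\<in>coord c ` (cdom c \<inter> tdom t). linear (\<lambda>u. A c t x [u]))) \<and>
     (\<forall>c\<in>\<A>. \<forall>d\<in>\<A>. \<forall>t\<in>\<T>. \<forall>x\<in>coord c ` (cdom c \<inter> cdom d \<inter> tdom t). \<forall>u.
        A c t x [u] = A d t (transition c d x) [jac c d x *v u]) \<and>
     (\<forall>c\<in>\<A>. \<forall>s\<in>\<T>. \<forall>t\<in>\<T>. \<forall>x\<in>coord c ` (cdom c \<inter> tdom s \<inter> tdom t). \<forall>u.
        let h = bundle_transition \<pi> s t \<circ> param c in
        A c s x [u] = matrix_inv (h x) ** A c t x [u] ** h x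
                      + matrix_inv (h x) ** frechet_derivative h (at x) u)"

definition curvature ::
  "(real ^ 'n \<Rightarrow> ('n, 'k ^ 'r ^ 'r) form) \<Rightarrow> real ^ 'n \<Rightarrow> ('n::finite, 'k::bundle_scalar ^ 'r ^ 'r::finite) form" where
  "curvature A x vs = ext_deriv 1 A x vs + wedge (**) 1 1 (A x) (A x) vs"

definition ext_cov_deriv ::
  "nat \<Rightarrow> (real ^ 'n \<Rightarrow> ('n, 'k ^ 'r ^ 'r) form) \<Rightarrow> (real ^ 'n \<Rightarrow> ('n, 'k ^ 'r ^ 'r) form)
     \<Rightarrow> real ^ 'n \<Rightarrow> ('n::finite, 'k::bundle_scalar ^ 'r ^ 'r::finite) form" where
  "ext_cov_deriv k A \<alpha> x vs =
     ext_deriv k \<alpha> x vs + wedge (**) 1 k (A x) (\<alpha> x) vs - (-1) ^ k *\<^sub>R wedge (**) k 1 (\<alpha> x) (A x) vs"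

definition self_dual ::
  "real \<Rightarrow> ('a, 'n::{finite, linorder}) chart set \<Rightarrow> ('a, 'n) metric \<Rightarrow> ('a, 'n) endo_bundle
     \<Rightarrow> ('a, 'w, 'k::bundle_scalar, 'r::finite) triv set \<Rightarrow> ('a, 'n, 'w, 'k, 'r) conn \<Rightarrow> bool" where
  "self_dual \<mu> \<A> g Q \<T> A \<longleftrightarrow>
     (\<forall>c\<in>\<A>. \<forall>t\<in>\<T>. \<forall>x\<in>coord c ` (cdom c \<inter> tdom t). \<forall>u v.
        B_op (g c x) (fundamental_form (g c x) (Q c x)) (curvature (A c t) x) [u, v]
          = \<mu> *\<^sub>R curvature (A c t) x [u, v])"

definition yang_mills ::
  "('a, 'n::{finite, linorder}) chart set \<Rightarrow> ('a, 'n) metric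
     \<Rightarrow> ('a, 'w, 'k::bundle_scalar, 'r::finite) triv set \<Rightarrow> ('a, 'n, 'w, 'k, 'r) conn \<Rightarrow> bool" where
  "yang_mills \<A> g \<T> A \<longleftrightarrow>
     (\<forall>c\<in>\<A>. \<forall>t\<in>\<T>. \<forall>x\<in>coord c ` (cdom c \<inter> tdom t). \<forall>vs. length vs = CARD('n) - 1 \<longrightarrow>
        ext_cov_deriv (CARD('n) - 2) (A c t) (\<lambda>y. hodge (g c y) 2 (curvature (A c t) y)) x vs = 0)"


section \<open>Grassmann structures\<close>

text \<open>A local Grassmann structure, expressed in a chart: the bundles E and H are trivialised by local
  frames \<open>e a\<close>, \<open>h B\<close> over an open coordinate domain, \<open>theta y a B\<close> is the vector of components of the
  complex covector identified with the tensor product of \<open>e a\<close> and \<open>h B\<close>, and \<open>omE\<close>, \<open>omH\<close> are the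
  components of the symplectic forms.\<close>

record ('n, 'e) grassmann =
  gdom :: "(real ^ 'n) set"
  theta :: "real ^ 'n \<Rightarrow> 'e \<Rightarrow> 2 \<Rightarrow> complex ^ 'n"
  omE :: "real ^ 'n \<Rightarrow> complex ^ 'e ^ 'e"
  omH :: "real ^ 'n \<Rightarrow> complex ^ 2 ^ 2"

definition coval :: "complex ^ 'n \<Rightarrow> real ^ 'n::finite \<Rightarrow> complex" where
  "coval \<theta> u = (\<Sum>i\<in>UNIV. \<theta> $ i * complex_of_real (u $ i))"

text \<open>The last two conditions below say that the structure is associated to \<open>Q\<close>, i.e. \<open>Q\<close> acts on the
  factor H only, and that the holonomy group is contained in \<open>Sp(E) \<otimes> Sp(H)\<close>.\<close>

definition local_grassmann ::
  "('a::topological_space, 'n::finite) chart set \<Rightarrow> ('a, 'n) metric \<Rightarrow> ('a, 'n) endo_bundle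
     \<Rightarrow> ('a, 'n) chart \<Rightarrow> ('n, 'e::finite) grassmann \<Rightarrow> bool" where
  "local_grassmann \<A> g Q c \<Gamma> \<longleftrightarrow>
     open (gdom \<Gamma>) \<and> gdom \<Gamma> \<subseteq> img c \<and>
     (\<forall>a B. smooth_on (gdom \<Gamma>) (\<lambda>x. theta \<Gamma> x a B)) \<and>
     smooth_on (gdom \<Gamma>) (omE \<Gamma>) \<and> smooth_on (gdom \<Gamma>) (omH \<Gamma>) \<and>
     (\<forall>x\<in>gdom \<Gamma>.
        bij (\<lambda>z :: complex ^ ('e \<times> 2). \<Sum>a\<in>UNIV. \<Sum>B\<in>UNIV. z $ (a, B) *s theta \<Gamma> x a B) \<and>
        transpose (omE \<Gamma> x) = - omE \<Gamma> x \<and> invertible (omE \<Gamma> x) \<and>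
        transpose (omH \<Gamma> x) = - omH \<Gamma> x \<and> invertible (omH \<Gamma> x) \<and>
        (\<forall>u v. complex_of_real (u \<bullet> (g c x *v v)) =
           (\<Sum>a\<in>UNIV. \<Sum>b\<in>UNIV. \<Sum>A\<in>UNIV. \<Sum>B\<in>UNIV.
              omE \<Gamma> x $ a $ b * omH \<Gamma> x $ A $ B * coval (theta \<Gamma> x a A) u * coval (theta \<Gamma> x b B) v)) \<and>
        (\<forall>J\<in>Q c x. \<exists>j :: complex ^ 2 ^ 2. \<forall>a A u.
           coval (theta \<Gamma> x a A) (J *v u) = (\<Sum>B\<in>UNIV. j $ A $ B * coval (theta \<Gamma> x a B) u)) \<and>
        (\<forall>P\<in>holonomy_group \<A> g c x. \<exists>(p :: complex ^ 'e ^ 'e) (q :: complex ^ 2 ^ 2).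
           transpose p ** omE \<Gamma> x ** p = omE \<Gamma> x \<and> transpose q ** omH \<Gamma> x ** q = omH \<Gamma> x \<and>
           (\<forall>a A u. coval (theta \<Gamma> x a A) (P *v u) =
              (\<Sum>b\<in>UNIV. \<Sum>B\<in>UNIV. p $ a $ b * q $ A $ B * coval (theta \<Gamma> x b B) u))))"

text \<open>A family of local Grassmann structures, given by its coordinate expressions in all charts, that
  covers the manifold.\<close>

definition grassmann_structure ::
  "('a::topological_space, 'n::finite) chart set \<Rightarrow> ('a, 'n) metric \<Rightarrow> ('a, 'n) endo_bundle
     \<Rightarrow> (('a, 'n) chart \<Rightarrow> ('n, 'e::finite) grassmann set) \<Rightarrow> bool" where
  "grassmann_structure \<A> g Q \<G> \<longleftrightarrow>
     (\<forall>c\<in>\<A>. (\<forall>\<Gamma>\<in>\<G> c. local_grassmann \<A> g Q c \<Gamma>) \<and> (\<Union>\<Gamma>\<in>\<G> c. gdom \<Gamma>) = img c)"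

text \<open>An element of the tensor product of \<open>S\<^sup>2E\<close>, \<open>\<and>\<^sup>2H\<close> and (complexified) End W is given by
  components \<open>C a b A B\<close> with values in complex matrices, symmetric in \<open>a, b\<close> and skew in \<open>A, B\<close>.\<close>

definition half_flat ::
  "('a, 'n::finite) chart set \<Rightarrow> (('a, 'n) chart \<Rightarrow> ('n, 'e::finite) grassmann set)
     \<Rightarrow> ('a, 'w, 'k::bundle_scalar, 'r::finite) triv set \<Rightarrow> ('a, 'n, 'w, 'k, 'r) conn \<Rightarrow> bool" where
  "half_flat \<A> \<G> \<T> A \<longleftrightarrow>
     (\<forall>c\<in>\<A>. \<forall>\<Gamma>\<in>\<G> c. \<forall>t\<in>\<T>. \<forall>x\<in>gdom \<Gamma> \<inter> coord c ` (cdom c \<inter> tdom t).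
        \<exists>C :: 'e \<Rightarrow> 'e \<Rightarrow> 2 \<Rightarrow> 2 \<Rightarrow> complex ^ 'r ^ 'r.
          (\<forall>a b A B. C a b A B = C b a A B \<and> C a b A B = - C a b B A) \<and>
          (\<forall>u v i j. to_complex (curvature (A c t) x [u, v] $ i $ j) =
             (\<Sum>a\<in>UNIV. \<Sum>b\<in>UNIV. \<Sum>A\<in>UNIV. \<Sum>B\<in>UNIV.
                C a b A B $ i $ j * coval (theta \<Gamma> x a A) u * coval (theta \<Gamma> x b B) v)))"

end

theory Submission
  imports Defs "HOL-Combinatorics.Multiset_Permutations"
begin

hide_const (open) Transposition.transpose

text \<open>The form \<open>B\<^sub>\<Omega> F\<close> is half the contraction of \<open>\<Omega>\<close> with \<open>F\<close>, that is
  \<open>B\<^sub>\<Omega> F (u, v) = 1/6 (\<Sum>\<^sub>\<alpha> 2 F (J\<^sub>\<alpha> u, J\<^sub>\<alpha> v) - \<omega>\<^sub>\<alpha> (u, v) \<tau>\<^sub>\<alpha>)\<close>, where \<open>\<tau>\<^sub>\<alpha>\<close> is the trace of \<open>F (u, J\<^sub>\<alpha> v)\<close>.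
  If \<open>B\<^sub>\<Omega> F = F\<close>, taking traces gives \<open>6 \<tau>\<^sub>\<alpha> = - (n + 2) \<tau>\<^sub>\<alpha>\<close>, so the traces vanish and \<open>3 F\<close> is the sum of the
  three forms \<open>F (J\<^sub>\<alpha> u, J\<^sub>\<alpha> v)\<close>; applying \<open>J\<^sub>\<beta>\<close> to this identity shows that \<open>F\<close> is invariant under each \<open>J\<^sub>\<beta>\<close>. As
  the \<open>J\<^sub>\<alpha>\<close> act on the factor \<open>H\<close> of the Grassmann structure by anticommuting matrices of determinant 1 that generate all
  2 by 2 matrices, invariance means that the coefficients of \<open>F\<close> are skew in the indices of that factor, i.e. half-flatness.

  For the Yang-Mills equation, \<open>Q\<close> is parallel, so \<open>\<nabla>F\<close> is invariant under \<open>Q\<close> as well; tracing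
  the Bianchi identity with one \<open>J\<close> then shows that \<open>F\<close> is divergence free, which is \<open>d\<^sup>\<nabla> \<star> F = 0\<close>.\<close>


section \<open>Multilinear and alternating functions of lists\<close>

text \<open>The coordinate basis is not orthonormal, so every trace pairs
  \<open>matrix_inv G *v axis p 1\<close> with \<open>axis p 1\<close>, and the Hodge star is
  treated as a coordinate determinant times the density \<open>sqrt (det G)\<close>. The two
  densities in \<open>B_op\<close> cancel against the determinant of the inverse metric; this is why
  only a contraction with \<Omega> remains.

  Two kinds of bases of Q have to be reconciled. The fundamental form rests on an admissible basis
  picked separately at each point, whereas differentiation asks for a smooth one. Self-duality is
  therefore compared with invariance under the picked basis only. Half-flatness mentions no basis
  and is equivalent to invariance under any of them, which lets the Yang-Mills part continue with a
  smooth basis.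

  The members of a smooth basis are in general not parallel; only Q is. Invariance of F under J,
  which is quadratic in J, is therefore rewritten as skewness of F with respect to J. This condition
  is linear in J, extends to all of Q and so applies to the covariant derivative of J.\<close>

lemma eq_uminus_self_imp_0: "(x :: 'v::real_vector) = - x \<Longrightarrow> x = 0"
  by (metis add.right_inverse scaleR_2 scaleR_eq_0_iff zero_neq_numeral)

text \<open>Only lists of length k are constrained, since a form may take arbitrary values on all
  others; \<open>alternating\<close> follows the same convention.\<close>

definition multilinear :: "nat \<Rightarrow> ('u::real_vector list \<Rightarrow> 'v::real_vector) \<Rightarrow> bool" where
  "multilinear k X \<longleftrightarrow> (\<forall>vs i. length vs = k \<longrightarrow> i < k \<longrightarrow> linear (\<lambda>v. X (vs[i := v])))"

definition alternating :: "nat \<Rightarrow> ('u list \<Rightarrow> 'v::real_vector) \<Rightarrow> bool" where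
  "alternating k X \<longleftrightarrow> (\<forall>\<sigma> vs. \<sigma> permutes {..<k} \<longrightarrow> length vs = k \<longrightarrow>
     X (permute_list \<sigma> vs) = of_int (sign \<sigma>) *\<^sub>R X vs)"

text \<open>Splits off the first slot, which turns statements about k slots into inductions on
  k.\<close>

lemma multilinear_Suc:
  "multilinear (Suc k) X \<longleftrightarrow>
     (\<forall>vs. length vs = k \<longrightarrow> linear (\<lambda>v. X (v # vs))) \<and> (\<forall>v. multilinear k (\<lambda>vs. X (v # vs)))"
proof (intro iffI conjI allI impI)
  assume X: "multilinear (Suc k) X"
  fix vs :: "'a list" assume "length vs = k"
  then have "linear (\<lambda>v. X ((0 # vs)[0 := v]))"
    using X unfolding multilinear_def by (metis length_Cons zero_less_Suc)
  then show "linear (\<lambda>v. X (v # vs))" by simp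
next
  assume X: "multilinear (Suc k) X"
  fix v
  show "multilinear k (\<lambda>vs. X (v # vs))" unfolding multilinear_def
  proof (intro allI impI)
    fix vs :: "'a list" and i assume "length vs = k" "i < k"
    then have "linear (\<lambda>w. X ((v # vs)[Suc i := w]))"
      using X unfolding multilinear_def by (metis length_Cons Suc_less_eq)
    then show "linear (\<lambda>w. X (v # vs[i := w]))" by simp
  qed
next
  assume X: "(\<forall>vs. length vs = k \<longrightarrow> linear (\<lambda>v. X (v # vs))) \<and> (\<forall>v. multilinear k (\<lambda>vs. X (v # vs)))"
  show "multilinear (Suc k) X" unfolding multilinear_def
  proof (intro allI impI)
    fix vs :: "'a list" and i assume vs: "length vs = Suc k" "i < Suc k"
    then obtain w ws where ws: "vs = w # ws" "length ws = k" by (auto simp: length_Suc_conv)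
    show "linear (\<lambda>v. X (vs[i := v]))"
    proof (cases i)
      case 0 then show ?thesis using X ws by simp
    next
      case (Suc j)
      then have "j < k" using vs by simp
      then have "linear (\<lambda>v. (\<lambda>us. X (w # us)) (ws[j := v]))"
        using X ws unfolding multilinear_def by blast
      then show ?thesis using Suc ws by simp
    qed
  qed
qed

lemma multilinear_0 [simp]: "multilinear 0 X"
  by (simp add: multilinear_def)

lemma finite_lists_length [simp]: "finite {xs :: 'n::finite list. length xs = k}"
  using finite_lists_length_eq[of "UNIV :: 'n set" k] by simp

lemma sum_lists_Suc:
  fixes f :: "'n::finite list \<Rightarrow> 'v::comm_monoid_add"
  shows "(\<Sum>xs | length xs = Suc k. f xs) = (\<Sum>x\<in>UNIV. \<Sum>xs | length xs = k. f (x # xs))"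
proof -
  have "(\<Sum>x\<in>UNIV. \<Sum>xs | length xs = k. f (x # xs)) =
      (\<Sum>(x, xs)\<in>UNIV \<times> {xs. length xs = k}. f (x # xs))"
    by (simp add: sum.cartesian_product)
  also have "\<dots> = (\<Sum>xs | length xs = Suc k. f xs)"
    by (rule sum.reindex_bij_witness[of _ "\<lambda>xs. (hd xs, tl xs)" "\<lambda>(x, xs). x # xs"])
       (auto simp: length_Suc_conv)
  finally show ?thesis by simp
qed

lemma sum_lists_append:
  fixes f :: "'n::finite list \<Rightarrow> 'v::comm_monoid_add"
  shows "(\<Sum>xs | length xs = k + l. f xs) =
    (\<Sum>xs | length xs = k. \<Sum>ys | length ys = l. f (xs @ ys))"
proof (induction k arbitrary: f)
  case (Suc k)
  show ?case by (simp add: sum_lists_Suc Suc)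
qed simp

lemma sum_lists_0: "(\<Sum>xs | length xs = 0. f xs) = f []"
  by simp

lemma linear_eq_sum_axis:
  fixes f :: "real ^ 'n \<Rightarrow> 'v::real_vector"
  assumes "linear f"
  shows "f v = (\<Sum>i\<in>UNIV. v $ i *\<^sub>R f (axis i 1))"
proof -
  have "f v = f (\<Sum>i\<in>UNIV. v $ i *\<^sub>R axis i 1)"
    using basis_expansion[of v] by (simp add: scalar_mult_eq_scaleR)
  also have "\<dots> = (\<Sum>i\<in>UNIV. v $ i *\<^sub>R f (axis i 1))"
    using assms by (simp add: linear_sum linear_cmul)
  finally show ?thesis .
qed

lemma multilinear_expand:
  fixes X :: "(real ^ 'n) list \<Rightarrow> 'v::real_vector"
  assumes "multilinear k X" "length vs = k"
  shows "X vs = (\<Sum>is | length is = k. (\<Prod>a<k. vs ! a $ (is ! a)) *\<^sub>R X (map (\<lambda>i. axis i 1) is))"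
  using assms
proof (induction k arbitrary: X vs)
  case (Suc k)
  then obtain w ws where ws: "vs = w # ws" "length ws = k" by (auto simp: length_Suc_conv)
  have lin: "linear (\<lambda>v. X (v # ws))" and ml: "\<And>v. multilinear k (\<lambda>vs. X (v # vs))"
    using Suc.prems(1) ws by (auto simp: multilinear_Suc)
  have "X vs = (\<Sum>i\<in>UNIV. w $ i *\<^sub>R X (axis i 1 # ws))"
    unfolding ws(1) by (rule linear_eq_sum_axis[OF lin])
  also have "\<dots> = (\<Sum>i\<in>UNIV. w $ i *\<^sub>R (\<Sum>is | length is = k.
      (\<Prod>a<k. ws ! a $ (is ! a)) *\<^sub>R X (axis i 1 # map (\<lambda>i. axis i 1) is)))"
    by (simp only: Suc.IH[OF ml ws(2)])
  also have "\<dots> = (\<Sum>is | length is = Suc k.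
      (\<Prod>a<Suc k. vs ! a $ (is ! a)) *\<^sub>R X (map (\<lambda>i. axis i 1) is))"
  proof -
    have eq: "(\<Prod>a<Suc k. (w # ws) ! a $ ((i # is) ! a)) = w $ i * (\<Prod>a<k. ws ! a $ (is ! a))" for i "is"
      by (subst prod.lessThan_Suc_shift) simp
    show ?thesis
      unfolding ws(1) sum_lists_Suc eq by (simp only: list.map scaleR_sum_right scaleR_scaleR)
  qed
  finally show ?case .
qed simp

lemma multilinear_ext:
  fixes X Y :: "(real ^ 'n) list \<Rightarrow> 'v::real_vector"
  assumes "multilinear k X" "multilinear k Y" "length vs = k"
    and "\<And>is. length is = k \<Longrightarrow> X (map (\<lambda>i. axis i 1) is) = Y (map (\<lambda>i. axis i 1) is)"
  shows "X vs = Y vs"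
  unfolding multilinear_expand[OF assms(1,3)] multilinear_expand[OF assms(2,3)]
  by (intro sum.cong refl) (simp add: assms(4))

text \<open>A full contraction is an iterated contraction of single slots, so a replacement of dual
  bases that is harmless for linear functions is harmless for multilinear ones. It serves to absorb
  a metric and its inverse in all slots at once.\<close>

lemma sum_lists_contract_cong:
  fixes X :: "(real ^ 'n) list \<Rightarrow> real" and Y :: "(real ^ 'n) list \<Rightarrow> 'v::real_vector"
  assumes step: "\<And>\<phi> (\<psi> :: real ^ 'n \<Rightarrow> 'v). linear \<phi> \<Longrightarrow> linear \<psi> \<Longrightarrow>
      (\<Sum>i\<in>UNIV. \<phi> (a i) *\<^sub>R \<psi> (b i)) = (\<Sum>i\<in>UNIV. \<phi> (a' i) *\<^sub>R \<psi> (b' i))"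
    and "multilinear k X" "multilinear k Y"
  shows "(\<Sum>is | length is = k. X (map a (is :: 'i::finite list)) *\<^sub>R Y (map b is)) =
    (\<Sum>is | length is = k. X (map a' (is :: 'i list)) *\<^sub>R Y (map b' is))"
  using assms(2,3)
proof (induction k arbitrary: X Y)
  case (Suc k)
  have lin: "linear (\<lambda>v. X (v # vs))" "linear (\<lambda>v. Y (v # vs))" if "length vs = k" for vs
    using Suc.prems that by (auto simp: multilinear_Suc)
  have ml: "\<And>v. multilinear k (\<lambda>vs. X (v # vs))" "\<And>v. multilinear k (\<lambda>vs. Y (v # vs))"
    using Suc.prems by (auto simp: multilinear_Suc)
  have "(\<Sum>is | length is = Suc k. X (map a is) *\<^sub>R Y (map b is)) =
     (\<Sum>i\<in>UNIV. \<Sum>is | length is = k. X (a i # map a' is) *\<^sub>R Y (b i # map b' is))"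
    by (simp add: sum_lists_Suc Suc.IH[OF ml])
  also have "\<dots> = (\<Sum>is | length is = k. \<Sum>i\<in>UNIV. X (a i # map a' is) *\<^sub>R Y (b i # map b' is))"
    by (rule sum.swap)
  also have "\<dots> = (\<Sum>is | length is = k. \<Sum>i\<in>UNIV. X (a' i # map a' is) *\<^sub>R Y (b' i # map b' is))"
    by (intro sum.cong refl step lin) auto
  also have "\<dots> = (\<Sum>is | length is = Suc k. X (map a' is) *\<^sub>R Y (map b' is))"
    unfolding sum_lists_Suc list.map by (rule sum.swap)
  finally show ?case .
qed simp

lemma permute_list_append_left:
  assumes "\<sigma> permutes {..<length xs}"
  shows "permute_list \<sigma> (xs @ ys) = permute_list \<sigma> xs @ ys"
proof (rule nth_equalityI)
  fix i assume "i < length (permute_list \<sigma> (xs @ ys))"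
  then have i: "i < length xs + length ys" by simp
  have p: "\<sigma> permutes {..<length (xs @ ys)}"
    using assms by (rule permutes_subset) auto
  show "permute_list \<sigma> (xs @ ys) ! i = (permute_list \<sigma> xs @ ys) ! i"
  proof (cases "i < length xs")
    case True
    then have "\<sigma> i < length xs" using permutes_in_image[OF assms] by auto
    then show ?thesis using True i permute_list_nth[OF p] permute_list_nth[OF assms]
      by (simp add: nth_append)
  next
    case False
    then have "\<sigma> i = i" using assms by (auto simp: permutes_def)
    then show ?thesis using False i permute_list_nth[OF p] by (simp add: nth_append)
  qed
qed simp

lemma transpose_permutes: "a < k \<Longrightarrow> b < k \<Longrightarrow> Transposition.transpose a b permutes {..<k::nat}"
  by (intro permutes_swap_id) auto

lemma permute_list_transpose:
  assumes "a < length vs" "b < length vs"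
  shows "permute_list (Transposition.transpose a b) vs = vs[a := vs ! b, b := vs ! a]"
  using assms by (intro nth_equalityI)
    (auto simp: permute_list_def nth_list_update Transposition.transpose_def)

text \<open>Transpositions generate the symmetric group and \<open>sign\<close> is multiplicative
  along the induction, so for a concrete form only the exchange of two slots has to be
  checked.\<close>

lemma alternating_if_swap:
  assumes "\<And>vs a b. length vs = k \<Longrightarrow> a < k \<Longrightarrow> b < k \<Longrightarrow> a \<noteq> b \<Longrightarrow>
    X (vs[a := vs ! b, b := vs ! a]) = - X vs"
  shows "alternating k X"
  unfolding alternating_def
proof (intro allI impI)
  fix \<sigma> and vs :: "'a list" assume "\<sigma> permutes {..<k}" "length vs = k"
  with finite_lessThan[of k] show "X (permute_list \<sigma> vs) = of_int (sign \<sigma>) *\<^sub>R X vs"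
  proof (induction \<sigma> arbitrary: vs rule: permutes_rev_induct)
    case id
    then show ?case by simp
  next
    case (swap a b p)
    note t = transpose_permutes[of a k b]
    have ab: "a < k" "b < k" using swap.hyps by auto
    have "p permutes {..<k}" using swap by auto
    then have "X (permute_list (p \<circ> Transposition.transpose a b) vs) = X (permute_list (Transposition.transpose a b) (permute_list p vs))"
      using t ab swap by (subst permute_list_compose) auto
    also have "\<dots> = - X (permute_list p vs)"
      using swap.prems swap.hyps ab assms[of "permute_list p vs" a b]
      by (subst permute_list_transpose) simp_all
    also have "\<dots> = of_int (sign (p \<circ> Transposition.transpose a b)) *\<^sub>R X vs"
      using swap \<open>p permutes {..<k}\<close>
      by (subst sign_compose)
         (auto simp: sign_swap_id permutation_permutes intro: exI[of _ "{..<k}"] t[OF ab])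
    finally show ?case by (simp add: o_def)
  qed
qed

lemma alternating_append:
  assumes "alternating (k + l) X" "length ys = l"
  shows "alternating k (\<lambda>xs. X (xs @ ys))"
  unfolding alternating_def
proof (intro allI impI)
  fix \<sigma> and vs :: "'a list" assume s: "\<sigma> permutes {..<k}" and vs: "length vs = k"
  have "X (permute_list \<sigma> (vs @ ys)) = of_int (sign \<sigma>) *\<^sub>R X (vs @ ys)"
    using assms s vs permutes_subset[OF s, of "{..<k + l}"] by (auto simp: alternating_def)
  then show "X (permute_list \<sigma> vs @ ys) = of_int (sign \<sigma>) *\<^sub>R X (vs @ ys)"
    using permute_list_append_left s vs by metis
qed

lemma alternating_swap:
  assumes "alternating k X" "length vs = k" "a < k" "b < k" "a \<noteq> b"
  shows "X (vs[a := vs ! b, b := vs ! a]) = - X vs"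
  using assms transpose_permutes[of a k b]
  by (simp add: alternating_def permute_list_transpose[symmetric] sign_swap_id)

lemma alternating_not_distinct:
  assumes "alternating k X" "length vs = k" "\<not> distinct vs"
  shows "X vs = 0"
proof -
  obtain a b where ab: "a < k" "b < k" "a \<noteq> b" "vs ! a = vs ! b"
    using assms(2,3) by (auto simp: distinct_conv_nth)
  then have "vs[a := vs ! b, b := vs ! a] = vs" using assms(2)
    by (metis list_update_id)
  then have "X vs = - X vs" using alternating_swap[OF assms(1,2) ab(1-3)] by simp
  then show ?thesis by (rule eq_uminus_self_imp_0)
qed

text \<open>Both factors pick up the sign of the same permutation, and its square is 1.\<close>

lemma alternating_product_mset_eq:
  assumes "alternating k X" "alternating k Y" "length ys = k" "mset xs = mset ys"
  shows "X xs *\<^sub>R Y xs = (X ys :: real) *\<^sub>R Y ys"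
proof -
  obtain p where p: "p permutes {..<length ys}" "permute_list p ys = xs"
    using mset_eq_permutation assms(4) by blast
  then have "X xs = of_int (sign p) *\<^sub>R X ys" "Y xs = of_int (sign p) *\<^sub>R Y ys"
    using assms by (auto simp: alternating_def)
  moreover have "of_int (sign p) * of_int (sign p) = (1::real)"
    by (metis of_int_1 of_int_mult sign_idempotent)
  ultimately show ?thesis by (simp add: mult.assoc[symmetric])
qed

lemma multilinear_sum:
  assumes "\<And>a. a \<in> S \<Longrightarrow> multilinear k (X a)"
  shows "multilinear k (\<lambda>vs. \<Sum>a\<in>S. X a vs)"
  using assms by (auto simp: multilinear_def intro!: linear_compose_sum)

lemma multilinear_scaleR:
  "multilinear k X \<Longrightarrow> multilinear k (\<lambda>vs. c *\<^sub>R X vs)"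
  by (auto simp: multilinear_def intro!: linear_compose_scale_right)

lemma multilinear_scaleR_left:
  assumes "multilinear k X" shows "multilinear k (\<lambda>vs. X vs *\<^sub>R c)"
  using assms by (auto simp: multilinear_def linear_iff scaleR_left.add)

lemma multilinear_append:
  assumes "multilinear (k + l) X" "length ys = l"
  shows "multilinear k (\<lambda>xs. X (xs @ ys))"
  unfolding multilinear_def
proof (intro allI impI)
  fix vs :: "'a list" and i assume "length vs = k" "i < k"
  then have "linear (\<lambda>v. X ((vs @ ys)[i := v]))"
    using assms unfolding multilinear_def by simp
  then show "linear (\<lambda>v. X (vs[i := v] @ ys))" using \<open>i < k\<close> \<open>length vs = k\<close>
    by (simp add: list_update_append)
qed

lemma multilinear_append2:
  assumes "multilinear (l + k) X" "length ys = l"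
  shows "multilinear k (\<lambda>xs. X (ys @ xs))"
  unfolding multilinear_def
proof (intro allI impI)
  fix vs :: "'a list" and i assume "length vs = k" "i < k"
  then have "linear (\<lambda>v. X ((ys @ vs)[l + i := v]))"
    using assms unfolding multilinear_def by simp
  then show "linear (\<lambda>v. X (ys @ vs[i := v]))" using \<open>i < k\<close> \<open>length vs = k\<close> assms(2)
    by (simp add: list_update_append)
qed

lemma multilinear_permute:
  assumes "multilinear k X" "\<sigma> permutes {..<k}"
  shows "multilinear k (\<lambda>xs. X (permute_list \<sigma> xs))"
  unfolding multilinear_def
proof (intro allI impI)
  fix vs :: "'a list" and i assume vs: "length vs = k" "i < k"
  have p: "permute_list \<sigma> (vs[i := v]) = (permute_list \<sigma> vs)[inv \<sigma> i := v]" for v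
  proof (rule nth_equalityI)
    fix j assume "j < length (permute_list \<sigma> (vs[i := v]))"
    then have j: "j < k" using vs by simp
    then have "\<sigma> j < k" using permutes_in_image[OF assms(2)] by auto
    moreover have "\<sigma> j = i \<longleftrightarrow> inv \<sigma> i = j"
      using permutes_inverses[OF assms(2)] by auto
    ultimately show "permute_list \<sigma> (vs[i := v]) ! j = (permute_list \<sigma> vs)[inv \<sigma> i := v] ! j"
      using j vs assms(2) by (auto simp: permute_list_nth nth_list_update)
  qed simp
  have "inv \<sigma> i < k" using permutes_in_image[OF permutes_inv[OF assms(2)]] vs by auto
  then show "linear (\<lambda>v. X (permute_list \<sigma> (vs[i := v])))"
    unfolding p using assms(1) vs by (simp add: multilinear_def)
qed

lemma multilinear_product:
  assumes "bilinear prd" "multilinear k X" "multilinear l Y"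
  shows "multilinear (k + l) (\<lambda>vs. prd (X (take k vs)) (Y (drop k vs)))"
  unfolding multilinear_def
proof (intro allI impI)
  fix vs :: "'d list" and i assume vs: "length vs = k + l" "i < k + l"
  show "linear (\<lambda>v. prd (X (take k (vs[i := v]))) (Y (drop k (vs[i := v]))))"
  proof (cases "i < k")
    case True
    then have "linear (\<lambda>v. X ((take k vs)[i := v]))"
      using assms(2) vs by (simp add: multilinear_def)
    from linear_compose[OF this, of "\<lambda>x. prd x (Y (drop k vs))"]
    show ?thesis using True assms(1)
      by (simp add: o_def bilinear_def take_update_swap)
  next
    case False
    then have "linear (\<lambda>v. Y ((drop k vs)[i - k := v]))"
      using assms(3) vs by (simp add: multilinear_def)
    from linear_compose[OF this, of "\<lambda>x. prd (X (take k vs)) x"]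
    show ?thesis using False assms(1)
      by (simp add: o_def bilinear_def drop_update_swap)
  qed
qed

section \<open>Wedge products and their contractions\<close>

lemma wedge_permute_list:
  assumes "length vs = k + l"
  shows "wedge prd k l \<alpha> \<beta> vs = (1 / (fact k * fact l)) *\<^sub>R
    (\<Sum>\<sigma> | \<sigma> permutes {..<k + l}. of_int (sign \<sigma>) *\<^sub>R
       prd (\<alpha> (take k (permute_list \<sigma> vs))) (\<beta> (drop k (permute_list \<sigma> vs))))"
  by (simp add: wedge_def permute_list_def assms take_map drop_map take_upt)

lemma multilinear_wedge:
  assumes "bilinear prd" "multilinear k \<alpha>" "multilinear l \<beta>"
  shows "multilinear (k + l) (wedge prd k l \<alpha> \<beta>)"
proof -
  have "multilinear (k + l) (\<lambda>vs. (1 / (fact k * fact l)) *\<^sub>R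
    (\<Sum>\<sigma> | \<sigma> permutes {..<k + l}. of_int (sign \<sigma>) *\<^sub>R
       prd (\<alpha> (take k (permute_list \<sigma> vs))) (\<beta> (drop k (permute_list \<sigma> vs)))))"
    by (intro multilinear_scaleR multilinear_sum
        multilinear_permute[of _ "\<lambda>vs. prd (\<alpha> (take k vs)) (\<beta> (drop k vs))"] multilinear_product assms) auto
  then show ?thesis unfolding multilinear_def by (simp add: wedge_permute_list)
qed

lemma permute_list_bij:
  assumes "\<sigma> permutes {..<k}"
  shows "bij_betw (permute_list \<sigma>) {xs :: 'n list. length xs = k} {xs. length xs = k}"
proof (rule bij_betw_byWitness[where f' = "permute_list (inv \<sigma>)"])
  have "permute_list (inv \<sigma>) (permute_list \<sigma> xs) = xs" if "length xs = k" for xs :: "'n list"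
    using that permutes_inv[OF assms] permute_list_compose[of "inv \<sigma>" xs \<sigma>] 
    by (simp add: permutes_inv_o[OF assms])
  then show "\<forall>a\<in>{xs :: 'n list. length xs = k}. permute_list (inv \<sigma>) (permute_list \<sigma> a) = a" by simp
  have "permute_list \<sigma> (permute_list (inv \<sigma>) xs) = xs" if "length xs = k" for xs :: "'n list"
    using that assms permute_list_compose[of \<sigma> xs "inv \<sigma>"]
    by (simp add: permutes_inv_o[OF assms])
  then show "\<forall>a'\<in>{xs :: 'n list. length xs = k}. permute_list \<sigma> (permute_list (inv \<sigma>) a') = a'" by simp
qed auto

text \<open>Against an alternating X all permutations in the definition of \<open>wedge\<close>
  contribute equally: reindexing the sum over lists by \<sigma> produces the sign of \<sigma> a
  second time. What remains is the number of permutations.\<close>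

lemma contract_wedge:
  fixes X :: "(real ^ 'n) list \<Rightarrow> real"
  assumes "alternating (k + l) X"
  shows "(\<Sum>is | length is = k + l. X (map a is) *\<^sub>R wedge prd k l \<alpha> \<beta> (map b (is :: 'i::finite list))) =
    (fact (k + l) / (fact k * fact l)) *\<^sub>R (\<Sum>is | length is = k. \<Sum>js | length js = l.
       X (map a is @ map a js) *\<^sub>R prd (\<alpha> (map b is)) (\<beta> (map b js)))"
proof -
  define W where "W vs = prd (\<alpha> (take k vs)) (\<beta> (drop k vs))" for vs
  have "(\<Sum>is | length is = k + l. X (map a is) *\<^sub>R wedge prd k l \<alpha> \<beta> (map b is)) =
     (\<Sum>is :: 'i list | length is = k + l. (1 / (fact k * fact l)) *\<^sub>R (\<Sum>\<sigma> | \<sigma> permutes {..<k + l}.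
        (of_int (sign \<sigma>) * X (map a is)) *\<^sub>R W (permute_list \<sigma> (map b is))))"
    by (intro sum.cong refl)
       (simp add: wedge_permute_list W_def scaleR_sum_right mult_ac)
  also have "\<dots> = (1 / (fact k * fact l)) *\<^sub>R (\<Sum>\<sigma> | \<sigma> permutes {..<k + l}. \<Sum>is :: 'i list | length is = k + l. 
        (of_int (sign \<sigma>) * X (map a is)) *\<^sub>R W (permute_list \<sigma> (map b is)))"
    by (simp add: scaleR_sum_right[symmetric]) (subst sum.swap, rule refl)
  also have "(\<Sum>\<sigma> | \<sigma> permutes {..<k + l}. \<Sum>is :: 'i list | length is = k + l. 
        (of_int (sign \<sigma>) * X (map a is)) *\<^sub>R W (permute_list \<sigma> (map b is))) =
     (\<Sum>\<sigma> | \<sigma> permutes {..<k + l}. \<Sum>is :: 'i list | length is = k + l. X (map a is) *\<^sub>R W (map b is))"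
  proof (rule sum.cong[OF refl])
    fix \<sigma> assume "\<sigma> \<in> {\<sigma>. \<sigma> permutes {..<k + l}}"
    then have s: "\<sigma> permutes {..<k + l}" by simp
    have "(\<Sum>is :: 'i list | length is = k + l. X (map a is) *\<^sub>R W (map b is)) =
      (\<Sum>is :: 'i list | length is = k + l. X (map a (permute_list \<sigma> is)) *\<^sub>R W (map b (permute_list \<sigma> is)))"
      by (rule sum.reindex_bij_betw[OF permute_list_bij[OF s], symmetric])
    also have "\<dots> = (\<Sum>is :: 'i list | length is = k + l. 
        (of_int (sign \<sigma>) * X (map a is)) *\<^sub>R W (permute_list \<sigma> (map b is)))"
    proof (intro sum.cong refl)
      fix xs :: "'i list" assume "xs \<in> {xs. length xs = k + l}"
      then have xs: "length xs = k + l" by simp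
      then have "X (permute_list \<sigma> (map a xs)) = of_int (sign \<sigma>) *\<^sub>R X (map a xs)"
        using assms s by (simp add: alternating_def)
      then show "X (map a (permute_list \<sigma> xs)) *\<^sub>R W (map b (permute_list \<sigma> xs)) =
        (of_int (sign \<sigma>) * X (map a xs)) *\<^sub>R W (permute_list \<sigma> (map b xs))"
        using xs s by (simp add: permute_list_map)
    qed
    finally show "(\<Sum>is :: 'i list | length is = k + l. 
        (of_int (sign \<sigma>) * X (map a is)) *\<^sub>R W (permute_list \<sigma> (map b is))) =
        (\<Sum>is :: 'i list | length is = k + l. X (map a is) *\<^sub>R W (map b is))" by simp
  qed
  also have "\<dots> = fact (k + l) *\<^sub>R (\<Sum>is :: 'i list | length is = k + l. X (map a is) *\<^sub>R W (map b is))"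
    using card_permutations[of "{..<k + l}" "k + l"]
    by (simp add: sum_constant_scaleR)
  finally show ?thesis by (simp add: sum_lists_append W_def)
qed

section \<open>The Hodge star and the operator of a 4-form\<close>

lemma alternating_swap_adjacent:
  assumes "alternating k X" "length us + length ws + 2 = k"
  shows "X (us @ b # a # ws) = - X (us @ a # b # ws)"
  using alternating_swap[OF assms(1), of "us @ a # b # ws" "length us" "Suc (length us)"] assms(2)
  by (simp add: nth_append list_update_append)

lemma alternating_move:
  assumes "alternating k X" "length us + length xs + length zs + 1 = k"
  shows "X (us @ xs @ y # zs) = (-1) ^ length xs *\<^sub>R X (us @ y # xs @ zs)"
  using assms(2)
proof (induction xs arbitrary: zs rule: rev_induct)
  case (snoc x xs)
  have "X (us @ (xs @ [x]) @ y # zs) = - X (us @ xs @ y # x # zs)"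
    using alternating_swap_adjacent[OF assms(1), of "us @ xs" zs x y] snoc.prems by simp
  also have "\<dots> = - ((-1) ^ length xs *\<^sub>R X (us @ y # xs @ x # zs))"
    using snoc.prems by (subst snoc.IH) simp_all
  finally show ?case by simp
qed simp

lemma alternating_append_commute:
  assumes "alternating k X" "length xs + length ys = k"
  shows "X (xs @ ys) = (-1) ^ (length xs * length ys) *\<^sub>R X (ys @ xs)"
proof -
  have "X (us @ xs @ ys) = (-1) ^ (length xs * length ys) *\<^sub>R X (us @ ys @ xs)"
    if "length us + length xs + length ys = k" for us
    using that
  proof (induction ys arbitrary: us)
    case (Cons y ys)
    have "X (us @ xs @ y # ys) = (-1) ^ length xs *\<^sub>R X ((us @ [y]) @ xs @ ys)"
      using alternating_move[OF assms(1), of us xs ys y] Cons.prems by simp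
    also have "\<dots> = (-1) ^ length xs *\<^sub>R (-1) ^ (length xs * length ys) *\<^sub>R X ((us @ [y]) @ ys @ xs)"
      using Cons.prems by (subst Cons.IH) simp_all
    finally show ?case by (simp add: power_add)
  qed simp
  from this[of "[]"] show ?thesis using assms(2) by simp
qed

section \<open>The coordinate volume form\<close>

definition position :: "'n::{finite, linorder} \<Rightarrow> nat" where
  "position i = card {j. j < i}"

text \<open>The volume form stripped of its density. It does not depend on the point, so the whole
  dependence on the metric sits in scalar coefficients.\<close>

definition vol :: "(real ^ 'n::{finite, linorder}) list \<Rightarrow> real" where
  "vol vs = det (\<chi> i :: 'n::{finite, linorder}. vs ! position i)"

lemma vol_form_eq: "vol_form G vs = sqrt (det G) * vol vs"
  by (simp add: vol_form_def vol_def position_def)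

lemma position_bij: "bij_betw position (UNIV :: 'n::{finite, linorder} set) {..<CARD('n)}"
proof -
  have less: "position i < position j" if "i < j" for i j :: 'n
    unfolding position_def using that by (intro psubset_card_mono) (auto simp: psubset_eq)
  have inj: "inj (position :: 'n \<Rightarrow> nat)"
    by (rule injI) (metis less less_irrefl linorder_neqE)
  have "position i < CARD('n)" for i :: 'n
    unfolding position_def by (intro psubset_card_mono) auto
  then have "position ` (UNIV :: 'n set) \<subseteq> {..<CARD('n)}" by auto
  then have "position ` (UNIV :: 'n set) = {..<CARD('n)}"
    using inj by (intro card_subset_eq) (auto simp: card_image)
  then show ?thesis using inj by (simp add: bij_betw_def)
qed

lemma position_less [simp]: "position (i :: 'n::{finite, linorder}) < CARD('n)"
  using position_bij by (auto simp: bij_betw_def)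

lemma position_inject [simp]: "position (i :: 'n::{finite, linorder}) = position j \<longleftrightarrow> i = j"
  using position_bij by (auto simp: bij_betw_def inj_on_def)

lemma position_surj:
  assumes "a < CARD('n)" obtains i :: "'n::{finite, linorder}" where "a = position i"
  using position_bij[where 'n = 'n] assms by (auto simp: bij_betw_def)

lemma multilinear_vol: "multilinear CARD('n) (vol :: (real ^ 'n::{finite, linorder}) list \<Rightarrow> real)"
  unfolding multilinear_def
proof (intro allI impI)
  fix vs :: "((real, 'n) vec) list" and a assume len: "length vs = CARD('n)" and "a < CARD('n)"
  then obtain r :: 'n where r: "a = position r" using position_surj by blast
  have eq: "vol (vs[a := v]) = det (\<chi> i. if i = r then v else vs ! position i)" for v
    unfolding vol_def using len r by (intro arg_cong[where f = det]) (auto simp: vec_eq_iff nth_list_update)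
  show "linear (\<lambda>v. vol (vs[a := v]))"
    unfolding eq
  proof (rule linearI)
    fix c and w :: "(real, 'n) vec"
    show "det (\<chi> i. if i = r then c *\<^sub>R w else vs ! position i) =
        c *\<^sub>R det (\<chi> i. if i = r then w else vs ! position i)"
      using det_row_mul[where k = r and c = c and a = "\<lambda>_. w" and b = "\<lambda>i. vs ! position i"]
      by (simp add: scalar_mult_eq_scaleR cong: if_cong)
  qed (simp add: det_row_add)
qed

lemma alternating_vol: "alternating CARD('n) (vol :: (real ^ 'n::{finite, linorder}) list \<Rightarrow> real)"
proof (rule alternating_if_swap)
  fix vs :: "((real, 'n) vec) list" and a b
  assume len: "length vs = CARD('n)" and ab: "a < CARD('n)" "b < CARD('n)" "a \<noteq> b"
  then obtain r s :: 'n where r: "a = position r" and s: "b = position s" using position_surj by metis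
  then have rs: "r \<noteq> s" using ab by auto
  let ?A = "(\<chi> i. vs ! position i) :: ((real, 'n) vec, 'n) vec"
  have "vol (vs[a := vs ! b, b := vs ! a]) = det (\<chi> i. ?A $ Transposition.transpose r s i)"
    unfolding vol_def using len r s rs
    by (intro arg_cong[where f = det]) (auto simp: vec_eq_iff nth_list_update Transposition.transpose_def)
  also have "\<dots> = - vol vs"
    using rs permutes_swap_id[of r UNIV s]
    by (subst det_permute_rows) (simp_all add: sign_swap_id vol_def)
  finally show "vol (vs[a := vs ! b, b := vs ! a]) = - vol vs" .
qed

text \<open>The value is the sign of the permutation listed by xs; in the double contraction below
  it occurs only squared.\<close>

lemma vol_axis_distinct:
  assumes "length xs = CARD('n)" "distinct (xs :: 'n::{finite, linorder} list)"
  shows "vol (map (\<lambda>i. axis i 1) xs) * vol (map (\<lambda>i. axis i 1) xs) = 1"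
proof -
  define p where "p i = xs ! position i" for i :: 'n
  have pos: "position i < length xs" for i :: 'n using assms by simp
  have "inj p" unfolding p_def inj_def using nth_eq_iff_index_eq[OF assms(2) pos pos] by simp
  then have "bij p" by (simp add: finite_UNIV_inj_surj bij_def)
  then have p: "p permutes UNIV" by (intro bij_imp_permutes) auto
  have "vol (map (\<lambda>i. axis i 1) xs) = det (\<chi> i. (mat 1 :: ((real, 'n) vec, 'n) vec) $ p i)"
    unfolding vol_def p_def using assms
    by (intro arg_cong[where f = det]) (auto simp: vec_eq_iff mat_def axis_def)
  also have "\<dots> = of_int (sign p)" using p by (simp add: det_permute_rows)
  finally show ?thesis by (metis of_int_1 of_int_mult sign_idempotent)
qed

lemma vol_map:
  assumes "length vs = CARD('n)"
  shows "vol (map ((*v) M) vs) = det M * vol (vs :: (real ^ 'n::{finite, linorder}) list)"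
proof -
  have "(\<chi> i :: 'n. map ((*v) M) vs ! position i) = (\<chi> i. vs ! position i) ** transpose M"
    using assms
    by (simp add: vec_eq_iff matrix_matrix_mult_def matrix_vector_mult_def transpose_def mult.commute)
  then show ?thesis by (simp add: vol_def det_mul)
qed

text \<open>For a fixed list of the last indices, the product of the two alternating factors is symmetric in the first
  ones, so on a basis only the permutations of one list contribute, each by the same amount.\<close>

lemma contract_vol:
  fixes \<Omega> :: "(real ^ 'n::{finite, linorder}) list \<Rightarrow> 'v::real_vector"
  assumes ml: "multilinear k \<Omega>" and alt: "alternating k \<Omega>" and k: "k + l = CARD('n)" and b: "length b = k"
  shows "(\<Sum>ks | length ks = l. vol (b @ map (\<lambda>i. axis i 1) ks) *\<^sub>R
     (\<Sum>js | length js = k. vol (map (\<lambda>i. axis i 1) js @ map (\<lambda>i. axis i 1) ks) *\<^sub>R \<Omega> (map (\<lambda>i. axis i 1) js)))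
    = (fact k * fact l) *\<^sub>R \<Omega> b"
  using multilinear_sum[of "{ks. length ks = l}" k "\<lambda>ks b. vol (b @ map (\<lambda>i. axis i 1) ks) *\<^sub>R
     (\<Sum>js | length js = k. vol (map (\<lambda>i. axis i 1) js @ map (\<lambda>i. axis i 1) ks) *\<^sub>R \<Omega> (map (\<lambda>i. axis i 1) js))"]
     multilinear_scaleR[OF ml] b
proof (rule multilinear_ext)
  fix ks :: "'n list" assume "ks \<in> {ks. length ks = l}"
  then show "multilinear k (\<lambda>b. vol (b @ map (\<lambda>i. axis i 1) ks) *\<^sub>R
     (\<Sum>js | length js = k. vol (map (\<lambda>i. axis i 1) js @ map (\<lambda>i. axis i 1) ks) *\<^sub>R \<Omega> (map (\<lambda>i. axis i 1) js)))"
    using k by (intro multilinear_scaleR_left multilinear_append[where l = l]) (simp_all add: multilinear_vol)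
next
  let ?e = "map (\<lambda>i :: 'n. axis i 1 :: (real, 'n) vec)"
  fix "is" :: "'n list" assume "is": "length is = k"
  have vol_nz: "distinct xs" if "vol (?e xs) \<noteq> 0" "length xs = CARD('n)" for xs
    using that alternating_not_distinct[OF alternating_vol, of "?e xs"] by (auto simp: distinct_map)
  have inner: "vol (?e is @ ?e ks) *\<^sub>R (\<Sum>js | length js = k. vol (?e js @ ?e ks) *\<^sub>R \<Omega> (?e js)) =
      (if ks \<in> permutations_of_set (- set is) then fact k *\<^sub>R \<Omega> (?e is) else 0)"
    if ks: "length ks = l" and dist: "distinct is" for ks
  proof (cases "distinct (is @ ks)")
    case False
    then have "vol (?e is @ ?e ks) = 0"
      using vol_nz[of "is @ ks"] "is" ks k by auto
    moreover have "ks \<notin> permutations_of_set (- set is)"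
      using False dist by (auto simp: permutations_of_set_def)
    ultimately show ?thesis by simp
  next
    case True
    have full: "set xs = UNIV" if "distinct xs" "length xs = CARD('n)" for xs :: "'n list"
      using that by (metis card_subset_eq distinct_card finite subset_UNIV)
    have "set is \<union> set ks = UNIV" using full[of "is @ ks"] True "is" ks k by simp
    then have mem: "ks \<in> permutations_of_set (- set is)"
      using True by (auto simp: permutations_of_set_def)
    \<comment> \<open>Together with ks the list \<open>is\<close> exhausts the indices, so a nonzero
      term forces js to be a rearrangement of \<open>is\<close>; all of these terms are
      equal.\<close>
    have "(\<Sum>js | length js = k. vol (?e js @ ?e ks) *\<^sub>R \<Omega> (?e js)) =
        (\<Sum>js\<in>permutations_of_set (set is). vol (?e is @ ?e ks) *\<^sub>R \<Omega> (?e is))"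
    proof (rule sum.mono_neutral_cong_right)
      show "permutations_of_set (set is) \<subseteq> {js. length js = k}"
        using "is" dist by (auto simp: permutations_of_set_def distinct_card[symmetric])
      show "\<forall>js\<in>{js. length js = k} - permutations_of_set (set is). vol (?e js @ ?e ks) *\<^sub>R \<Omega> (?e js) = 0"
      proof
        fix js assume js: "js \<in> {js. length js = k} - permutations_of_set (set is)"
        have "vol (?e js @ ?e ks) = 0"
        proof (rule ccontr)
          assume "vol (?e js @ ?e ks) \<noteq> 0"
          then have d: "distinct (js @ ks)" using vol_nz[of "js @ ks"] js ks k by auto
          then have "set js \<union> set ks = UNIV" using full[of "js @ ks"] js ks k by simp
          then have "set js = set is" using d \<open>set is \<union> set ks = UNIV\<close> True by auto
          then show False using js d by (auto simp: permutations_of_set_def)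
        qed
        then show "vol (?e js @ ?e ks) *\<^sub>R \<Omega> (?e js) = 0" by simp
      qed
      fix js assume "js \<in> permutations_of_set (set is)"
      then have "mset js = mset is" using dist by (auto simp: permutations_of_set_def set_eq_iff_mset_eq_distinct)
      then show "vol (?e js @ ?e ks) *\<^sub>R \<Omega> (?e js) = vol (?e is @ ?e ks) *\<^sub>R \<Omega> (?e is)"
        using alternating_product_mset_eq[of k "\<lambda>xs. vol (xs @ ?e ks)" \<Omega> "?e is" "?e js"]
          alternating_append[of k l vol "?e ks"] alternating_vol[where 'n = 'n] k ks alt "is" by simp
    qed simp
    also have "\<dots> = fact k *\<^sub>R vol (?e is @ ?e ks) *\<^sub>R \<Omega> (?e is)"
      using dist "is" by (simp add: sum_constant_scaleR distinct_card)
    finally show ?thesis using mem vol_axis_distinct[of "is @ ks"] True "is" ks k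
      by (simp add: mult_ac)
  qed
  show "(\<Sum>ks | length ks = l. vol (?e is @ ?e ks) *\<^sub>R (\<Sum>js | length js = k. vol (?e js @ ?e ks) *\<^sub>R \<Omega> (?e js)))
    = (fact k * fact l) *\<^sub>R \<Omega> (?e is)"
  proof (cases "distinct is")
    case True
    \<comment> \<open>The surviving lists ks are the orderings of the complement of
      \<open>is\<close>, whence the factor \<open>fact l\<close>.\<close>
    then have "card (- set is) = l" using "is" k by (simp add: Compl_eq_Diff_UNIV card_Diff_subset distinct_card)
    moreover have "permutations_of_set (- set is) \<subseteq> {ks. length ks = l}"
      using \<open>card (- set is) = l\<close> by (auto simp: permutations_of_set_def distinct_card[symmetric])
    then have "{ks. length ks = l} \<inter> permutations_of_set (- set is) = permutations_of_set (- set is)" by auto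
    moreover have "(\<Sum>ks | length ks = l. vol (?e is @ ?e ks) *\<^sub>R (\<Sum>js | length js = k. vol (?e js @ ?e ks) *\<^sub>R \<Omega> (?e js))) =
      (\<Sum>ks | length ks = l. if ks \<in> permutations_of_set (- set is) then fact k *\<^sub>R \<Omega> (?e is) else 0)"
      by (intro sum.cong refl inner True) simp
    ultimately show ?thesis
      by (simp add: sum.If_cases sum_constant_scaleR mult_ac)
  next
    case False
    then have "vol (?e is @ ?e ks) = 0" if "length ks = l" for ks
      using that vol_nz[of "is @ ks"] "is" k by auto
    moreover have "\<Omega> (?e is) = 0"
      using False "is" alternating_not_distinct[OF alt, of "?e is"] by (auto simp: distinct_map)
    ultimately show ?thesis by simp
  qed
qed

text \<open>Raising all indices of \<alpha> is the same as evaluating it on the columns of the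
  inverse metric.\<close>

lemma hodge_eq:
  fixes \<alpha> :: "('n::{finite, linorder}, 'v::real_vector) form"
  assumes "multilinear k \<alpha>"
  shows "hodge G k \<alpha> vs = (sqrt (det G) / fact k) *\<^sub>R (\<Sum>js | length js = k.
     vol (map (\<lambda>i. axis i 1) js @ vs) *\<^sub>R \<alpha> (map (\<lambda>i. matrix_inv G *v axis i 1) js))"
proof -
  have "\<alpha> (map (\<lambda>i. matrix_inv G *v axis i 1) js) =
      (\<Sum>is | length is = k. (\<Prod>a<k. matrix_inv G $ (is ! a) $ (js ! a)) *\<^sub>R \<alpha> (map (\<lambda>i. axis i 1) is))"
    if "length js = k" for js
    using multilinear_expand[OF assms, of "map (\<lambda>i. matrix_inv G *v axis i 1) js"] that
    by (simp add: matrix_vector_mult_basis column_def)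
  then have "(sqrt (det G) / fact k) *\<^sub>R (\<Sum>js | length js = k.
     vol (map (\<lambda>i. axis i 1) js @ vs) *\<^sub>R \<alpha> (map (\<lambda>i. matrix_inv G *v axis i 1) js)) =
     (1 / fact k) *\<^sub>R (\<Sum>js | length js = k. \<Sum>is | length is = k.
       ((\<Prod>a<k. matrix_inv G $ (is ! a) $ (js ! a)) * vol_form G (map (\<lambda>i. axis i 1) js @ vs))
         *\<^sub>R \<alpha> (map (\<lambda>i. axis i 1) is))"
    by (simp add: scaleR_sum_right vol_form_eq mult_ac)
  also have "\<dots> = hodge G k \<alpha> vs"
    unfolding hodge_def by (subst sum.swap) (rule refl)
  finally show ?thesis by simp
qed

lemma multilinear_hodge:
  fixes \<alpha> :: "('n::{finite, linorder}, 'v::real_vector) form"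
  assumes "multilinear k \<alpha>" "k + l = CARD('n)"
  shows "multilinear l (hodge G k \<alpha>)"
proof -
  have "multilinear l (\<lambda>vs. (sqrt (det G) / fact k) *\<^sub>R (\<Sum>js | length js = k.
     vol (map (\<lambda>i. axis i 1) js @ vs) *\<^sub>R \<alpha> (map (\<lambda>i. matrix_inv G *v axis i 1) js)))"
    by (intro multilinear_scaleR multilinear_sum multilinear_scaleR_left multilinear_append2[where l = k])
       (auto simp: assms(2) multilinear_vol)
  then show ?thesis by (simp add: hodge_eq[OF assms(1)] multilinear_def)
qed

lemma
  fixes A :: "'k::semiring_1 ^ 'n ^ 'm"
  assumes "invertible A"
  shows matrix_inv_right: "A ** matrix_inv A = mat 1" and matrix_inv_left: "matrix_inv A ** A = mat 1"
  using someI_ex[OF assms[unfolded invertible_def]] unfolding matrix_inv_def by auto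

text \<open>The sum of the tensors \<open>G *v axis i 1\<close> times
  \<open>matrix_inv G *v axis i 1\<close> has the components of the inverse times the transpose of
  G, hence is the identity tensor by symmetry of G.\<close>

lemma sum_matrix_inv_contract:
  fixes G :: "real ^ 'n ^ 'n" and \<phi> :: "real ^ 'n \<Rightarrow> real" and \<psi> :: "real ^ 'n \<Rightarrow> 'v::real_vector"
  assumes "linear \<phi>" "linear \<psi>" and G: "invertible G" "transpose G = G"
  shows "(\<Sum>i\<in>UNIV. \<phi> (G *v axis i 1) *\<^sub>R \<psi> (matrix_inv G *v axis i 1)) =
    (\<Sum>i\<in>UNIV. \<phi> (axis i 1) *\<^sub>R \<psi> (axis i 1))"
proof -
  have sym: "G $ i $ j = G $ j $ i" for i j using G(2) by (metis transpose_def vec_lambda_beta)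
  have inv: "(\<Sum>i\<in>UNIV. matrix_inv G $ l $ i * G $ i $ j) = (if l = j then 1 else 0)" for l j
  proof -
    have "(matrix_inv G ** G) $ l $ j = mat 1 $ l $ j" using matrix_inv_left[OF G(1)] by simp
    then show ?thesis by (simp add: matrix_matrix_mult_def mat_def)
  qed
  have "(\<Sum>i\<in>UNIV. \<phi> (G *v axis i 1) *\<^sub>R \<psi> (matrix_inv G *v axis i 1)) =
    (\<Sum>i\<in>UNIV. \<Sum>j\<in>UNIV. \<Sum>l\<in>UNIV. (G $ j $ i * \<phi> (axis j 1) * matrix_inv G $ l $ i) *\<^sub>R \<psi> (axis l 1))"
  proof (rule sum.cong[OF refl])
    fix i
    have "\<phi> (G *v axis i 1) = (\<Sum>j\<in>UNIV. G $ j $ i * \<phi> (axis j 1))"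
      using linear_eq_sum_axis[OF assms(1), of "G *v axis i 1"] by (simp add: matrix_vector_mult_basis column_def)
    moreover have "\<psi> (matrix_inv G *v axis i 1) = (\<Sum>l\<in>UNIV. matrix_inv G $ l $ i *\<^sub>R \<psi> (axis l 1))"
      using linear_eq_sum_axis[OF assms(2), of "matrix_inv G *v axis i 1"] by (simp add: matrix_vector_mult_basis column_def)
    ultimately show "\<phi> (G *v axis i 1) *\<^sub>R \<psi> (matrix_inv G *v axis i 1) =
      (\<Sum>j\<in>UNIV. \<Sum>l\<in>UNIV. (G $ j $ i * \<phi> (axis j 1) * matrix_inv G $ l $ i) *\<^sub>R \<psi> (axis l 1))"
      by (simp only:) (subst scaleR_sum_left, simp only: scaleR_sum_right scaleR_scaleR)
  qed
  also have "\<dots> = (\<Sum>j\<in>UNIV. \<Sum>l\<in>UNIV. \<Sum>i\<in>UNIV. (G $ j $ i * \<phi> (axis j 1) * matrix_inv G $ l $ i) *\<^sub>R \<psi> (axis l 1))"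
    by (subst sum.swap, rule sum.cong[OF refl], rule sum.swap)
  also have "\<dots> = (\<Sum>j\<in>UNIV. \<Sum>l\<in>UNIV. (\<phi> (axis j 1) * (\<Sum>i\<in>UNIV. matrix_inv G $ l $ i * G $ i $ j)) *\<^sub>R \<psi> (axis l 1))"
    by (simp only: sum_distrib_left scaleR_sum_left sym[of _ _] mult_ac)
  also have "\<dots> = (\<Sum>i\<in>UNIV. \<phi> (axis i 1) *\<^sub>R \<psi> (axis i 1))"
    by (simp add: inv if_distrib if_distribR cong: if_cong)
  finally show ?thesis .
qed

text \<open>Expanding the outer star and the wedge product leaves a sum over the first l slots in
  which \<open>vol\<close> is contracted with the inner star of \<Omega>. This is a double star, and
  \<open>contract_vol\<close> returns \<Omega> itself on the remaining four arguments.\<close>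

lemma B_op_eq:
  fixes G :: "((real, 'n::{finite, linorder}) vec, 'n) vec" and \<alpha> :: "('n, 'v::real_vector) form"
  assumes \<Omega>: "multilinear 4 \<Omega>" "alternating 4 \<Omega>" and \<alpha>: "multilinear 2 \<alpha>" and n: "CARD('n) \<ge> 4"
    and G: "det G > 0" "transpose G = G"
  shows "B_op G \<Omega> \<alpha> [u, v] = (1 / 2) *\<^sub>R (\<Sum>p\<in>UNIV. \<Sum>q\<in>UNIV.
    \<Omega> [axis p 1, axis q 1, u, v] *\<^sub>R \<alpha> [matrix_inv G *v axis p 1, matrix_inv G *v axis q 1])"
proof -
  let ?e = "map (\<lambda>i :: 'n. axis i 1 :: (real, 'n) vec)"
  let ?h = "map (\<lambda>i :: 'n. matrix_inv G *v axis i 1 :: (real, 'n) vec)"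
  obtain l where l: "CARD('n) = 4 + l" using n by (metis le_Suc_ex)
  have inv: "invertible G" using G(1) by (simp add: invertible_det_nz)
  have vol: "multilinear (4 + l) (vol :: ((real, 'n) vec) list \<Rightarrow> real)"
    "alternating (4 + l) (vol :: ((real, 'n) vec) list \<Rightarrow> real)"
    using multilinear_vol[where 'n = 'n] alternating_vol[where 'n = 'n] by (simp_all add: l)
  have dets: "det (matrix_inv G) * det G = 1"
    by (metis det_I det_mul inv matrix_inv_left)
  \<comment> \<open>The arguments carry raised indices. Taking the inverse metric out of every slot
    of \<open>vol\<close> gives its determinant and puts G on the first four slots, where it cancels
    against the raised indices of \<Omega>.\<close>
  have star: "hodge G 4 \<Omega> (?h is) = (sqrt (det G) * det (matrix_inv G) / fact 4) *
      (\<Sum>ks | length ks = 4. vol (?e ks @ ?e is) * \<Omega> (?e ks))" if "is": "length is = l" for "is"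
  proof -
    have "vol (?e ks @ ?h is) = det (matrix_inv G) * vol (map (\<lambda>i. G *v axis i 1) ks @ ?e is)"
      if "length ks = 4" for ks
    proof -
      have "?e ks @ ?h is = map ((*v) (matrix_inv G)) (map (\<lambda>i. G *v axis i 1) ks @ ?e is)"
        by (simp add: matrix_vector_mul_assoc matrix_inv_left[OF inv])
      then show ?thesis by (simp only:) (rule vol_map, simp add: that "is" l)
    qed
    then have "hodge G 4 \<Omega> (?h is) = (sqrt (det G) * det (matrix_inv G) / fact 4) *
      (\<Sum>ks | length ks = 4. vol (map (\<lambda>i. G *v axis i 1) ks @ ?e is) *\<^sub>R \<Omega> (?h ks))"
      by (simp add: hodge_eq[OF \<Omega>(1)] sum_distrib_left mult_ac)
    also have "(\<Sum>ks | length ks = 4. vol (map (\<lambda>i. G *v axis i 1) ks @ ?e is) *\<^sub>R \<Omega> (?h ks)) =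
      (\<Sum>ks | length ks = 4. vol (?e ks @ ?e is) *\<^sub>R \<Omega> (?e ks))"
      using vol(1) "is" \<Omega>(1)
      by (intro sum_lists_contract_cong[of _ _ _ _ _ "\<lambda>xs. vol (xs @ ?e is)"]
          sum_matrix_inv_contract inv G multilinear_append[where l = l]) simp_all
    finally show ?thesis by simp
  qed
  have "B_op G \<Omega> \<alpha> [u, v] = hodge G (l + 2) (wedge (*\<^sub>R) l 2 (hodge G 4 \<Omega>) \<alpha>) [u, v]"
    by (simp add: B_op_def l)
  also have "\<dots> = (sqrt (det G) / fact (l + 2)) *\<^sub>R (\<Sum>js | length js = l + 2.
     vol (?e js @ [u, v]) *\<^sub>R (wedge (*\<^sub>R) l 2 (hodge G 4 \<Omega>) \<alpha>) (?h js))"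
    by (intro hodge_eq multilinear_wedge multilinear_hodge[where k = 4] \<alpha> \<Omega>)
       (auto simp: l bilinear_def linear_iff algebra_simps)
  also have "\<dots> = (sqrt (det G) / fact (l + 2)) *\<^sub>R (fact (l + 2) / (fact l * fact 2)) *\<^sub>R
      (\<Sum>is | length is = l. \<Sum>js | length js = 2. vol ((?e is @ ?e js) @ [u, v]) *\<^sub>R (hodge G 4 \<Omega> (?h is) *\<^sub>R \<alpha> (?h js)))"
    by (subst contract_wedge[where X = "\<lambda>xs. vol (xs @ [u, v])"], rule alternating_append[where l = 2])
       (use vol(2) in \<open>simp_all add: numeral_eq_Suc\<close>)
  also have "(\<Sum>is | length is = l. \<Sum>js | length js = 2. vol ((?e is @ ?e js) @ [u, v]) *\<^sub>R (hodge G 4 \<Omega> (?h is) *\<^sub>R \<alpha> (?h js))) =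
      (\<Sum>js | length js = 2. (\<Sum>is | length is = l. vol ((?e js @ [u, v]) @ ?e is) *\<^sub>R hodge G 4 \<Omega> (?h is)) *\<^sub>R \<alpha> (?h js))"
  proof -
    \<comment> \<open>A block moved past four vectors changes no sign, whatever the parity of
      l.\<close>
    have "vol ((?e is @ ?e js) @ [u, v]) = vol ((?e js @ [u, v]) @ ?e is)"
      if "length is = l" "length js = 2" for "is" js
      using alternating_append_commute[OF vol(2), of "?e is" "?e js @ [u, v]"] that by simp
    then show ?thesis by (subst sum.swap) (simp add: scaleR_sum_left)
  qed
  also have "\<dots> = (\<Sum>js | length js = 2. (sqrt (det G) * det (matrix_inv G) / fact 4 * (fact 4 * fact l) * \<Omega> (?e js @ [u, v])) *\<^sub>R \<alpha> (?h js))"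
  proof (rule sum.cong[OF refl])
    fix js :: "'n list" assume "js \<in> {js. length js = 2}"
    then have b: "length (?e js @ [u, v]) = 4" by simp
    have "(\<Sum>is | length is = l. vol ((?e js @ [u, v]) @ ?e is) *\<^sub>R hodge G 4 \<Omega> (?h is)) =
      (sqrt (det G) * det (matrix_inv G) / fact 4) * (\<Sum>is | length is = l. vol ((?e js @ [u, v]) @ ?e is) *\<^sub>R
        (\<Sum>ks | length ks = 4. vol (?e ks @ ?e is) *\<^sub>R \<Omega> (?e ks)))"
      by (simp add: star sum_distrib_left mult_ac)
    also have "\<dots> = (sqrt (det G) * det (matrix_inv G) / fact 4) * ((fact 4 * fact l) * \<Omega> (?e js @ [u, v]))"
      by (subst contract_vol[OF \<Omega> l[symmetric] b]) simp
    finally show "(\<Sum>is | length is = l. vol ((?e js @ [u, v]) @ ?e is) *\<^sub>R hodge G 4 \<Omega> (?h is)) *\<^sub>R \<alpha> (?h js) =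
      (sqrt (det G) * det (matrix_inv G) / fact 4 * (fact 4 * fact l) * \<Omega> (?e js @ [u, v])) *\<^sub>R \<alpha> (?h js)"
      by (simp add: mult_ac)
  qed
  also have "(sqrt (det G) / fact (l + 2)) *\<^sub>R (fact (l + 2) / (fact l * fact 2)) *\<^sub>R \<dots> =
      (1 / 2) *\<^sub>R (\<Sum>js | length js = 2. \<Omega> (?e js @ [u, v]) *\<^sub>R \<alpha> (?h js))"
  proof -
    \<comment> \<open>Each star contributes one factor \<open>sqrt (det G)\<close>; with the
      determinant of the inverse metric the product is 1.\<close>
    have sq: "sqrt (det G) * sqrt (det G) * det (matrix_inv G) = 1" using G(1) dets by (simp add: mult_ac)
    have cancel: "(s / a) * (a / (b * 2)) * (s * d / c * (c * b) * x) = (s * s * d) * x / 2"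
      if "a \<noteq> 0" "b \<noteq> 0" "c \<noteq> 0" for a b c d s x :: real
      using that by (simp add: field_simps)
    have eq: "(sqrt (det G) / fact (l + 2)) * (fact (l + 2) / (fact l * fact 2)) *
       (sqrt (det G) * det (matrix_inv G) / fact 4 * (fact 4 * fact l) * x) = (1 / 2) * x" for x
      unfolding fact_2
      using cancel[of "fact (l + 2)" "fact l" "fact 4" "sqrt (det G)" "det (matrix_inv G)" x,
          OF fact_nonzero fact_nonzero fact_nonzero, unfolded sq]
      by (simp only: mult_1 times_divide_eq_left)
    show ?thesis by (simp only: scaleR_sum_right scaleR_scaleR mult.assoc[of "_ / _" "_ / _", symmetric] eq)
  qed
  also have "(\<Sum>js | length js = 2. \<Omega> (?e js @ [u, v]) *\<^sub>R \<alpha> (?h js)) = (\<Sum>p\<in>UNIV. \<Sum>q\<in>UNIV.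
    \<Omega> [axis p 1, axis q 1, u, v] *\<^sub>R \<alpha> [matrix_inv G *v axis p 1, matrix_inv G *v axis q 1])"
    unfolding numeral_2_eq_2 sum_lists_Suc sum_lists_0 by simp
  finally show ?thesis .
qed

section \<open>Quaternionic linear algebra\<close>

lemma sum_permutations_wedge_2_2:
  fixes f :: "nat list \<Rightarrow> real"
  shows "(\<Sum>\<sigma> | \<sigma> permutes {..<4}. of_int (sign \<sigma>) * f [\<sigma> 0, \<sigma> 1, \<sigma> 2, \<sigma> 3]) =
     f [0,1,2,3] - f [0,1,3,2] - f [0,2,1,3] + f [0,2,3,1] + f [0,3,1,2] - f [0,3,2,1]
   - f [1,0,2,3] + f [1,0,3,2] + f [1,2,0,3] - f [1,2,3,0] - f [1,3,0,2] + f [1,3,2,0]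
   + f [2,0,1,3] - f [2,0,3,1] - f [2,1,0,3] + f [2,1,3,0] + f [2,3,0,1] - f [2,3,1,0]
   - f [3,0,1,2] + f [3,0,2,1] + f [3,1,0,2] - f [3,1,2,0] - f [3,2,0,1] + f [3,2,1,0]"
proof -
  have set4: "{..<4} = {0, 1, 2, 3 :: nat}" by auto
  have f: "finite {1, 2, 3 :: nat}" "0 \<notin> {1, 2, 3 :: nat}" "finite {2, 3 :: nat}" "1 \<notin> {2, 3 :: nat}"
    "finite {3 :: nat}" "2 \<notin> {3 :: nat}" by auto
  show ?thesis
    unfolding set4 sum_over_permutations_insert[OF f(1,2)] sum_over_permutations_insert[OF f(3,4)]
      sum_over_permutations_insert[OF f(5,6)] permutes_sing
    by (simp add: sign_compose permutation_compose permutation_swap_id sign_swap_id Transposition.transpose_def)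
qed

text \<open>Each of the three splittings of the arguments into two pairs arises from eight of the 24
  permutations, always with the same value; division by \<open>fact 2 * fact 2\<close> leaves the
  factor 2.\<close>

lemma wedge_2_2:
  fixes \<alpha> :: "('n, real) form"
  assumes "\<And>u v. \<alpha> [u, v] = - \<alpha> [v, u]"
  shows "wedge (*) 2 2 \<alpha> \<alpha> [a, b, c, d] =
    2 * (\<alpha> [a, b] * \<alpha> [c, d] - \<alpha> [a, c] * \<alpha> [b, d] + \<alpha> [a, d] * \<alpha> [b, c])"
proof -
  let ?vs = "[a, b, c, d]"
  define f where "f xs = \<alpha> [?vs ! (xs ! 0), ?vs ! (xs ! 1)] * \<alpha> [?vs ! (xs ! 2), ?vs ! (xs ! 3)]" for xs
  have upt: "[0..<2] = [0, 1]" "[2..<4] = [2, 3::nat]" by (simp_all add: numeral_eq_Suc)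
  have swap: "\<alpha> [b, a] = - \<alpha> [a, b]" "\<alpha> [c, a] = - \<alpha> [a, c]" "\<alpha> [d, a] = - \<alpha> [a, d]"
    "\<alpha> [c, b] = - \<alpha> [b, c]" "\<alpha> [d, b] = - \<alpha> [b, d]" "\<alpha> [d, c] = - \<alpha> [c, d]"
    by (rule assms)+
  have "wedge (*) 2 2 \<alpha> \<alpha> ?vs =
      (1 / 4) * (\<Sum>\<sigma> | \<sigma> permutes {..<4}. of_int (sign \<sigma>) * f [\<sigma> 0, \<sigma> 1, \<sigma> 2, \<sigma> 3])"
    by (simp add: wedge_def f_def upt fact_2)
  also have "\<dots> = 2 * (\<alpha> [a, b] * \<alpha> [c, d] - \<alpha> [a, c] * \<alpha> [b, d] + \<alpha> [a, d] * \<alpha> [b, c])"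
    by (subst sum_permutations_wedge_2_2) (simp add: f_def swap mult_ac)
  finally show ?thesis .
qed

text \<open>Composition with \<tau> permutes the summation index and changes all signs by the sign
  of \<tau>.\<close>

lemma alternating_wedge:
  fixes \<alpha> :: "('n::finite, 'u) form" and prd :: "'u \<Rightarrow> 'v \<Rightarrow> 'w::real_vector"
  shows "alternating (k + l) (wedge prd k l \<alpha> \<beta>)"
  unfolding alternating_def
proof (intro allI impI)
  fix \<tau> and vs :: "(real ^ 'n) list" assume \<tau>: "\<tau> permutes {..<k + l}" and vs: "length vs = k + l"
  define W where "W vs = prd (\<alpha> (take k vs)) (\<beta> (drop k vs))" for vs
  have "(\<Sum>\<sigma> | \<sigma> permutes {..<k + l}. of_int (sign \<sigma>) *\<^sub>R W (permute_list \<sigma> (permute_list \<tau> vs))) =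
    (\<Sum>\<sigma> | \<sigma> permutes {..<k + l}. of_int (sign \<tau>) *\<^sub>R (of_int (sign (\<tau> \<circ> \<sigma>)) *\<^sub>R W (permute_list (\<tau> \<circ> \<sigma>) vs)))"
  proof (rule sum.cong[OF refl])
    fix \<sigma> assume "\<sigma> \<in> {\<sigma>. \<sigma> permutes {..<k + l}}"
    then have \<sigma>: "\<sigma> permutes {..<k + l}" by simp
    have "sign (\<tau> \<circ> \<sigma>) = sign \<tau> * sign \<sigma>"
      using \<sigma> \<tau> by (intro sign_compose) (auto simp: permutation_permutes)
    then have "sign \<tau> * sign (\<tau> \<circ> \<sigma>) = sign \<sigma>" by simp
    then have "of_int (sign \<sigma>) = (of_int (sign \<tau>) * of_int (sign (\<tau> \<circ> \<sigma>)) :: real)"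
      by (metis of_int_mult)
    then show "of_int (sign \<sigma>) *\<^sub>R W (permute_list \<sigma> (permute_list \<tau> vs)) =
       of_int (sign \<tau>) *\<^sub>R (of_int (sign (\<tau> \<circ> \<sigma>)) *\<^sub>R W (permute_list (\<tau> \<circ> \<sigma>) vs))"
      using \<sigma> vs by (subst permute_list_compose) simp_all
  qed
  also have "\<dots> = of_int (sign \<tau>) *\<^sub>R
      (\<Sum>\<sigma> | \<sigma> permutes {..<k + l}. of_int (sign (\<tau> \<circ> \<sigma>)) *\<^sub>R W (permute_list (\<tau> \<circ> \<sigma>) vs))"
    by (simp only: scaleR_sum_right)
  also have "(\<Sum>\<sigma> | \<sigma> permutes {..<k + l}. of_int (sign (\<tau> \<circ> \<sigma>)) *\<^sub>R W (permute_list (\<tau> \<circ> \<sigma>) vs)) =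
     (\<Sum>\<sigma> | \<sigma> permutes {..<k + l}. of_int (sign \<sigma>) *\<^sub>R W (permute_list \<sigma> vs))"
  proof (rule sum.reindex_bij_betw, rule bij_betw_byWitness[where f' = "(\<circ>) (inv \<tau>)"])
    show "\<forall>\<sigma>\<in>{\<sigma>. \<sigma> permutes {..<k + l}}. inv \<tau> \<circ> (\<tau> \<circ> \<sigma>) = \<sigma>"
      "\<forall>\<sigma>\<in>{\<sigma>. \<sigma> permutes {..<k + l}}. \<tau> \<circ> (inv \<tau> \<circ> \<sigma>) = \<sigma>"
      by (simp_all add: fun_eq_iff permutes_inverses[OF \<tau>])
    show "(\<circ>) \<tau> ` {\<sigma>. \<sigma> permutes {..<k + l}} \<subseteq> {\<sigma>. \<sigma> permutes {..<k + l}}"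
      "(\<circ>) (inv \<tau>) ` {\<sigma>. \<sigma> permutes {..<k + l}} \<subseteq> {\<sigma>. \<sigma> permutes {..<k + l}}"
      using \<tau> by (blast intro: permutes_compose permutes_inv)+
  qed
  finally show "wedge prd k l \<alpha> \<beta> (permute_list \<tau> vs) = of_int (sign \<tau>) *\<^sub>R wedge prd k l \<alpha> \<beta> vs"
    using vs by (simp add: wedge_permute_list W_def mult_ac)
qed

lemma multilinear_2_iff:
  "multilinear 2 X \<longleftrightarrow> bilinear (\<lambda>u v. X [u, v])"
  by (auto simp: numeral_2_eq_2 multilinear_Suc bilinear_def length_Suc_conv)

lemma matrix_vector_mult_uminus_left: "(- A) *v x = - (A *v (x :: 'k::ring_1 ^ 'n))"
  by (simp add: vec_eq_iff matrix_vector_mult_def sum_negf)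

lemma sum_nth_scaleR_linear:
  fixes \<psi> :: "real ^ 'n \<Rightarrow> 'v::real_vector"
  assumes "linear \<psi>"
  shows "(\<Sum>p\<in>UNIV. w $ p *\<^sub>R \<psi> (A *v axis p 1)) = \<psi> (A *v w)"
  using linear_eq_sum_axis[OF linear_compose[OF matrix_vector_mul_linear[of A] assms], of w]
  by (simp add: o_def)

text \<open>The identity tensor transformed by B in its second factor equals the one transformed by
  the transpose of B in its first factor.\<close>

lemma contract_transpose:
  fixes S :: "real ^ 'n \<Rightarrow> real ^ 'n \<Rightarrow> 'v::real_vector"
  assumes "bilinear S"
  shows "(\<Sum>p\<in>UNIV. S (A *v axis p 1) (B *v axis p 1)) =
    (\<Sum>q\<in>UNIV. S (A *v (transpose B *v axis q 1)) (axis q 1))"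
proof -
  have lin: "linear (S u)" "linear (\<lambda>u. S u v)" for u v
    using assms by (auto simp: bilinear_def)
  have "(\<Sum>p\<in>UNIV. S (A *v axis p 1) (B *v axis p 1)) =
      (\<Sum>p\<in>UNIV. \<Sum>q\<in>UNIV. B $ q $ p *\<^sub>R S (A *v axis p 1) (axis q 1))"
    by (subst linear_eq_sum_axis[OF lin(1)]) (simp add: matrix_vector_mult_basis column_def)
  also have "\<dots> = (\<Sum>q\<in>UNIV. \<Sum>p\<in>UNIV. B $ q $ p *\<^sub>R S (A *v axis p 1) (axis q 1))"
    by (rule sum.swap)
  also have "\<dots> = (\<Sum>q\<in>UNIV. S (A *v (transpose B *v axis q 1)) (axis q 1))"
  proof (rule sum.cong[OF refl])
    fix q
    show "(\<Sum>p\<in>UNIV. B $ q $ p *\<^sub>R S (A *v axis p 1) (axis q 1)) =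
      S (A *v (transpose B *v axis q 1)) (axis q 1)"
      using sum_nth_scaleR_linear[OF lin(2)[of "axis q 1"], where w = "transpose B *v axis q 1" and A = A]
      by (simp add: matrix_vector_mult_basis column_def transpose_def)
  qed
  finally show ?thesis .
qed

lemma skew_wrt_transpose:
  assumes "skew_wrt G J"
  shows "transpose J ** G = - (G ** J)"
proof -
  have "(transpose J ** G) $ i $ j = - (G ** J) $ i $ j" for i j
  proof -
    have "(J *v axis i 1) \<bullet> (G *v axis j 1) = - (axis i 1 \<bullet> (G *v (J *v axis j 1)))"
      using assms by (simp add: skew_wrt_def)
    then show ?thesis
      by (simp add: matrix_vector_mult_basis column_def matrix_vector_mul_assoc inner_axis')
         (simp add: matrix_matrix_mult_def matrix_vector_mult_def inner_vec_def transpose_def)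
  qed
  then show ?thesis by (simp add: vec_eq_iff)
qed

lemma transpose_symmetric: "transpose G = G \<Longrightarrow> u \<bullet> (G *v v) = (G *v u) \<bullet> (v :: real ^ 'n)"
  by (metis dot_lmul_matrix vector_transpose_matrix)

lemma transpose_matrix_inv:
  fixes G :: "real ^ 'n ^ 'n"
  assumes "invertible G" "transpose G = G"
  shows "transpose (matrix_inv G) = matrix_inv G"
proof -
  have "transpose (matrix_inv G) ** G = mat 1"
    by (metis assms matrix_inv_right matrix_transpose_mul transpose_mat)
  then have "transpose (matrix_inv G) ** (G ** matrix_inv G) = matrix_inv G"
    by (simp add: matrix_mul_assoc)
  then show ?thesis by (simp add: matrix_inv_right[OF assms(1)])
qed

text \<open>The linear algebra of one tangent space. With \<open>H\<close> the inverse of G, the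
  vectors \<open>H *v axis p 1\<close> and \<open>axis p 1\<close> are dual bases for the metric G,
  up to lowering the index of the second; sums over p of such pairs, one slot of them raised, are
  the traces that occur.\<close>

locale quaternionic_triple =
  fixes G :: "real ^ 'n ^ 'n" and Q and J1 J2 J3 :: "real ^ 'n ^ 'n"
  assumes G_sym: "transpose G = G" and G_det: "det G > 0"
    and admissible: "admissible_basis G Q J1 J2 J3"
begin

abbreviation "H \<equiv> matrix_inv G"

lemma inv_G: "invertible G" using G_det by (simp add: invertible_det_nz)

lemma H_sym: "transpose H = H"
  by (rule transpose_matrix_inv[OF inv_G G_sym])

lemma mult_J:
  "J1 *v (J1 *v u) = - u" "J2 *v (J2 *v u) = - u" "J3 *v (J3 *v u) = - u"
  "J1 *v (J2 *v u) = J3 *v u" "J2 *v (J1 *v u) = - (J3 *v u)"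
  "J2 *v (J3 *v u) = J1 *v u" "J3 *v (J2 *v u) = - (J1 *v u)"
  "J3 *v (J1 *v u) = J2 *v u" "J1 *v (J3 *v u) = - (J2 *v u)"
proof -
  have m: "J1 ** J1 = - mat 1" "J2 ** J2 = - mat 1" "J3 = J1 ** J2" "J2 ** J1 = - (J1 ** J2)"
    using admissible by (auto simp: admissible_basis_def)
  have 1: "J1 *v (J1 *v u) = - u" "J2 *v (J2 *v u) = - u" "J1 *v (J2 *v u) = J3 *v u"
    "J2 *v (J1 *v u) = - (J3 *v u)" for u
    unfolding m(3) using m(1,2,4)
    by (simp_all add: matrix_vector_mul_assoc matrix_vector_mult_uminus_left)
  note neg = linear_neg[OF matrix_vector_mul_linear]
  show "J1 *v (J1 *v u) = - u" "J2 *v (J2 *v u) = - u" "J1 *v (J2 *v u) = J3 *v u"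
    "J2 *v (J1 *v u) = - (J3 *v u)" by (rule 1)+
  have 13: "J1 *v (J3 *v u) = - (J2 *v u)" for u by (metis 1)
  have 32: "J3 *v (J2 *v u) = - (J1 *v u)" for u by (metis 1 neg)
  have 23: "J2 *v (J3 *v u) = J1 *v u" for u by (metis 1 neg minus_minus)
  have 31: "J3 *v (J1 *v u) = J2 *v u" for u by (metis 1 neg minus_minus)
  show "J1 *v (J3 *v u) = - (J2 *v u)" "J3 *v (J2 *v u) = - (J1 *v u)" "J2 *v (J3 *v u) = J1 *v u"
    "J3 *v (J1 *v u) = J2 *v u" by (rule 13 32 23 31)+
  show "J3 *v (J3 *v u) = - u" by (metis 1(3) 13 23 1(1) 32 31 neg)
qed

lemma skew: "skew_wrt G J1" "skew_wrt G J2" "skew_wrt G J3"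
  using admissible by (auto simp: admissible_basis_def)

lemma J_in_Q: "J1 \<in> Q" "J2 \<in> Q" "J3 \<in> Q"
  using admissible by (auto simp: admissible_basis_def intro: span_base)

text \<open>A skew J with square -1 is an isometry, which for the inverse metric reads
  \<open>J ** H ** transpose J = H\<close>.\<close>

lemma contract_isometry:
  assumes "bilinear S" "skew_wrt G J" "\<And>u. J *v (J *v u) = - u"
  shows "(\<Sum>p\<in>UNIV. S (J *v (H *v axis p 1)) (J *v axis p 1)) = (\<Sum>p\<in>UNIV. S (H *v axis p 1) (axis p 1))"
proof -
  have "(J ** H) *v (transpose J *v w) = H *v w" for w
  proof -
    have "transpose J *v w = (transpose J ** G) *v (H *v w)"
      by (simp add: matrix_vector_mul_assoc matrix_inv_right[OF inv_G] flip: matrix_mul_assoc)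
    also have "\<dots> = - (G *v (J *v (H *v w)))"
      unfolding skew_wrt_transpose[OF assms(2)] matrix_vector_mult_uminus_left
      by (simp flip: matrix_vector_mul_assoc)
    finally have "(J ** H) *v (transpose J *v w) = - (J *v ((H ** G) *v (J *v (H *v w))))"
      by (simp add: linear_neg[OF matrix_vector_mul_linear] flip: matrix_vector_mul_assoc)
    then show ?thesis by (simp add: matrix_inv_left[OF inv_G] assms(3))
  qed
  then show ?thesis
    using contract_transpose[OF assms(1), of "J ** H" J] by (simp add: matrix_vector_mul_assoc[symmetric])
qed

text \<open>For a two-form f this is, up to a constant, its inner product with the Kaehler form of J
  when J is skew.\<close>

definition ktrace :: "(real ^ 'n \<Rightarrow> real ^ 'n \<Rightarrow> 'v::real_vector) \<Rightarrow> real ^ 'n ^ 'n \<Rightarrow> 'v" where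
  "ktrace f J = (\<Sum>p\<in>UNIV. f (H *v axis p 1) (J *v axis p 1))"

lemma ktrace_isometry:
  assumes "bilinear f" "skew_wrt G K" "\<And>u. K *v (K *v u) = - u"
  shows "(\<Sum>p\<in>UNIV. f (K *v (H *v axis p 1)) (J *v (K *v axis p 1))) = ktrace f J"
proof -
  have "bilinear (\<lambda>u v. f u (J *v v))"
    using assms(1) by (auto simp: bilinear_def intro: linear_compose[OF matrix_vector_mul_linear, unfolded o_def])
  then show ?thesis using contract_isometry[of "\<lambda>u v. f u (J *v v)" K] assms by (simp add: ktrace_def)
qed

text \<open>Transforming both slots by the isometry K leaves the trace unchanged, while invariance
  of f and the anticommutation of J and K reverse its sign.\<close>

lemma ktrace_eq_0:
  assumes "bilinear f" "skew_wrt G K" "\<And>u. K *v (K *v u) = - u"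
    and "\<And>u v. f (K *v u) (K *v v) = f u v" "\<And>u. J *v (K *v u) = - (K *v (J *v u))"
  shows "ktrace f J = 0"
proof -
  have neg: "f u (- v) = - f u v" for u v using assms(1) by (simp add: bilinear_rneg)
  have "ktrace f J = - ktrace f J"
    using ktrace_isometry[OF assms(1-3), of J]
    by (simp add: assms(4,5) neg sum_negf ktrace_def)
  then show ?thesis by (rule eq_uminus_self_imp_0)
qed

text \<open>The closed form of \<open>B_op\<close> proved in \<open>B_op_triple_form\<close>. The
  factor 1/6 is the product of 1/2 from the contraction, 1/6 from the normalisation of the
  fundamental form and 2 from \<open>wedge_2_2\<close>; the sign of the normalisation reverses the
  bracket.\<close>

definition kaehler_operator :: "(real ^ 'n \<Rightarrow> real ^ 'n \<Rightarrow> 'v::real_vector) \<Rightarrow> real ^ 'n \<Rightarrow> real ^ 'n \<Rightarrow> 'v" where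
  "kaehler_operator f u v = (1 / 6) *\<^sub>R (\<Sum>J\<leftarrow>[J1, J2, J3].
     2 *\<^sub>R f (J *v u) (J *v v) - ((J *v u) \<bullet> (G *v v)) *\<^sub>R ktrace f J)"

lemma contract_kaehler_form:
  assumes "skew_wrt G J" "skew_wrt G K"
  shows "(\<Sum>p\<in>UNIV. (J *v (H *v axis p 1)) \<bullet> (G *v (K *v axis p 1))) = - trace (J ** K)"
proof -
  have "(J *v (H *v axis p 1)) \<bullet> (G *v (K *v axis p 1)) = - (J ** K) $ p $ p" for p
  proof -
    have "(J *v (H *v axis p 1)) \<bullet> (G *v (K *v axis p 1)) = - ((H *v axis p 1) \<bullet> (G *v (J *v (K *v axis p 1))))"
      using assms(1) by (simp add: skew_wrt_def)
    also have "(H *v axis p 1) \<bullet> (G *v (J *v (K *v axis p 1))) = axis p 1 \<bullet> (H *v (G *v (J *v (K *v axis p 1))))"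
      using transpose_symmetric[OF H_sym] by metis
    also have "H *v (G *v (J *v (K *v axis p 1))) = (J ** K) *v axis p 1"
      by (simp add: matrix_vector_mul_assoc matrix_inv_left[OF inv_G] matrix_mul_assoc)
    finally show ?thesis by (simp add: inner_axis' matrix_vector_mult_basis column_def)
  qed
  then show ?thesis by (simp add: trace_def sum_negf)
qed

text \<open>Anticommuting matrices have a product of trace 0 by cyclicity of the trace. Via
  \<open>contract_kaehler_form\<close> this is the orthogonality of the three Kaehler forms.\<close>

lemma trace_mult_J:
  "trace (J1 ** J1) = - CARD('n)" "trace (J2 ** J2) = - CARD('n)" "trace (J3 ** J3) = - CARD('n)"
  "trace (J1 ** J2) = 0" "trace (J2 ** J1) = 0" "trace (J1 ** J3) = 0" "trace (J3 ** J1) = 0"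
  "trace (J2 ** J3) = 0" "trace (J3 ** J2) = 0"
proof -
  have sq: "trace (J ** J) = - CARD('n)" if "\<And>u. J *v (J *v u) = - u" for J :: "real ^ 'n ^ 'n"
  proof -
    have "J ** J = - mat 1"
      using that by (simp add: matrix_eq matrix_vector_mul_assoc[symmetric] matrix_vector_mult_uminus_left)
    then show ?thesis by (simp add: trace_def sum_negf mat_def)
  qed
  have ac: "trace (J ** K) = 0 \<and> trace (K ** J) = 0" if "\<And>u. J *v (K *v u) = - (K *v (J *v u))" for J K :: "real ^ 'n ^ 'n"
  proof -
    have "J ** K = - (K ** J)"
      using that by (simp add: matrix_eq matrix_vector_mul_assoc[symmetric] matrix_vector_mult_uminus_left)
    then have "trace (J ** K) = - trace (K ** J)" by (simp add: trace_def sum_negf)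
    then show ?thesis using trace_mul_sym[of J K] by simp
  qed
  show "trace (J1 ** J1) = - CARD('n)" "trace (J2 ** J2) = - CARD('n)" "trace (J3 ** J3) = - CARD('n)"
    by (rule sq, simp add: mult_J)+
  show "trace (J1 ** J2) = 0" "trace (J2 ** J1) = 0" "trace (J1 ** J3) = 0" "trace (J3 ** J1) = 0"
    "trace (J2 ** J3) = 0" "trace (J3 ** J2) = 0"
    using ac[of J1 J2] ac[of J1 J3] ac[of J2 J3] by (simp_all add: mult_J)
qed

lemma kaehler_operator_fixed_iff:
  fixes f :: "real ^ 'n \<Rightarrow> real ^ 'n \<Rightarrow> 'v::real_vector"
  assumes f: "bilinear f"
  shows "(\<forall>u v. kaehler_operator f u v = f u v) \<longleftrightarrow>
    (\<forall>J\<in>{J1, J2, J3}. \<forall>u v. f (J *v u) (J *v v) = f u v)"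
proof
  assume J_inv: "\<forall>J\<in>{J1, J2, J3}. \<forall>u v. f (J *v u) (J *v v) = f u v"
  \<comment> \<open>Each trace vanishes by invariance under another member of the basis; then only
    the three equal terms \<open>2 *\<^sub>R f u v\<close> are left.\<close>
  have "ktrace f J1 = 0" "ktrace f J2 = 0" "ktrace f J3 = 0"
    using J_inv by (auto intro: ktrace_eq_0[OF f skew(2)] ktrace_eq_0[OF f skew(1)] simp: mult_J)
  then show "\<forall>u v. kaehler_operator f u v = f u v"
    using J_inv by (simp add: kaehler_operator_def flip: scaleR_left.add)
next
  assume fixed: "\<forall>u v. kaehler_operator f u v = f u v"
  have neg: "f u (- v) = - f u v" "f (- u) v = - f u v" for u v
    using f by (simp_all add: bilinear_rneg bilinear_lneg)
  have six: "6 *\<^sub>R f u v = (\<Sum>J\<leftarrow>[J1, J2, J3].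
     2 *\<^sub>R f (J *v u) (J *v v) - ((J *v u) \<bullet> (G *v v)) *\<^sub>R ktrace f J)" for u v
  proof -
    have "6 *\<^sub>R f u v = 6 *\<^sub>R kaehler_operator f u v" using fixed by simp
    then show ?thesis by (simp add: kaehler_operator_def)
  qed
  have tr: "6 *\<^sub>R ktrace f K = (\<Sum>J\<leftarrow>[J1, J2, J3].
      2 *\<^sub>R (\<Sum>p\<in>UNIV. f (J *v (H *v axis p 1)) (J *v (K *v axis p 1))) + trace (J ** K) *\<^sub>R ktrace f J)"
    if "K \<in> {J1, J2, J3}" for K
  proof -
    have "6 *\<^sub>R ktrace f K = (\<Sum>p\<in>UNIV. \<Sum>J\<leftarrow>[J1, J2, J3]. 2 *\<^sub>R f (J *v (H *v axis p 1)) (J *v (K *v axis p 1))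
        - ((J *v (H *v axis p 1)) \<bullet> (G *v (K *v axis p 1))) *\<^sub>R ktrace f J)"
      unfolding ktrace_def[of f K] scaleR_sum_right six ..
    also have "\<dots> = (\<Sum>J\<leftarrow>[J1, J2, J3]. 2 *\<^sub>R (\<Sum>p\<in>UNIV. f (J *v (H *v axis p 1)) (J *v (K *v axis p 1)))
        - (\<Sum>p\<in>UNIV. (J *v (H *v axis p 1)) \<bullet> (G *v (K *v axis p 1))) *\<^sub>R ktrace f J)"
      by (simp add: sum.distrib sum_subtractf scaleR_sum_right scaleR_sum_left)
    also have "\<dots> = (\<Sum>J\<leftarrow>[J1, J2, J3].
      2 *\<^sub>R (\<Sum>p\<in>UNIV. f (J *v (H *v axis p 1)) (J *v (K *v axis p 1))) + trace (J ** K) *\<^sub>R ktrace f J)"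
    proof -
      have "skew_wrt G K" using that skew by auto
      note contract_kaehler_form[OF skew(1) this] contract_kaehler_form[OF skew(2) this]
        contract_kaehler_form[OF skew(3) this]
      then show ?thesis by simp
    qed
    finally show ?thesis .
  qed
  \<comment> \<open>The constant c is 1 if K is J itself and -1 for the other two structures, so
    these terms add up to 2 - 2 - 2 = -2 times the trace. By \<open>trace_mult_J\<close> the rest is
    minus the dimension times the same trace.\<close>
  have commute: "(\<Sum>p\<in>UNIV. f (K *v (H *v axis p 1)) (K *v (J *v axis p 1))) = c *\<^sub>R ktrace f J"
    if "skew_wrt G K" "\<And>u. K *v (K *v u) = - u" "\<And>u. K *v (J *v u) = c *\<^sub>R (J *v (K *v u))" for J K c
    using ktrace_isometry[OF f that(1,2), of J]
    by (simp add: that(3) bilinear_rmul[OF f] flip: scaleR_sum_right)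
  have zero: "t = 0" if "real CARD('n) *\<^sub>R t + 6 *\<^sub>R t = - (2 *\<^sub>R t)" for t :: 'v
  proof -
    have "(real CARD('n) + 6 + 2) *\<^sub>R t = 0"
      unfolding scaleR_left_distrib that by simp
    moreover have "real CARD('n) + 6 + 2 \<noteq> 0" by linarith
    ultimately show "t = 0" by simp
  qed
  have t1: "ktrace f J1 = 0"
    using tr[of J1] commute[of J1 J1 1] commute[of J2 J1 "-1"] commute[of J3 J1 "-1"]
    by (intro zero) (simp add: mult_J skew trace_mult_J algebra_simps)
  have t2: "ktrace f J2 = 0"
    using tr[of J2] commute[of J1 J2 "-1"] commute[of J2 J2 1] commute[of J3 J2 "-1"]
    by (intro zero) (simp add: mult_J skew trace_mult_J algebra_simps)
  have t3: "ktrace f J3 = 0"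
    using tr[of J3] commute[of J1 J3 "-1"] commute[of J2 J3 "-1"] commute[of J3 J3 1]
    by (intro zero) (simp add: mult_J skew trace_mult_J algebra_simps)
  have three: "3 *\<^sub>R f u v = f (J1 *v u) (J1 *v v) + f (J2 *v u) (J2 *v v) + f (J3 *v u) (J3 *v v)" for u v
  proof -
    have "2 *\<^sub>R (3 *\<^sub>R f u v) = 2 *\<^sub>R (f (J1 *v u) (J1 *v v) + f (J2 *v u) (J2 *v v) + f (J3 *v u) (J3 *v v))"
      using six[of u v] t1 t2 t3 by (simp add: scaleR_add_right)
    then show ?thesis by (simp only: scaleR_cancel_left) simp
  qed
  \<comment> \<open>Here a is the form, b its transform by one structure, c and d its transforms by
    the other two. Transforming the whole identity by the first structure exchanges a with b and c
    with d.\<close>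
  have cancel: "b = a" if "3 *\<^sub>R a = b + c + d" "3 *\<^sub>R b = a + c + d" for a b c d :: 'v
  proof -
    have "4 *\<^sub>R x = 3 *\<^sub>R x + x" for x :: 'v using scaleR_left_distrib[of 3 1 x] by simp
    then have "4 *\<^sub>R b = 4 *\<^sub>R a" using that by (simp add: algebra_simps)
    then show ?thesis by simp
  qed
  have "f (J1 *v u) (J1 *v v) = f u v" for u v
    by (rule cancel[of _ _ "f (J2 *v u) (J2 *v v)" "f (J3 *v u) (J3 *v v)"])
       (simp_all add: three mult_J neg add_ac)
  moreover have "f (J2 *v u) (J2 *v v) = f u v" for u v
    by (rule cancel[of _ _ "f (J1 *v u) (J1 *v v)" "f (J3 *v u) (J3 *v v)"])
       (simp_all add: three mult_J neg add_ac)
  moreover have "f (J3 *v u) (J3 *v v) = f u v" for u v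
    by (rule cancel[of _ _ "f (J1 *v u) (J1 *v v)" "f (J2 *v u) (J2 *v v)"])
       (simp_all add: three mult_J neg add_ac)
  ultimately show "\<forall>J\<in>{J1, J2, J3}. \<forall>u v. f (J *v u) (J *v v) = f u v" by simp
qed

text \<open>Raising one index of the Kaehler form of J recovers J; the sign depends on which index
  is raised.\<close>

lemma contract_kaehler_left:
  assumes "skew_wrt G J" "linear \<psi>"
  shows "(\<Sum>p\<in>UNIV. kaehler_form G J [axis p 1, u] *\<^sub>R \<psi> (H *v axis p 1)) = - \<psi> (J *v u)"
proof -
  have "kaehler_form G J [axis p 1, u] = (- (G *v (J *v u))) $ p" for p
    using assms(1) by (simp add: kaehler_form_def skew_wrt_def inner_axis')
  then have "(\<Sum>p\<in>UNIV. kaehler_form G J [axis p 1, u] *\<^sub>R \<psi> (H *v axis p 1)) = \<psi> (H *v (- (G *v (J *v u))))"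
    by (simp only: sum_nth_scaleR_linear[OF assms(2)])
  also have "\<dots> = \<psi> (- ((H ** G) *v (J *v u)))"
    by (simp add: linear_neg[OF matrix_vector_mul_linear] flip: matrix_vector_mul_assoc)
  finally show ?thesis
    by (simp add: matrix_inv_left[OF inv_G] linear_neg[OF assms(2)])
qed

lemma contract_kaehler_right:
  assumes "linear \<psi>"
  shows "(\<Sum>q\<in>UNIV. kaehler_form G J [u, axis q 1] *\<^sub>R \<psi> (H *v axis q 1)) = \<psi> (J *v u)"
proof -
  have "kaehler_form G J [u, axis q 1] = (G *v (J *v u)) $ q" for q
    by (simp add: kaehler_form_def transpose_symmetric[OF G_sym] inner_axis)
  then have "(\<Sum>q\<in>UNIV. kaehler_form G J [u, axis q 1] *\<^sub>R \<psi> (H *v axis q 1)) = \<psi> (H *v (G *v (J *v u)))"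
    by (simp only: sum_nth_scaleR_linear[OF assms])
  then show ?thesis by (simp add: matrix_vector_mul_assoc matrix_inv_left[OF inv_G] matrix_mul_assoc)
qed

lemma kaehler_form_skew:
  assumes "skew_wrt G J"
  shows "kaehler_form G J [u, v] = - kaehler_form G J [v, u]"
proof -
  have "kaehler_form G J [u, v] = - ((G *v u) \<bullet> (J *v v))"
    using assms transpose_symmetric[OF G_sym, of u] by (simp add: kaehler_form_def skew_wrt_def)
  then show ?thesis by (simp add: kaehler_form_def inner_commute)
qed

lemma multilinear_kaehler_form: "multilinear 2 (kaehler_form G J)"
  by (simp add: multilinear_2_iff bilinear_def kaehler_form_def linear_iff matrix_vector_right_distrib
      matrix_vector_mult_scaleR inner_add_left inner_add_right)

definition triple_form :: "('n, real) form" where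
  "triple_form vs = - (1/6) * (\<Sum>J\<leftarrow>[J1, J2, J3]. wedge (*) 2 2 (kaehler_form G J) (kaehler_form G J) vs)"

lemma multilinear_triple_form: "multilinear 4 triple_form"
proof -
  have "bilinear ((*) :: real \<Rightarrow> real \<Rightarrow> real)" by (simp add: bilinear_def linear_iff algebra_simps)
  then have ml: "multilinear 4 (wedge (*) 2 2 (kaehler_form G J) (kaehler_form G J))" for J
    using multilinear_wedge[OF _ multilinear_kaehler_form multilinear_kaehler_form, of "(*)" J J] by simp
  show ?thesis
    using ml[of J1] ml[of J2] ml[of J3]
    by (simp add: multilinear_def triple_form_def linear_iff field_simps)
qed

lemma alternating_triple_form: "alternating 4 triple_form"
  using alternating_wedge[of 2 2 "(*)" "kaehler_form G J1" "kaehler_form G J1"]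
    alternating_wedge[of 2 2 "(*)" "kaehler_form G J2" "kaehler_form G J2"]
    alternating_wedge[of 2 2 "(*)" "kaehler_form G J3" "kaehler_form G J3"]
  by (simp add: alternating_def triple_form_def algebra_simps)

text \<open>Of the three products in \<open>wedge_2_2\<close> the one pairing the two contracted
  slots yields the trace. The other two agree because f is skew, and each yields the transform of f
  by J.\<close>

lemma contract_wedge_kaehler_form:
  fixes f :: "real ^ 'n \<Rightarrow> real ^ 'n \<Rightarrow> 'v::real_vector"
  assumes f: "bilinear f" "\<And>u v. f u v = - f v u" and J: "skew_wrt G J"
  shows "(\<Sum>p\<in>UNIV. \<Sum>q\<in>UNIV. wedge (*) 2 2 (kaehler_form G J) (kaehler_form G J) [axis p 1, axis q 1, u, v]
      *\<^sub>R f (H *v axis p 1) (H *v axis q 1)) =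
    2 *\<^sub>R (((J *v u) \<bullet> (G *v v)) *\<^sub>R ktrace f J - 2 *\<^sub>R f (J *v u) (J *v v))"
proof -
  let ?\<omega> = "\<lambda>u v. kaehler_form G J [u, v]"
  have lin: "linear (f u)" "linear (\<lambda>u. f u v)" for u v using f(1) by (auto simp: bilinear_def)
  have 1: "(\<Sum>p\<in>UNIV. \<Sum>q\<in>UNIV. (?\<omega> (axis p 1) (axis q 1) * ?\<omega> u v) *\<^sub>R f (H *v axis p 1) (H *v axis q 1)) =
      ?\<omega> u v *\<^sub>R ktrace f J"
  proof -
    have "(\<Sum>p\<in>UNIV. \<Sum>q\<in>UNIV. (?\<omega> (axis p 1) (axis q 1) * ?\<omega> u v) *\<^sub>R f (H *v axis p 1) (H *v axis q 1)) =
      ?\<omega> u v *\<^sub>R (\<Sum>p\<in>UNIV. \<Sum>q\<in>UNIV. ?\<omega> (axis p 1) (axis q 1) *\<^sub>R f (H *v axis p 1) (H *v axis q 1))"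
      by (simp add: scaleR_sum_right mult.commute)
    then show ?thesis by (simp add: contract_kaehler_right[OF lin(1)] ktrace_def)
  qed
  have 2: "(\<Sum>p\<in>UNIV. \<Sum>q\<in>UNIV. (?\<omega> (axis p 1) w * ?\<omega> (axis q 1) z) *\<^sub>R f (H *v axis p 1) (H *v axis q 1)) =
      f (J *v w) (J *v z)" for w z
  proof -
    have "(\<Sum>q\<in>UNIV. (?\<omega> (axis p 1) w * ?\<omega> (axis q 1) z) *\<^sub>R f (H *v axis p 1) (H *v axis q 1)) =
      - (?\<omega> (axis p 1) w *\<^sub>R f (H *v axis p 1) (J *v z))" for p
    proof -
      have "(\<Sum>q\<in>UNIV. (?\<omega> (axis p 1) w * ?\<omega> (axis q 1) z) *\<^sub>R f (H *v axis p 1) (H *v axis q 1)) =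
        ?\<omega> (axis p 1) w *\<^sub>R (\<Sum>q\<in>UNIV. ?\<omega> (axis q 1) z *\<^sub>R f (H *v axis p 1) (H *v axis q 1))"
        by (simp add: scaleR_sum_right)
      then show ?thesis by (simp add: contract_kaehler_left[OF J lin(1)])
    qed
    then show ?thesis by (simp add: sum_negf contract_kaehler_left[OF J lin(2)])
  qed
  have "(\<Sum>p\<in>UNIV. \<Sum>q\<in>UNIV. wedge (*) 2 2 (kaehler_form G J) (kaehler_form G J) [axis p 1, axis q 1, u, v]
      *\<^sub>R f (H *v axis p 1) (H *v axis q 1)) =
    2 *\<^sub>R ((\<Sum>p\<in>UNIV. \<Sum>q\<in>UNIV. (?\<omega> (axis p 1) (axis q 1) * ?\<omega> u v) *\<^sub>R f (H *v axis p 1) (H *v axis q 1))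
     - (\<Sum>p\<in>UNIV. \<Sum>q\<in>UNIV. (?\<omega> (axis p 1) u * ?\<omega> (axis q 1) v) *\<^sub>R f (H *v axis p 1) (H *v axis q 1))
     + (\<Sum>p\<in>UNIV. \<Sum>q\<in>UNIV. (?\<omega> (axis p 1) v * ?\<omega> (axis q 1) u) *\<^sub>R f (H *v axis p 1) (H *v axis q 1)))"
    by (simp add: wedge_2_2[of "kaehler_form G J", OF kaehler_form_skew[OF J]] scaleR_sum_right scaleR_left_distrib scaleR_left_diff_distrib
        sum.distrib sum_subtractf algebra_simps)
  also have "\<dots> = 2 *\<^sub>R (((J *v u) \<bullet> (G *v v)) *\<^sub>R ktrace f J - 2 *\<^sub>R f (J *v u) (J *v v))"
    unfolding 1 2 using f(2)[of "J *v v" "J *v u"]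
    by (simp add: kaehler_form_def scaleR_2)
  finally show ?thesis .
qed

end

lemma B_op_triple_form:
  fixes G :: "((real, 'n::{finite, linorder}) vec, 'n) vec" and \<alpha> :: "('n, 'v::real_vector) form"
  assumes tr: "quaternionic_triple G Q J1 J2 J3" and n: "CARD('n) \<ge> 4"
    and \<alpha>: "multilinear 2 \<alpha>" "\<And>u v. \<alpha> [u, v] = - \<alpha> [v, u]"
  shows "B_op G (quaternionic_triple.triple_form G J1 J2 J3) \<alpha> [u, v] =
    quaternionic_triple.kaehler_operator G J1 J2 J3 (\<lambda>u v. \<alpha> [u, v]) u v"
proof -
  interpret quaternionic_triple G Q J1 J2 J3 by (rule tr)
  let ?f = "\<lambda>u v. \<alpha> [u, v]"
  have f: "bilinear ?f" using \<alpha>(1) by (simp add: multilinear_2_iff)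
  let ?W = "\<lambda>J p q. wedge (*) 2 2 (kaehler_form G J) (kaehler_form G J) [axis p 1, axis q 1, u, v]"
  have "B_op G triple_form \<alpha> [u, v] = (1 / 2) *\<^sub>R (\<Sum>p\<in>UNIV. \<Sum>q\<in>UNIV.
      triple_form [axis p 1, axis q 1, u, v] *\<^sub>R ?f (H *v axis p 1) (H *v axis q 1))"
    by (rule B_op_eq[OF multilinear_triple_form alternating_triple_form \<alpha>(1) n G_det G_sym])
  also have "\<dots> = - (1 / 12) *\<^sub>R (\<Sum>J\<leftarrow>[J1, J2, J3]. \<Sum>p\<in>UNIV. \<Sum>q\<in>UNIV. ?W J p q *\<^sub>R ?f (H *v axis p 1) (H *v axis q 1))"
  proof -
    have "triple_form [axis p 1, axis q 1, u, v] *\<^sub>R x =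
        - (1 / 6) *\<^sub>R (?W J1 p q *\<^sub>R x + ?W J2 p q *\<^sub>R x + ?W J3 p q *\<^sub>R x)" for p q and x :: 'v
      by (simp add: triple_form_def scaleR_left_distrib scaleR_left_diff_distrib scaleR_add_right add_divide_distrib)
    then show ?thesis
      by (simp only: sum.distrib flip: scaleR_sum_right) (simp add: add_ac)
  qed
  also have "\<dots> = kaehler_operator ?f u v"
    by (simp add: contract_wedge_kaehler_form[OF f \<alpha>(2)] skew kaehler_operator_def algebra_simps)
  finally show ?thesis .
qed

section \<open>Grassmann frames\<close>

text \<open>A square root of -1 with nonzero trace is a nonzero scalar matrix, and that anticommutes
  with no invertible matrix. Once the trace is 0, the determinant is minus the entry of the
  square.\<close>

lemma anticommuting_2x2_traceless:
  fixes a b c d p q r s :: complex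
  assumes "a * a + b * c = -1" "a * b + b * d = 0" "c * a + d * c = 0" "c * b + d * d = -1"
    and "p * p + q * r = -1" "p * q + q * s = 0" "r * p + s * r = 0" "r * q + s * s = -1"
    and "a * p + b * r = - (p * a + q * c)" "a * q + b * s = - (p * b + q * d)"
    and "c * p + d * r = - (r * a + s * c)" "c * q + d * s = - (r * b + s * d)"
  shows "d = - a" and "a * d - b * c = 1"
proof -
  show d: "d = - a"
  proof (rule ccontr)
    assume ne: "d \<noteq> - a"
    then have ad: "a + d \<noteq> 0" by (metis add.commute add_eq_0_iff)
    have "b * (a + d) = 0" "c * (a + d) = 0" using assms(2,3) by (simp_all add: algebra_simps)
    then have bc: "b = 0" "c = 0" using ad by simp_all
    have "(a + d) * (a - d) = 0" using assms(1,4) bc by (simp add: algebra_simps)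
    then have "a = d" using ad by simp
    moreover have "a \<noteq> 0" using assms(1) bc by auto
    moreover have "2 * (a * p) = 0" "q * (a + d) = 0"
      using assms(9,10) bc by (simp_all add: algebra_simps)
    ultimately have "p = 0" "q = 0" using ad by (metis mult_eq_0_iff zero_neq_numeral)+
    then show False using assms(5) by simp
  qed
  show "a * d - b * c = 1" using assms(1) d by algebra
qed

text \<open>Here \<open>(x, y; y, w)\<close> is a symmetric bilinear form and \<open>(a, b; c, -a)\<close>, \<open>(p, q; r, -p)\<close> are anticommuting
  complex structures on the plane; the linear hypotheses express invariance of the form under both.\<close>

lemma invariant_symmetric_2x2_eq_0:
  fixes a b c p q r x y w :: complex
  assumes 1: "a * a + b * c = -1" "p * p + q * r = -1" and anti: "2 * a * p + b * r + c * q = 0"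
    and j1: "a * x + c * y = 0" "b * y - a * w = 0" "b * x + c * w = 0"
    and j2: "p * x + r * y = 0" "q * y - p * w = 0" "q * x + r * w = 0"
  shows "x = 0" "y = 0" "w = 0"
proof -
  show x: "x = 0"
  proof (rule ccontr)
    assume "x \<noteq> 0"
    \<comment> \<open>Multiplying the quadratic relations by \<open>x * x\<close> and removing a, b,
      p, q with the linear ones leaves c, r and D only. The first two results make c, r and D
      nonzero, the third makes their product 0.\<close>
    define D where "D = y * y - w * x"
    have "c * c * D = - (x * x)" "r * r * D = - (x * x)" "2 * c * r * D = 0"
      unfolding D_def using 1 anti j1 j2 by algebra+
    then show False using \<open>x \<noteq> 0\<close> by auto
  qed
  show w: "w = 0"
  proof (rule ccontr)
    assume "w \<noteq> 0"
    define D where "D = y * y - w * x"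
    have "b * b * D = - (w * w)" "q * q * D = - (w * w)" "2 * b * q * D = 0"
      unfolding D_def using 1 anti j1 j2 by algebra+
    then show False using \<open>w \<noteq> 0\<close> by auto
  qed
  show "y = 0"
  proof (rule ccontr)
    assume "y \<noteq> 0"
    then have "b = 0" "c = 0" "q = 0" "r = 0" using j1 j2 x w by auto
    then show False using 1 anti by auto
  qed
qed

text \<open>With S = (x, y; y, w) and l = (a, b; c, -a), the hypotheses are the entries of the
  invariance of S under l, the off-diagonal one simplified by s. As l squares to -1, invariance
  means that S l is skew; the conclusions are the entries of S l plus its transpose, up to factors
  2.\<close>

lemma invariant_symmetric_2x2_linear:
  fixes a b c x y w :: complex
  assumes s: "a * a + b * c = -1"
    and e: "x = a * a * x + 2 * (a * c) * y + c * c * w" "w = b * b * x - 2 * (a * b) * y + a * a * w"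
      "a * b * x + 2 * (b * c) * y - a * c * w = 0"
  shows "a * x + c * y = 0" "b * y - a * w = 0" "b * x + c * w = 0"
proof -
  define P Q R where "P = a * x + c * y" and "Q = b * y - a * w" and "R = b * x + c * w"
  note defs = P_def Q_def R_def
  have 1: "2 * (a * P) + c * R = 0" unfolding defs using s e(1) by algebra
  have 2: "2 * (a * Q) - b * R = 0" unfolding defs using s e(2) by algebra
  have 3: "b * P + c * Q = 0" unfolding defs using e(3) by algebra
  have 4: "a * R = b * P - c * Q" unfolding defs by algebra
  have "R = 0" using s 1 2 4 by algebra
  then have "a * P = 0" "a * Q = 0" "b * P = 0" "c * Q = 0" using 1 2 3 4 by auto
  then have "P = 0" "Q = 0" using s by algebra+
  then show "a * x + c * y = 0" "b * y - a * w = 0" "b * x + c * w = 0"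
    using \<open>R = 0\<close> by (simp_all add: defs)
qed

lemma coval_linear: "linear (coval \<theta>)"
  by (auto simp: coval_def linear_iff algebra_simps sum.distrib sum_distrib_left
      scaleR_conv_of_real[where 'a = complex] intro!: sum.cong)

lemma coval_axis [simp]: "coval \<theta> (axis i 1) = \<theta> $ i"
proof -
  have "\<theta> $ j * complex_of_real (axis i 1 $ j) = (if j = i then \<theta> $ j else 0)" for j
    by (simp add: axis_def)
  then show ?thesis by (simp add: coval_def)
qed

lemma sum_4_eq:
  fixes g :: "'e::finite \<Rightarrow> 'e \<Rightarrow> 'f::finite \<Rightarrow> 'f \<Rightarrow> 'v::comm_monoid_add"
  shows "(\<Sum>a\<in>UNIV. \<Sum>b\<in>UNIV. \<Sum>A\<in>UNIV. \<Sum>B\<in>UNIV. g a b A B) =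
    (\<Sum>a\<in>UNIV. \<Sum>A\<in>UNIV. \<Sum>b\<in>UNIV. \<Sum>B\<in>UNIV. g a b A B)"
  by (rule sum.cong[OF refl]) (rule sum.swap)

section \<open>Frames of the complexified cotangent space\<close>

locale grassmann_frame =
  fixes \<theta> :: "'e::finite \<Rightarrow> 2 \<Rightarrow> complex ^ 'n"
  assumes frame: "bij (\<lambda>z :: complex ^ ('e \<times> 2). \<Sum>a\<in>UNIV. \<Sum>B\<in>UNIV. z $ (a, B) *s \<theta> a B)"
begin

abbreviation "T a B u \<equiv> coval (\<theta> a B) u"

abbreviation "frame_sum C u v \<equiv> \<Sum>a\<in>UNIV. \<Sum>b\<in>UNIV. \<Sum>A\<in>UNIV. \<Sum>B\<in>UNIV. C a b A B * T a A u * T b B v"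

lemma coval_combination:
  "coval (\<Sum>a\<in>UNIV. \<Sum>B\<in>UNIV. z a B *s \<theta> a B) u = (\<Sum>a\<in>UNIV. \<Sum>B\<in>UNIV. z a B * T a B u)"
proof -
  have add: "coval (x + y) u = coval x u + coval y u" for x y
    by (simp add: coval_def algebra_simps sum.distrib)
  have zero: "coval 0 u = 0" by (simp add: coval_def)
  have cs: "coval (sum h S) u = (\<Sum>s\<in>S. coval (h s) u)" if "finite S" for h and S :: "'x set"
    using that by induction (auto simp: add zero)
  show ?thesis by (simp add: cs) (simp add: coval_def sum_distrib_left mult.assoc)
qed

text \<open>Real test vectors suffice, because the coordinate vectors already read off all complex
  components of a covector.\<close>

lemma frame_independent:
  assumes "\<And>u. (\<Sum>a\<in>UNIV. \<Sum>B\<in>UNIV. z a B * T a B u) = 0"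
  shows "z a B = 0"
proof -
  define Z :: "complex ^ ('e \<times> 2)" where "Z = (\<chi> x. z (fst x) (snd x))"
  have "(\<Sum>a\<in>UNIV. \<Sum>B\<in>UNIV. z a B *s \<theta> a B) $ i = 0" for i
    using assms[of "axis i 1"] by (simp add: sum_component)
  then have "(\<Sum>a\<in>UNIV. \<Sum>B\<in>UNIV. Z $ (a, B) *s \<theta> a B) = (\<Sum>a\<in>UNIV. \<Sum>B\<in>UNIV. (0 :: complex ^ ('e \<times> 2)) $ (a, B) *s \<theta> a B)"
    by (simp add: vec_eq_iff Z_def)
  then have "Z = 0" using injD[OF bij_is_inj[OF frame]] by blast
  then have "Z $ (a, B) = 0" by simp
  then show ?thesis by (simp add: Z_def)
qed

lemma frame_independent_H:
  assumes "\<And>u. (\<Sum>B\<in>UNIV. w B * T a B u) = 0"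
  shows "w B = 0"
proof -
  have "(\<Sum>a'\<in>UNIV. \<Sum>B\<in>UNIV. (if a' = a then w B else 0) * T a' B u) = 0" for u
  proof -
    have "(\<Sum>B\<in>UNIV. (if a' = a then w B else 0) * T a' B u) = (if a' = a then \<Sum>B\<in>UNIV. w B * T a B u else 0)" for a'
      by simp
    then show ?thesis using assms by simp
  qed
  from frame_independent[of "\<lambda>a' B. if a' = a then w B else 0", OF this, of a B] show ?thesis by simp
qed

lemma frame_independent_2:
  assumes "\<And>u v. frame_sum C u v = 0"
  shows "C a b A B = 0"
proof -
  have "(\<Sum>b\<in>UNIV. \<Sum>B\<in>UNIV. C a b A B * T b B v) = 0" for a A v
  proof (rule frame_independent[of "\<lambda>a A. \<Sum>b\<in>UNIV. \<Sum>B\<in>UNIV. C a b A B * T b B v"])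
    fix u
    show "(\<Sum>a\<in>UNIV. \<Sum>A\<in>UNIV. (\<Sum>b\<in>UNIV. \<Sum>B\<in>UNIV. C a b A B * T b B v) * T a A u) = 0"
      using assms[of u v] unfolding sum_4_eq by (simp add: sum_distrib_left mult_ac)
  qed
  from frame_independent[of "\<lambda>b B. C a b A B", OF this] show ?thesis .
qed

text \<open>Surjectivity of the frame map expresses every coordinate covector through the frame;
  these expressions are inserted into the coordinate expansion of \<open>\<phi>\<close>, one slot
  after the other.\<close>

lemma frame_expand:
  fixes \<phi> :: "real ^ 'n \<Rightarrow> real ^ 'n \<Rightarrow> complex"
  assumes "bilinear \<phi>"
  shows "\<exists>C. \<forall>u v. \<phi> u v = frame_sum C u v"
proof -
  have "\<exists>z. \<forall>u. complex_of_real (u $ i) = (\<Sum>a\<in>UNIV. \<Sum>B\<in>UNIV. z a B * T a B u)" for i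
  proof -
    obtain Z :: "complex ^ ('e \<times> 2)" where Z: "axis i 1 = (\<Sum>a\<in>UNIV. \<Sum>B\<in>UNIV. Z $ (a, B) *s \<theta> a B)"
      using surjD[OF bij_is_surj[OF frame], of "axis i 1"] by blast
    have "complex_of_real (u $ i) = coval (axis i 1) u" for u
    proof -
      have "axis i 1 $ j * complex_of_real (u $ j) = (if j = i then complex_of_real (u $ j) else 0)" for j
        by (simp add: axis_def)
      then show ?thesis by (simp add: coval_def)
    qed
    then show ?thesis
      by (intro exI[of _ "\<lambda>a B. Z $ (a, B)"]) (simp add: Z coval_combination)
  qed
  then have "\<forall>i. \<exists>z. \<forall>u. complex_of_real (u $ i) = (\<Sum>a\<in>UNIV. \<Sum>B\<in>UNIV. z a B * T a B u)" by blast
  from choice[OF this] obtain z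
    where "\<forall>i. \<forall>u. complex_of_real (u $ i) = (\<Sum>a\<in>UNIV. \<Sum>B\<in>UNIV. z i a B * T a B u)" by blast
  then have z: "complex_of_real (u $ i) = (\<Sum>a\<in>UNIV. \<Sum>B\<in>UNIV. z i a B * T a B u)" for i u by blast
  have lin: "linear (\<phi> u)" "linear (\<lambda>u. \<phi> u v)" for u v using assms by (auto simp: bilinear_def)
  have one: "f u = (\<Sum>a\<in>UNIV. \<Sum>A\<in>UNIV. (\<Sum>p\<in>UNIV. f (axis p 1) * z p a A) * T a A u)"
    if "linear f" for f :: "real ^ 'n \<Rightarrow> complex" and u
  proof -
    have "f u = (\<Sum>p\<in>UNIV. f (axis p 1) * complex_of_real (u $ p))"
      by (subst linear_eq_sum_axis[OF that]) (simp add: scaleR_conv_of_real mult.commute)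
    also have "\<dots> = (\<Sum>p\<in>UNIV. \<Sum>a\<in>UNIV. \<Sum>A\<in>UNIV. f (axis p 1) * z p a A * T a A u)"
      by (simp add: z sum_distrib_left mult.assoc)
    also have "\<dots> = (\<Sum>a\<in>UNIV. \<Sum>A\<in>UNIV. \<Sum>p\<in>UNIV. f (axis p 1) * z p a A * T a A u)"
      by (subst sum.swap, rule sum.cong[OF refl], rule sum.swap)
    finally show ?thesis by (simp add: sum_distrib_right)
  qed
  define C where "C a b A B = (\<Sum>p\<in>UNIV. (\<Sum>q\<in>UNIV. \<phi> (axis p 1) (axis q 1) * z q b B) * z p a A)" for a b A B
  have "\<phi> u v = frame_sum C u v" for u v
  proof -
    have "\<phi> u v = (\<Sum>b\<in>UNIV. \<Sum>B\<in>UNIV. (\<Sum>q\<in>UNIV. \<phi> u (axis q 1) * z q b B) * T b B v)"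
      by (rule one[OF lin(1)])
    also have "\<dots> = (\<Sum>b\<in>UNIV. \<Sum>B\<in>UNIV. (\<Sum>a\<in>UNIV. \<Sum>A\<in>UNIV. C a b A B * T a A u) * T b B v)"
    proof -
      have "linear (\<lambda>u. \<Sum>q\<in>UNIV. \<phi> u (axis q 1) * z q b B)" for b B
        using lin(2) by (intro linear_compose_sum) (simp add: linear_iff algebra_simps)
      then have "(\<Sum>q\<in>UNIV. \<phi> u (axis q 1) * z q b B) = (\<Sum>a\<in>UNIV. \<Sum>A\<in>UNIV. C a b A B * T a A u)" for b B
        unfolding C_def by (rule one)
      then show ?thesis by (simp only:)
    qed
    also have "\<dots> = (\<Sum>b\<in>UNIV. \<Sum>a\<in>UNIV. \<Sum>B\<in>UNIV. \<Sum>A\<in>UNIV. C a b A B * T a A u * T b B v)"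
      unfolding sum_4_eq by (simp add: sum_distrib_right)
    also have "\<dots> = frame_sum C u v"
      by (rule trans[OF sum.swap], rule sum.cong[OF refl], rule sum.cong[OF refl], rule sum.swap)
    finally show ?thesis .
  qed
  then show ?thesis by blast
qed

text \<open>The matrix acts on the values of the frame covectors, so composition of endomorphisms
  corresponds to the matrix product in the same order.\<close>

definition H_action :: "complex ^ 2 ^ 2 \<Rightarrow> real ^ 'n ^ 'n \<Rightarrow> bool" where
  "H_action j J \<longleftrightarrow> (\<forall>a A u. T a A (J *v u) = (\<Sum>B\<in>UNIV. j $ A $ B * T a B u))"

lemma H_action_mult:
  assumes "H_action j J" "H_action k K"
  shows "T a A (J *v (K *v u)) = (\<Sum>B\<in>UNIV. (j ** k) $ A $ B * T a B u)"
  using assms unfolding H_action_def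
  by (simp add: sum_2 matrix_matrix_mult_def algebra_simps)

text \<open>Independence of the frame makes the action faithful, hence relations between
  endomorphisms pass to the 2 by 2 matrices. The sign covers both the squares and the
  anticommutation.\<close>

lemma H_action_mult_eq:
  assumes "H_action j J" "H_action k K" "H_action j' J'" "H_action k' K'"
    and "\<And>u. J *v (K *v u) = - (J' *v (K' *v u))"
  shows "j ** k = - (j' ** k')"
proof -
  fix a :: 'e
  have "(j ** k) $ A $ B + (j' ** k') $ A $ B = 0" for A B
  proof (rule frame_independent_H[of "\<lambda>B. (j ** k) $ A $ B + (j' ** k') $ A $ B" a])
    fix u
    have "T a A (J *v (K *v u)) = - T a A (J' *v (K' *v u))"
      unfolding assms(5) by (rule linear_neg[OF coval_linear])
    then show "(\<Sum>B\<in>UNIV. ((j ** k) $ A $ B + (j' ** k') $ A $ B) * T a B u) = 0"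
      unfolding H_action_mult[OF assms(1,2)] H_action_mult[OF assms(3,4)]
      by (simp add: algebra_simps sum.distrib)
  qed
  then show ?thesis by (simp add: vec_eq_iff add_eq_0_iff)
qed

lemma H_action_square:
  assumes "H_action j J" "\<And>u. J *v (J *v u) = - u"
  shows "j ** j = - mat 1"
proof -
  have "H_action (mat 1) (mat 1)"
  proof -
    have "(mat 1 :: complex ^ 2 ^ 2) $ A $ B * T a B u = (if B = A then T a B u else 0)" for A B a u
      by (simp add: mat_def)
    then show ?thesis by (simp add: H_action_def)
  qed
  from H_action_mult_eq[OF assms(1,1) this this] assms(2) show ?thesis by simp
qed

text \<open>For fixed a and b, the part of the coefficients symmetric in A and B is a symmetric form
  on the plane invariant under j and k, and no such form except 0 exists. So invariance forces
  skewness in A, B, and skewness of \<open>\<phi>\<close> then gives symmetry in a, b.\<close>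

lemma invariant_iff_skew_H:
  fixes \<phi> :: "real ^ 'n \<Rightarrow> real ^ 'n \<Rightarrow> complex"
  assumes \<phi>: "bilinear \<phi>" "\<And>u v. \<phi> u v = - \<phi> v u"
    and j: "H_action j J" "\<And>u. J *v (J *v u) = - u" and k: "H_action k K" "\<And>u. K *v (K *v u) = - u"
    and jk: "\<And>u. J *v (K *v u) = - (K *v (J *v u))"
  shows "(\<forall>u v. \<phi> (J *v u) (J *v v) = \<phi> u v \<and> \<phi> (K *v u) (K *v v) = \<phi> u v) \<longleftrightarrow>
    (\<exists>C. (\<forall>a b A B. C a b A B = C b a A B \<and> C a b A B = - C a b B A) \<and>
      (\<forall>u v. \<phi> u v = frame_sum C u v))"
    (is "?inv \<longleftrightarrow> ?flat")
proof -
  have jj: "j ** j = - mat 1" and kk: "k ** k = - mat 1" and ac: "j ** k = - (k ** j)"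
    using H_action_square[OF j] H_action_square[OF k] H_action_mult_eq[OF j(1) k(1) k(1) j(1) jk] by auto
  have e: "(M ** N) $ x $ y = M $ x $ 1 * N $ 1 $ y + M $ x $ 2 * N $ 2 $ y" for M N :: "complex ^ 2 ^ 2" and x y
    by (simp add: matrix_matrix_mult_def sum_2)
  have j_eqs: "j $ 1 $ 1 * j $ 1 $ 1 + j $ 1 $ 2 * j $ 2 $ 1 = -1" "j $ 1 $ 1 * j $ 1 $ 2 + j $ 1 $ 2 * j $ 2 $ 2 = 0"
    "j $ 2 $ 1 * j $ 1 $ 1 + j $ 2 $ 2 * j $ 2 $ 1 = 0" "j $ 2 $ 1 * j $ 1 $ 2 + j $ 2 $ 2 * j $ 2 $ 2 = -1"
    unfolding e[symmetric] jj by (simp_all add: mat_def)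
  have k_eqs: "k $ 1 $ 1 * k $ 1 $ 1 + k $ 1 $ 2 * k $ 2 $ 1 = -1" "k $ 1 $ 1 * k $ 1 $ 2 + k $ 1 $ 2 * k $ 2 $ 2 = 0"
    "k $ 2 $ 1 * k $ 1 $ 1 + k $ 2 $ 2 * k $ 2 $ 1 = 0" "k $ 2 $ 1 * k $ 1 $ 2 + k $ 2 $ 2 * k $ 2 $ 2 = -1"
    unfolding e[symmetric] kk by (simp_all add: mat_def)
  have jk_eqs: "j $ x $ 1 * k $ 1 $ y + j $ x $ 2 * k $ 2 $ y = - (k $ x $ 1 * j $ 1 $ y + k $ x $ 2 * j $ 2 $ y)" for x y
    unfolding e[symmetric] ac by simp
  have kj_eqs: "k $ x $ 1 * j $ 1 $ y + k $ x $ 2 * j $ 2 $ y = - (j $ x $ 1 * k $ 1 $ y + j $ x $ 2 * k $ 2 $ y)" for x y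
    using jk_eqs[of x y] by simp
  have trj: "j $ 2 $ 2 = - j $ 1 $ 1" "j $ 1 $ 1 * j $ 2 $ 2 - j $ 1 $ 2 * j $ 2 $ 1 = 1"
    by (rule anticommuting_2x2_traceless[OF j_eqs k_eqs jk_eqs jk_eqs jk_eqs jk_eqs])+
  have trk: "k $ 2 $ 2 = - k $ 1 $ 1" "k $ 1 $ 1 * k $ 2 $ 2 - k $ 1 $ 2 * k $ 2 $ 1 = 1"
    by (rule anticommuting_2x2_traceless[OF k_eqs j_eqs kj_eqs kj_eqs kj_eqs kj_eqs])+
  show ?thesis
  proof
    assume ?flat
    then obtain C where C: "\<And>a b A B. C a b A B = C b a A B" "\<And>a b A B. C a b A B = - C a b B A"
      "\<And>u v. \<phi> u v = frame_sum C u v"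
      by blast
    have z: "C a b A A = 0" for a b A using C(2)[of a b A A] by simp
    \<comment> \<open>Skew coefficients combine 2 by 2 minors of the frame, and a matrix acting on H
      multiplies these by its determinant.\<close>
    have \<phi>_eq: "\<phi> u v = (\<Sum>a\<in>UNIV. \<Sum>b\<in>UNIV. C a b 1 2 * (T a 1 u * T b 2 v - T a 2 u * T b 1 v))" for u v
      unfolding C(3) by (intro sum.cong refl) (simp add: sum_2 z C(2)[of _ _ 2 1] algebra_simps)
    have inv: "\<phi> (L *v u) (L *v v) = \<phi> u v"
      if "H_action l L" "l $ 1 $ 1 * l $ 2 $ 2 - l $ 1 $ 2 * l $ 2 $ 1 = 1" for l L u v
    proof -
      have "T a 1 (L *v u) * T b 2 (L *v v) - T a 2 (L *v u) * T b 1 (L *v v) =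
        (l $ 1 $ 1 * l $ 2 $ 2 - l $ 1 $ 2 * l $ 2 $ 1) * (T a 1 u * T b 2 v - T a 2 u * T b 1 v)" for a b
        using that(1) by (simp add: H_action_def sum_2 algebra_simps)
      then show ?thesis unfolding \<phi>_eq that(2) by simp
    qed
    show ?inv using inv[OF j(1) trj(2)] inv[OF k(1) trk(2)] by blast
  next
    assume inv: ?inv
    obtain C where C: "\<And>u v. \<phi> u v = frame_sum C u v"
      using frame_expand[OF \<phi>(1)] by blast
    have unique: "C a b A B = C' a b A B"
      if "\<And>u v. \<phi> u v = frame_sum C' u v" for C' a b A B
    proof -
      have "C a b A B - C' a b A B = 0"
      proof (rule frame_independent_2[of "\<lambda>a b A B. C a b A B - C' a b A B"])
        fix u v
        show "(\<Sum>a\<in>UNIV. \<Sum>b\<in>UNIV. \<Sum>A\<in>UNIV. \<Sum>B\<in>UNIV. (C a b A B - C' a b A B) * T a A u * T b B v) = 0"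
          using C[of u v] that[of u v] by (simp add: left_diff_distrib sum_subtractf)
      qed
      then show ?thesis by simp
    qed
    \<comment> \<open>The pullback by L contracts both H-indices with l; comparison of coefficients
      is legitimate because the frame is independent.\<close>
    have tr: "C a b A' B' = (\<Sum>A\<in>UNIV. \<Sum>B\<in>UNIV. C a b A B * l $ A $ A' * l $ B $ B')"
      if "H_action l L" "\<And>u v. \<phi> (L *v u) (L *v v) = \<phi> u v" for l L a b A' B'
    proof (rule unique)
      fix u v
      have "\<phi> u v = \<phi> (L *v u) (L *v v)" using that(2) by simp
      also have "\<dots> = (\<Sum>a\<in>UNIV. \<Sum>b\<in>UNIV. \<Sum>A'\<in>UNIV. \<Sum>B'\<in>UNIV.
          (\<Sum>A\<in>UNIV. \<Sum>B\<in>UNIV. C a b A B * l $ A $ A' * l $ B $ B') * T a A' u * T b B' v)"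
        unfolding C
        by (rule sum.cong[OF refl], rule sum.cong[OF refl])
           (use that(1) in \<open>simp add: H_action_def sum_2 algebra_simps\<close>)
      finally show "\<phi> u v = (\<Sum>a\<in>UNIV. \<Sum>b\<in>UNIV. \<Sum>A'\<in>UNIV. \<Sum>B'\<in>UNIV.
          (\<Sum>A\<in>UNIV. \<Sum>B\<in>UNIV. C a b A B * l $ A $ A' * l $ B $ B') * T a A' u * T b B' v)" .
    qed
    have swap: "C a b A B = - C b a B A" for a b A B
    proof (rule unique)
      fix u v
      have "\<phi> u v = - \<phi> v u" by (rule \<phi>(2))
      also have "\<dots> = (\<Sum>a\<in>UNIV. \<Sum>b\<in>UNIV. \<Sum>A\<in>UNIV. \<Sum>B\<in>UNIV. - C a b A B * T a A v * T b B u)"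
        unfolding C by (simp add: sum_negf)
      also have "\<dots> = (\<Sum>b\<in>UNIV. \<Sum>a\<in>UNIV. \<Sum>B\<in>UNIV. \<Sum>A\<in>UNIV. - C a b A B * T a A v * T b B u)"
        by (rule trans[OF sum.swap], rule sum.cong[OF refl], rule sum.cong[OF refl], rule sum.swap)
      also have "\<dots> = (\<Sum>a\<in>UNIV. \<Sum>b\<in>UNIV. \<Sum>A\<in>UNIV. \<Sum>B\<in>UNIV. - C b a B A * T a A u * T b B v)"
        by (simp add: mult_ac)
      finally show "\<phi> u v = (\<Sum>a\<in>UNIV. \<Sum>b\<in>UNIV. \<Sum>A\<in>UNIV. \<Sum>B\<in>UNIV. - C b a B A * T a A u * T b B v)" .
    qed
    have skew_AB: "C a b A B = - C a b B A" for a b A B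
    proof -
      let ?c = "\<lambda>A B. C a b A B"
      \<comment> \<open>The symmetrised coefficient matrix has the entries
        \<open>2 * ?c 1 1\<close>, y, \<open>2 * ?c 2 2\<close>; symmetrising without a factor 1/2
        avoids fractions.\<close>
      define y where "y = ?c 1 2 + ?c 2 1"
      have rel: "l $ 1 $ 1 * (2 * ?c 1 1) + l $ 2 $ 1 * y = 0 \<and> l $ 1 $ 2 * y - l $ 1 $ 1 * (2 * ?c 2 2) = 0 \<and>
          l $ 1 $ 2 * (2 * ?c 1 1) + l $ 2 $ 1 * (2 * ?c 2 2) = 0"
        if l: "H_action l L" "\<And>u v. \<phi> (L *v u) (L *v v) = \<phi> u v"
          and d: "l $ 2 $ 2 = - l $ 1 $ 1" "l $ 1 $ 1 * l $ 2 $ 2 - l $ 1 $ 2 * l $ 2 $ 1 = 1" for l L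
      proof -
        have e: "?c x z = ?c 1 1 * l $ 1 $ x * l $ 1 $ z + ?c 1 2 * l $ 1 $ x * l $ 2 $ z +
          (?c 2 1 * l $ 2 $ x * l $ 1 $ z + ?c 2 2 * l $ 2 $ x * l $ 2 $ z)" for x z
          using tr[OF l, of a b x z] by (simp add: sum_2)
        define a b c where "a = l $ 1 $ 1" and "b = l $ 1 $ 2" and "c = l $ 2 $ 1"
        have l22: "l $ 2 $ 2 = - a" using d(1) by (simp add: a_def)
        note eqs = e[of 1 1] e[of 2 2] e[of 1 2] e[of 2 1]
        note eqs' = eqs[unfolded l22, folded a_def b_def c_def]
        have s: "a * a + b * c = -1" using d(2) unfolding l22 a_def[symmetric] b_def[symmetric] c_def[symmetric] by algebra
        have "2 * ?c 1 1 = a * a * (2 * ?c 1 1) + 2 * (a * c) * y + c * c * (2 * ?c 2 2)"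
          using eqs'(1) unfolding y_def by algebra
        moreover have "2 * ?c 2 2 = b * b * (2 * ?c 1 1) - 2 * (a * b) * y + a * a * (2 * ?c 2 2)"
          using eqs'(2) unfolding y_def by algebra
        moreover have "a * b * (2 * ?c 1 1) + 2 * (b * c) * y - a * c * (2 * ?c 2 2) = 0"
          using eqs'(3,4) s unfolding y_def by algebra
        ultimately show ?thesis
          using invariant_symmetric_2x2_linear[OF s] by (simp only: a_def b_def c_def)
      qed
      have sq: "j $ 1 $ 1 * j $ 1 $ 1 + j $ 1 $ 2 * j $ 2 $ 1 = -1" "k $ 1 $ 1 * k $ 1 $ 1 + k $ 1 $ 2 * k $ 2 $ 1 = -1"
        "2 * j $ 1 $ 1 * k $ 1 $ 1 + j $ 1 $ 2 * k $ 2 $ 1 + j $ 2 $ 1 * k $ 1 $ 2 = 0"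
        using j_eqs(1) k_eqs(1) jk_eqs[of 1 1] by (simp_all add: algebra_simps)
      have "\<phi> (J *v u) (J *v v) = \<phi> u v" "\<phi> (K *v u) (K *v v) = \<phi> u v" for u v
        using inv by simp_all
      note rj = rel[OF j(1) this(1) trj] and rk = rel[OF k(1) this(2) trk]
      note rels = conjunct1[OF rj] conjunct1[OF conjunct2[OF rj]] conjunct2[OF conjunct2[OF rj]]
        conjunct1[OF rk] conjunct1[OF conjunct2[OF rk]] conjunct2[OF conjunct2[OF rk]]
      have zero: "2 * ?c 1 1 = 0" "y = 0" "2 * ?c 2 2 = 0"
        by (rule invariant_symmetric_2x2_eq_0[OF sq rels])+
      then have "?c 1 1 = 0" "?c 2 2 = 0" "?c 1 2 = - ?c 2 1" by (auto simp: y_def eq_neg_iff_add_eq_0)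
      then show ?thesis using exhaust_2[of A] exhaust_2[of B] by auto
    qed
    have "C a b A B = C b a A B \<and> C a b A B = - C a b B A" for a b A B
      using swap[of a b A B] skew_AB[of a b A B] skew_AB[of b a B A] by simp
    then show ?flat using C by blast
  qed
qed

end

section \<open>Contractions with the volume form\<close>

text \<open>The form of the argument lists in \<open>ext_deriv\<close>.\<close>

definition remove_nth :: "nat \<Rightarrow> 'a list \<Rightarrow> 'a list" where
  "remove_nth i xs = take i xs @ drop (Suc i) xs"

lemma length_remove_nth: "i < length xs \<Longrightarrow> length (remove_nth i xs) = length xs - 1"
  by (simp add: remove_nth_def)

lemma multilinear_vol_remove_nth:
  fixes \<phi> :: "real ^ 'n::{finite, linorder} \<Rightarrow> 'v::real_vector"
  assumes "linear \<phi>" "i < Suc CARD('n)"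
  shows "multilinear (Suc CARD('n)) (\<lambda>ws. vol (remove_nth i ws) *\<^sub>R \<phi> (ws ! i))"
  unfolding multilinear_def
proof (intro allI impI)
  fix ws :: "(real, 'n) vec list" and j assume ws: "length ws = Suc CARD('n)" and j: "j < Suc CARD('n)"
  show "linear (\<lambda>v. vol (remove_nth i (ws[j := v])) *\<^sub>R \<phi> (ws[j := v] ! i))"
  proof (cases "j = i")
    case True
    have "remove_nth i (ws[j := v]) = remove_nth i ws" for v using True ws by (simp add: remove_nth_def)
    then show ?thesis using True assms ws j by (auto intro: linear_compose_scale_right)
  next
    case False
    define j' where "j' = (if j < i then j else j - 1)"
    have r: "remove_nth i (ws[j := v]) = (remove_nth i ws)[j' := v]" for v
    proof -
      have "length (take i ws) = i" using ws assms(2) by simp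
      then show ?thesis using False assms(2) ws j
        by (auto simp: remove_nth_def j'_def list_update_append take_update_swap drop_update_swap list_update_beyond)
    qed
    have "linear (\<lambda>v. vol ((remove_nth i ws)[j' := v]))"
      using multilinear_vol[where 'n = 'n] False ws j assms(2)
      by (auto simp: multilinear_def length_remove_nth j'_def)
    then show ?thesis using False
      by (auto simp: r linear_iff scaleR_left.add)
  qed
qed

text \<open>Cramer's rule: an alternating expression in one vector more than the dimension vanishes.\<close>

lemma vol_remove_nth_sum:
  fixes \<phi> :: "real ^ 'n::{finite, linorder} \<Rightarrow> 'v::real_vector"
  assumes \<phi>: "linear \<phi>" and ws: "length ws = Suc CARD('n)"
  shows "(\<Sum>i<Suc CARD('n). (-1) ^ i *\<^sub>R (vol (remove_nth i ws) *\<^sub>R \<phi> (ws ! i))) = 0"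
proof -
  let ?D = "\<lambda>ws. \<Sum>i<Suc CARD('n). (-1) ^ i *\<^sub>R (vol (remove_nth i ws) *\<^sub>R \<phi> (ws ! i))"
  have "multilinear (Suc CARD('n)) ?D"
    by (intro multilinear_sum multilinear_scaleR multilinear_vol_remove_nth \<phi>) simp
  moreover have "multilinear (Suc CARD('n)) (\<lambda>_ :: (real, 'n) vec list. 0 :: 'v)"
    by (simp add: multilinear_def linear_zero)
  ultimately show ?thesis using ws
  proof (rule multilinear_ext)
    fix xs :: "'n list" assume len: "length xs = Suc CARD('n)"
    let ?ws = "map (\<lambda>i. axis i 1 :: (real, 'n) vec) xs"
    have "card (set xs) \<le> CARD('n)" by (rule card_mono) auto
    then have "\<not> distinct xs" using len by (auto dest: distinct_card)
    then obtain us x zs ts where xs: "xs = us @ [x] @ zs @ [x] @ ts" using not_distinct_decomp by blast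
    define a b where "a = length us" and "b = length us + length zs + 1"
    have ab: "a < b" "b < Suc CARD('n)" using len by (auto simp: a_def b_def xs)
    let ?t = "\<lambda>i. (-1) ^ i *\<^sub>R (vol (remove_nth i ?ws) *\<^sub>R \<phi> (?ws ! i))"
    \<comment> \<open>Among more basis vectors than the dimension one is repeated, and it still
      occurs twice after the removal of any other entry.\<close>
    have "?t i = 0" if i: "i < Suc CARD('n)" "i \<noteq> a" "i \<noteq> b" for i
    proof -
      \<comment> \<open>The places of the two copies once entry i is gone.\<close>
      define k l where "k = (if i < a then a - 1 else a)" and "l = (if i < b then b - 1 else b)"
      have kl: "k < l" "l < CARD('n)" using i ab by (auto simp: k_def l_def)
      have nth: "remove_nth i ?ws ! m = ?ws ! (if m < i then m else Suc m)" if "m < CARD('n)" for m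
        using that len i by (auto simp: remove_nth_def nth_append min_def)
      have xa: "xs ! a = x" "xs ! b = x" by (auto simp: xs a_def b_def nth_append)
      have "remove_nth i ?ws ! k = axis x 1"
        using kl i ab len xa(1) by (subst nth) (auto simp: k_def)
      moreover have "remove_nth i ?ws ! l = axis x 1"
        using kl i ab len xa(2) by (subst nth) (auto simp: l_def)
      moreover have "length (remove_nth i ?ws) = CARD('n)" using len i by (simp add: length_remove_nth)
      ultimately have "\<not> distinct (remove_nth i ?ws)"
        using kl nth_eq_iff_index_eq[of "remove_nth i ?ws" k l] by auto
      then have "vol (remove_nth i ?ws) = 0"
        using alternating_not_distinct[OF alternating_vol] \<open>length (remove_nth i ?ws) = CARD('n)\<close> by blast
      then show ?thesis by simp
    qed
    then have "?D ?ws = (\<Sum>i\<in>{a, b}. ?t i)"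
      using ab by (intro sum.mono_neutral_right) auto
    also have "\<dots> = ?t a + ?t b" using ab by simp
    also have "\<dots> = 0"
    proof -
      \<comment> \<open>Moving one copy across zs costs one sign per entry, while the alternating
        signs at a and b differ by one further sign, so the two terms cancel.\<close>
      let ?e = "map (\<lambda>i. axis i 1 :: (real, 'n) vec)"
      have "remove_nth a ?ws = ?e us @ ?e zs @ axis x 1 # ?e ts" "remove_nth b ?ws = ?e us @ axis x 1 # ?e zs @ ?e ts"
        by (auto simp: remove_nth_def a_def b_def xs)
      moreover have "vol (?e us @ ?e zs @ axis x 1 # ?e ts) = (-1) ^ length zs * vol (?e us @ axis x 1 # ?e zs @ ?e ts)"
        using alternating_move[OF alternating_vol[where 'n = 'n], of "?e us" "?e zs" "?e ts" "axis x 1"] len by (simp add: xs)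
      moreover have "?ws ! a = axis x 1" "?ws ! b = axis x 1" by (auto simp: xs a_def b_def nth_append)
      ultimately show ?thesis
        by (simp add: b_def a_def power_add)
    qed
    finally show "?D ?ws = 0" .
  qed
qed

text \<open>Cramer's rule with x and y placed in front; their own two terms form the right-hand
  side. The left-hand side is what \<open>ext_deriv\<close> makes of a form with constant
  \<open>vol\<close> and varying coefficients.\<close>

lemma cramer_vol:
  fixes \<phi> :: "real ^ 'n::{finite, linorder} \<Rightarrow> 'v::real_vector"
  assumes \<phi>: "linear \<phi>" and vs: "Suc (length vs) = CARD('n)"
  shows "(\<Sum>p<length vs. (-1) ^ p *\<^sub>R (vol (x # y # remove_nth p vs) *\<^sub>R \<phi> (vs ! p))) =
    vol (x # vs) *\<^sub>R \<phi> y - vol (y # vs) *\<^sub>R \<phi> x"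
proof -
  have r: "remove_nth 0 (x # ws) = ws" "remove_nth (Suc i) (x # ws) = x # remove_nth i ws" for i x and ws :: "(real, 'n) vec list"
    by (auto simp: remove_nth_def)
  have "(\<Sum>i<Suc (Suc (length vs)). (-1) ^ i *\<^sub>R (vol (remove_nth i (x # y # vs)) *\<^sub>R \<phi> ((x # y # vs) ! i))) = 0"
    using vol_remove_nth_sum[OF \<phi>, of "x # y # vs"] vs by simp
  then show ?thesis
    unfolding sum.lessThan_Suc_shift by (simp add: r algebra_simps)
qed

section \<open>Alternation and wedge products with one-forms\<close>

definition alt_sum :: "nat \<Rightarrow> ('u list \<Rightarrow> 'v::real_vector) \<Rightarrow> 'u list \<Rightarrow> 'v" where
  "alt_sum k X vs = (\<Sum>\<sigma> | \<sigma> permutes {..<k}. of_int (sign \<sigma>) *\<^sub>R X (permute_list \<sigma> vs))"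

lemma alt_sum_cong:
  assumes "length vs = k" "\<And>ws. length ws = k \<Longrightarrow> X ws = Y ws"
  shows "alt_sum k X vs = alt_sum k Y vs"
  using assms by (simp add: alt_sum_def)

lemma alt_sum_sum: "alt_sum k (\<lambda>ws. \<Sum>i\<in>I. X i ws) vs = (\<Sum>i\<in>I. alt_sum k (X i) vs)"
  unfolding alt_sum_def scaleR_sum_right by (rule sum.swap)

lemma alt_sum_scaleR: "alt_sum k (\<lambda>ws. c *\<^sub>R X ws) vs = c *\<^sub>R alt_sum k X vs"
  unfolding alt_sum_def by (simp add: scaleR_sum_right mult.commute)

lemma alt_sum_alternating:
  assumes "alternating k X" "length vs = k"
  shows "alt_sum k X vs = fact k *\<^sub>R X vs"
proof -
  have "of_int (sign \<sigma>) *\<^sub>R X (permute_list \<sigma> vs) = X vs" if "\<sigma> permutes {..<k}" for \<sigma>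
  proof -
    have "of_int (sign \<sigma>) * of_int (sign \<sigma>) = (1 :: real)" by (metis of_int_1 of_int_mult sign_idempotent)
    then show ?thesis using assms that by (simp add: alternating_def)
  qed
  then show ?thesis using card_permutations[of "{..<k}" k]
    by (simp add: alt_sum_def sum_constant_scaleR)
qed

lemma alt_sum_permute:
  assumes \<tau>: "\<tau> permutes {..<k}" and vs: "length vs = k"
  shows "alt_sum k (\<lambda>ws. X (permute_list \<tau> ws)) vs = of_int (sign \<tau>) *\<^sub>R alt_sum k X vs"
proof -
  have bij: "bij_betw (\<lambda>\<sigma>. \<sigma> \<circ> \<tau>) {\<sigma>. \<sigma> permutes {..<k}} {\<sigma>. \<sigma> permutes {..<k}}"
  proof (rule bij_betw_byWitness[where f' = "\<lambda>\<sigma>. \<sigma> \<circ> inv \<tau>"])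
    show "\<forall>\<sigma>\<in>{\<sigma>. \<sigma> permutes {..<k}}. \<sigma> \<circ> \<tau> \<circ> inv \<tau> = \<sigma>" "\<forall>\<sigma>\<in>{\<sigma>. \<sigma> permutes {..<k}}. \<sigma> \<circ> inv \<tau> \<circ> \<tau> = \<sigma>"
      by (simp_all add: fun_eq_iff permutes_inverses[OF \<tau>])
    show "(\<lambda>\<sigma>. \<sigma> \<circ> \<tau>) ` {\<sigma>. \<sigma> permutes {..<k}} \<subseteq> {\<sigma>. \<sigma> permutes {..<k}}"
      "(\<lambda>\<sigma>. \<sigma> \<circ> inv \<tau>) ` {\<sigma>. \<sigma> permutes {..<k}} \<subseteq> {\<sigma>. \<sigma> permutes {..<k}}"
      using \<tau> by (blast intro: permutes_compose permutes_inv)+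
  qed
  have "alt_sum k X vs = (\<Sum>\<sigma> | \<sigma> permutes {..<k}. of_int (sign (\<sigma> \<circ> \<tau>)) *\<^sub>R X (permute_list (\<sigma> \<circ> \<tau>) vs))"
    unfolding alt_sum_def by (rule sum.reindex_bij_betw[OF bij, symmetric])
  also have "\<dots> = (\<Sum>\<sigma> | \<sigma> permutes {..<k}. of_int (sign \<tau>) *\<^sub>R of_int (sign \<sigma>) *\<^sub>R X (permute_list \<tau> (permute_list \<sigma> vs)))"
  proof (rule sum.cong[OF refl])
    fix \<sigma> assume "\<sigma> \<in> {\<sigma>. \<sigma> permutes {..<k}}"
    then have "\<sigma> permutes {..<k}" by simp
    then have "sign (\<sigma> \<circ> \<tau>) = sign \<sigma> * sign \<tau>" using \<tau>
      by (intro sign_compose) (auto simp: permutation_permutes)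
    then show "of_int (sign (\<sigma> \<circ> \<tau>)) *\<^sub>R X (permute_list (\<sigma> \<circ> \<tau>) vs) =
      of_int (sign \<tau>) *\<^sub>R of_int (sign \<sigma>) *\<^sub>R X (permute_list \<tau> (permute_list \<sigma> vs))"
      using \<tau> vs by (simp add: permute_list_compose mult.commute)
  qed
  also have "\<dots> = of_int (sign \<tau>) *\<^sub>R alt_sum k (\<lambda>ws. X (permute_list \<tau> ws)) vs"
    by (simp only: alt_sum_def scaleR_sum_right)
  finally have "of_int (sign \<tau>) *\<^sub>R alt_sum k X vs =
      (of_int (sign \<tau>) * of_int (sign \<tau>)) *\<^sub>R alt_sum k (\<lambda>ws. X (permute_list \<tau> ws)) vs" by simp
  moreover have "of_int (sign \<tau>) * of_int (sign \<tau>) = (1 :: real)" by (metis of_int_1 of_int_mult sign_idempotent)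
  ultimately show ?thesis by simp
qed

text \<open>Exchanging the removed position with its neighbour costs a sign, so after alternation all positions in
  Cramer's rule contribute equally.\<close>

lemma alt_sum_vol_remove_nth:
  fixes \<phi> :: "real ^ 'n::{finite, linorder} \<Rightarrow> 'v::real_vector"
  assumes \<phi>: "linear \<phi>" and vs: "length vs = Suc k" "CARD('n) = Suc (Suc k)" and p: "p \<le> k"
  shows "alt_sum (Suc k) (\<lambda>ws. vol (x # y # remove_nth p ws) *\<^sub>R \<phi> (ws ! p)) vs =
    ((-1) ^ p * fact k) *\<^sub>R (vol (x # vs) *\<^sub>R \<phi> y - vol (y # vs) *\<^sub>R \<phi> x)"
proof -
  define X where "X p ws = vol (x # y # remove_nth p ws) *\<^sub>R \<phi> (ws ! p)" for p ws
  define E where "E p = alt_sum (Suc k) (X p) vs" for p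
  have step: "E (Suc p) = - E p" if "Suc p < Suc k" for p
  proof -
    let ?\<tau> = "Transposition.transpose p (Suc p)"
    have \<tau>: "?\<tau> permutes {..<Suc k}" using that by (intro transpose_permutes) auto
    have "X p (permute_list ?\<tau> ws) = X (Suc p) ws" if ws: "length ws = Suc k" for ws
    proof -
      have pl: "permute_list ?\<tau> ws = ws[p := ws ! Suc p, Suc p := ws ! p]"
        using \<open>Suc p < Suc k\<close> ws by (intro permute_list_transpose) auto
      have "remove_nth p (ws[p := ws ! Suc p, Suc p := ws ! p]) = remove_nth (Suc p) ws"
        using \<open>Suc p < Suc k\<close> ws
        by (intro nth_equalityI) (auto simp: remove_nth_def nth_append nth_list_update min_def less_Suc_eq)
      then show ?thesis using \<open>Suc p < Suc k\<close> ws by (simp add: X_def pl)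
    qed
    then have "E (Suc p) = alt_sum (Suc k) (\<lambda>ws. X p (permute_list ?\<tau> ws)) vs"
      unfolding E_def using vs by (intro alt_sum_cong) auto
    also have "\<dots> = - E p"
      using alt_sum_permute[OF \<tau> vs(1), of "X p"] by (simp add: sign_swap_id E_def)
    finally show ?thesis .
  qed
  have E: "E p = (-1) ^ p *\<^sub>R E 0" if "p < Suc k" for p
    using that by (induction p) (auto simp: step)
  have "(\<Sum>p<Suc k. (-1) ^ p *\<^sub>R E p) = alt_sum (Suc k) (\<lambda>ws. \<Sum>p<Suc k. (-1) ^ p *\<^sub>R X p ws) vs"
    by (simp only: E_def alt_sum_sum alt_sum_scaleR)
  also have "\<dots> = alt_sum (Suc k) (\<lambda>ws. vol (x # ws) *\<^sub>R \<phi> y - vol (y # ws) *\<^sub>R \<phi> x) vs"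
    using vs cramer_vol[OF \<phi>] unfolding X_def by (intro alt_sum_cong) auto
  also have "\<dots> = fact (Suc k) *\<^sub>R (vol (x # vs) *\<^sub>R \<phi> y - vol (y # vs) *\<^sub>R \<phi> x)"
  proof (rule alt_sum_alternating[OF _ vs(1)])
    have alt: "alternating (Suc k) (\<lambda>ws. vol (z # ws))" for z :: "(real, 'n) vec"
    proof (rule alternating_if_swap)
      fix vs :: "(real, 'n) vec list" and a b assume "length vs = Suc k" "a < Suc k" "b < Suc k" "a \<noteq> b"
      then show "vol (z # vs[a := vs ! b, b := vs ! a]) = - vol (z # vs)"
        using alternating_swap[OF alternating_vol[where 'n = 'n], of "z # vs" "Suc a" "Suc b"] vs(2) by simp
    qed
    show "alternating (Suc k) (\<lambda>ws. vol (x # ws) *\<^sub>R \<phi> y - vol (y # ws) *\<^sub>R \<phi> x)"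
      using alt[of x] alt[of y] by (simp add: alternating_def algebra_simps)
  qed
  finally have "(\<Sum>p<Suc k. (-1) ^ p *\<^sub>R E p) = fact (Suc k) *\<^sub>R (vol (x # vs) *\<^sub>R \<phi> y - vol (y # vs) *\<^sub>R \<phi> x)" .
  moreover have "(\<Sum>p<Suc k. (-1) ^ p *\<^sub>R E p) = (\<Sum>p<Suc k. E 0)"
    by (rule sum.cong[OF refl], subst E, simp, simp flip: power_mult_distrib)
  moreover have "(\<Sum>p<Suc k. E 0) = real (Suc k) *\<^sub>R E 0"
    by (simp only: sum_constant_scaleR card_lessThan)
  moreover have "fact (Suc k) = real (Suc k) * fact k" by simp
  ultimately have "real (Suc k) *\<^sub>R E 0 = (real (Suc k) * fact k) *\<^sub>R (vol (x # vs) *\<^sub>R \<phi> y - vol (y # vs) *\<^sub>R \<phi> x)"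
    by metis
  then have "real (Suc k) *\<^sub>R E 0 = real (Suc k) *\<^sub>R (fact k *\<^sub>R (vol (x # vs) *\<^sub>R \<phi> y - vol (y # vs) *\<^sub>R \<phi> x))"
    by (simp only: scaleR_scaleR)
  then have "E 0 = fact k *\<^sub>R (vol (x # vs) *\<^sub>R \<phi> y - vol (y # vs) *\<^sub>R \<phi> x)"
    unfolding scaleR_cancel_left by (simp only: of_nat_eq_0_iff nat.distinct simp_thms)
  then have "E p = ((-1) ^ p * fact k) *\<^sub>R (vol (x # vs) *\<^sub>R \<phi> y - vol (y # vs) *\<^sub>R \<phi> x)"
    using E[of p] p by simp
  then show ?thesis by (simp add: E_def X_def[abs_def])
qed

lemma wedge_alt_sum:
  assumes "length vs = k + l"
  shows "wedge prd k l \<alpha> \<beta> vs = (1 / (fact k * fact l)) *\<^sub>R alt_sum (k + l) (\<lambda>ws. prd (\<alpha> (take k ws)) (\<beta> (drop k ws))) vs"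
  by (simp add: wedge_permute_list[OF assms] alt_sum_def)

text \<open>Alternation yields \<open>fact k\<close>, which cancels the normalisation of the wedge
  product. The one-form occupies slot 0 in the first product and slot k in the second, so the second
  one acquires the sign \<open>(-1) ^ k\<close>, which is 1 for even k.\<close>

lemma
  fixes R :: "'n::{finite, linorder} \<Rightarrow> 'n \<Rightarrow> 'v::real_vector" and \<beta> :: "('n, 'v) form" and \<alpha> :: "('n, 'u::real_vector) form"
  assumes \<beta>: "\<And>ws. length ws = k \<Longrightarrow> \<beta> ws = (\<Sum>j\<in>UNIV. \<Sum>l\<in>UNIV. vol (axis j 1 # axis l 1 # ws) *\<^sub>R R j l)"
    and \<alpha>: "linear (\<lambda>u. \<alpha> [u])" and vs: "length vs = Suc k" "CARD('n) = Suc (Suc k)" 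
  shows wedge_1_vol: "bilinear prd \<Longrightarrow> wedge prd 1 k \<alpha> \<beta> vs = (\<Sum>j\<in>UNIV. \<Sum>l\<in>UNIV.
      vol (axis j 1 # vs) *\<^sub>R prd (\<alpha> [axis l 1]) (R j l) - vol (axis l 1 # vs) *\<^sub>R prd (\<alpha> [axis j 1]) (R j l))"
    and wedge_vol_1: "bilinear prd' \<Longrightarrow> even k \<Longrightarrow> wedge prd' k 1 \<beta> \<alpha> vs = (\<Sum>j\<in>UNIV. \<Sum>l\<in>UNIV.
      vol (axis j 1 # vs) *\<^sub>R prd' (R j l) (\<alpha> [axis l 1]) - vol (axis l 1 # vs) *\<^sub>R prd' (R j l) (\<alpha> [axis j 1]))"
proof -
  assume prd: "bilinear prd"
  have lin: "linear (\<lambda>u. prd (\<alpha> [u]) z)" for z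
    using prd linear_compose[OF \<alpha>, of "\<lambda>a. prd a z"] by (simp add: bilinear_def o_def)
  have "wedge prd 1 k \<alpha> \<beta> vs = (1 / fact k) *\<^sub>R alt_sum (Suc k) (\<lambda>ws. prd (\<alpha> (take 1 ws)) (\<beta> (drop 1 ws))) vs"
    using wedge_alt_sum[of vs 1 k] vs by simp
  also have "alt_sum (Suc k) (\<lambda>ws. prd (\<alpha> (take 1 ws)) (\<beta> (drop 1 ws))) vs =
     alt_sum (Suc k) (\<lambda>ws. \<Sum>j\<in>UNIV. \<Sum>l\<in>UNIV. vol (axis j 1 # axis l 1 # remove_nth 0 ws) *\<^sub>R prd (\<alpha> [ws ! 0]) (R j l)) vs"
  proof (rule alt_sum_cong[OF vs(1)])
    fix ws :: "(real, 'n) vec list" assume "length ws = Suc k"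
    then have "take 1 ws = [ws ! 0]" "length (remove_nth 0 ws) = k" "drop 1 ws = remove_nth 0 ws"
      by (auto simp: length_Suc_conv remove_nth_def)
    then show "prd (\<alpha> (take 1 ws)) (\<beta> (drop 1 ws)) =
        (\<Sum>j\<in>UNIV. \<Sum>l\<in>UNIV. vol (axis j 1 # axis l 1 # remove_nth 0 ws) *\<^sub>R prd (\<alpha> [ws ! 0]) (R j l))"
      using prd by (simp add: \<beta> bilinear_def linear_sum linear_cmul)
  qed
  also have "\<dots> = (\<Sum>j\<in>UNIV. \<Sum>l\<in>UNIV. fact k *\<^sub>R
      (vol (axis j 1 # vs) *\<^sub>R prd (\<alpha> [axis l 1]) (R j l) - vol (axis l 1 # vs) *\<^sub>R prd (\<alpha> [axis j 1]) (R j l)))"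
    unfolding alt_sum_sum
    by (intro sum.cong refl) (subst alt_sum_vol_remove_nth[OF lin vs], simp_all)
  finally show "wedge prd 1 k \<alpha> \<beta> vs = (\<Sum>j\<in>UNIV. \<Sum>l\<in>UNIV.
      vol (axis j 1 # vs) *\<^sub>R prd (\<alpha> [axis l 1]) (R j l) - vol (axis l 1 # vs) *\<^sub>R prd (\<alpha> [axis j 1]) (R j l))"
    by (simp flip: scaleR_sum_right)
next
  assume prd: "bilinear prd'" and k: "even k"
  have lin: "linear (\<lambda>u. prd' z (\<alpha> [u]))" for z
    using prd linear_compose[OF \<alpha>, of "\<lambda>a. prd' z a"] by (simp add: bilinear_def o_def)
  have "wedge prd' k 1 \<beta> \<alpha> vs = (1 / fact k) *\<^sub>R alt_sum (Suc k) (\<lambda>ws. prd' (\<beta> (take k ws)) (\<alpha> (drop k ws))) vs"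
    using wedge_alt_sum[of vs k 1] vs by simp
  also have "alt_sum (Suc k) (\<lambda>ws. prd' (\<beta> (take k ws)) (\<alpha> (drop k ws))) vs =
     alt_sum (Suc k) (\<lambda>ws. \<Sum>j\<in>UNIV. \<Sum>l\<in>UNIV. vol (axis j 1 # axis l 1 # remove_nth k ws) *\<^sub>R prd' (R j l) (\<alpha> [ws ! k])) vs"
  proof (rule alt_sum_cong[OF vs(1)])
    fix ws :: "(real, 'n) vec list" assume len: "length ws = Suc k"
    then have "drop k ws = [ws ! k]"
      by (metis Cons_nth_drop_Suc drop_all le_refl lessI)
    moreover have "length (take k ws) = k" "take k ws = remove_nth k ws"
      using len by (auto simp: remove_nth_def)
    ultimately show "prd' (\<beta> (take k ws)) (\<alpha> (drop k ws)) =
        (\<Sum>j\<in>UNIV. \<Sum>l\<in>UNIV. vol (axis j 1 # axis l 1 # remove_nth k ws) *\<^sub>R prd' (R j l) (\<alpha> [ws ! k]))"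
      using prd by (simp add: \<beta> bilinear_def linear_sum[of "\<lambda>x. prd' x _"] linear_cmul[of "\<lambda>x. prd' x _"])
  qed
  also have "\<dots> = (\<Sum>j\<in>UNIV. \<Sum>l\<in>UNIV. fact k *\<^sub>R
      (vol (axis j 1 # vs) *\<^sub>R prd' (R j l) (\<alpha> [axis l 1]) - vol (axis l 1 # vs) *\<^sub>R prd' (R j l) (\<alpha> [axis j 1])))"
    unfolding alt_sum_sum
    by (intro sum.cong refl) (subst alt_sum_vol_remove_nth[OF lin vs], simp_all add: k)
  finally show "wedge prd' k 1 \<beta> \<alpha> vs = (\<Sum>j\<in>UNIV. \<Sum>l\<in>UNIV.
      vol (axis j 1 # vs) *\<^sub>R prd' (R j l) (\<alpha> [axis l 1]) - vol (axis l 1 # vs) *\<^sub>R prd' (R j l) (\<alpha> [axis j 1]))"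
    by (simp flip: scaleR_sum_right)
qed

section \<open>Divergence of a tensor satisfying the Bianchi identity\<close>

context quaternionic_triple
begin

lemma contract_symmetric:
  assumes "bilinear S"
  shows "(\<Sum>p\<in>UNIV. S (H *v axis p 1) (axis p 1)) = (\<Sum>p\<in>UNIV. S (axis p 1) (H *v axis p 1))"
  using contract_transpose[OF assms, of "mat 1" H] by (simp add: H_sym)

text \<open>In the Bianchi identity traced with J1, the term whose derivative slot is not traced
  vanishes by invariance under J2, and the other two coincide because J1 is an isometry. Replacing v
  by J1 v and moving J1 to the other slot turns the resulting equation into the divergence.\<close>

lemma divergence_eq_0:
  fixes t :: "real ^ 'n \<Rightarrow> real ^ 'n \<Rightarrow> real ^ 'n \<Rightarrow> 'v::real_vector"
  assumes lin: "\<And>u v. linear (\<lambda>w. t w u v)" "\<And>u. bilinear (t u)"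
    and skew_t: "\<And>u v w. t u v w = - t u w v"
    and J: "\<And>u v w. t u (J1 *v v) w = - t u v (J1 *v w)" "\<And>u v w. t u (J2 *v v) w = - t u v (J2 *v w)"
    and bianchi: "\<And>u v w. t u v w + t v w u + t w u v = 0"
  shows "(\<Sum>p\<in>UNIV. t (axis p 1) (H *v axis p 1) v) = 0"
proof -
  have neg: "t u (- v) w = - t u v w" "t u v (- w) = - t u v w" for u v w
    using lin(2) by (auto simp: bilinear_lneg bilinear_rneg)
  have bl: "bilinear (\<lambda>a b. t b v a)" "bilinear (\<lambda>a b. t b a v)" for v
    using lin by (auto simp: bilinear_def)
  have blJ: "bilinear (\<lambda>a b. t (J1 *v b) v a)" "bilinear (\<lambda>a b. t b v (J1 *v a))" for v
    using lin by (auto simp: bilinear_def intro: linear_compose[OF matrix_vector_mul_linear, unfolded o_def])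
  have main: "(\<Sum>p\<in>UNIV. t (H *v axis p 1) (J1 *v axis p 1) v) = 0" for v
  proof -
    have 1: "ktrace (t v) J1 = 0"
      by (rule ktrace_eq_0[OF lin(2) skew(2)]) (simp_all add: mult_J J neg)
    have "(\<Sum>p\<in>UNIV. t (J1 *v axis p 1) v (H *v axis p 1)) =
      (\<Sum>p\<in>UNIV. t (J1 *v (J1 *v axis p 1)) v (J1 *v (H *v axis p 1)))"
      using contract_isometry[OF blJ(1) skew(1) mult_J(1), of v] by simp
    also have "\<dots> = (\<Sum>p\<in>UNIV. - t (axis p 1) v (J1 *v (H *v axis p 1)))"
      by (simp add: mult_J linear_neg[OF lin(1)])
    also have "\<dots> = - (\<Sum>p\<in>UNIV. t (axis p 1) v (J1 *v (H *v axis p 1)))"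
      by (rule sum_negf)
    also have "(\<Sum>p\<in>UNIV. t (axis p 1) v (J1 *v (H *v axis p 1))) = (\<Sum>p\<in>UNIV. t (H *v axis p 1) v (J1 *v axis p 1))"
      by (rule contract_symmetric[OF blJ(2)])
    also have "- \<dots> = (\<Sum>p\<in>UNIV. t (H *v axis p 1) (J1 *v axis p 1) v)"
      unfolding sum_negf[symmetric] by (rule sum.cong[OF refl], subst skew_t) simp
    finally have 2: "(\<Sum>p\<in>UNIV. t (J1 *v axis p 1) v (H *v axis p 1)) = (\<Sum>p\<in>UNIV. t (H *v axis p 1) (J1 *v axis p 1) v)" .
    have "(\<Sum>p\<in>UNIV. t v (H *v axis p 1) (J1 *v axis p 1) + t (H *v axis p 1) (J1 *v axis p 1) v
        + t (J1 *v axis p 1) v (H *v axis p 1)) = 0"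
      unfolding bianchi by simp
    then have "2 *\<^sub>R (\<Sum>p\<in>UNIV. t (H *v axis p 1) (J1 *v axis p 1) v) = 0"
      using 1 2 by (simp add: sum.distrib ktrace_def scaleR_2)
    then show ?thesis by simp
  qed
  have "(\<Sum>p\<in>UNIV. t (H *v axis p 1) (axis p 1) v) = (\<Sum>p\<in>UNIV. t (H *v axis p 1) (J1 *v axis p 1) (J1 *v v))"
    by (simp add: J(1) mult_J neg)
  then have "(\<Sum>p\<in>UNIV. t (H *v axis p 1) (axis p 1) v) = 0" using main by simp
  then show ?thesis using contract_symmetric[OF bl(2), of v] contract_symmetric[of "\<lambda>a b. t a b v"] lin
    by (simp add: bilinear_def)
qed

end

section \<open>Second derivatives and derivatives of matrix functions\<close>

lemma has_real_derivative_line: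
  fixes f :: "'a::real_normed_vector \<Rightarrow> real"
  assumes "(f has_derivative f') (at (p + s *\<^sub>R u))"
  shows "((\<lambda>s. f (p + s *\<^sub>R u)) has_real_derivative f' u) (at s)"
proof -
  have "((\<lambda>s. p + s *\<^sub>R u) has_derivative (\<lambda>h. h *\<^sub>R u)) (at s)"
    by (auto intro!: derivative_eq_intros)
  from has_derivative_compose[OF this assms]
  have "((\<lambda>s. f (p + s *\<^sub>R u)) has_derivative (\<lambda>h. f' (h *\<^sub>R u))) (at s)" .
  moreover have "(\<lambda>h. f' (h *\<^sub>R u)) = (*) (f' u)"
    using has_derivative_linear[OF assms] by (auto simp: linear_cmul mult.commute)
  ultimately show ?thesis by (simp add: has_field_derivative_def)
qed

text \<open>The mean value theorem is applied in direction u to the difference of f along v, then in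
  direction v to the derivative so obtained.\<close>

lemma second_difference_mvt:
  fixes f :: "'a::real_normed_vector \<Rightarrow> real"
  assumes t: "t > 0"
    and mem: "\<And>a b. 0 \<le> a \<Longrightarrow> a \<le> t \<Longrightarrow> 0 \<le> b \<Longrightarrow> b \<le> t \<Longrightarrow> x + a *\<^sub>R u + b *\<^sub>R v \<in> U"
    and f: "\<And>y. y \<in> U \<Longrightarrow> (f has_derivative f' y) (at y)"
    and fu: "\<And>y. y \<in> U \<Longrightarrow> ((\<lambda>y. f' y u) has_derivative fu y) (at y)"
  obtains a b where "0 \<le> a" "a \<le> t" "0 \<le> b" "b \<le> t"
    "f (x + t *\<^sub>R u + t *\<^sub>R v) - f (x + t *\<^sub>R u) - f (x + t *\<^sub>R v) + f x = t * t * fu (x + a *\<^sub>R u + b *\<^sub>R v) v"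
proof -
  define \<phi> where "\<phi> s = f (x + s *\<^sub>R u + t *\<^sub>R v) - f (x + s *\<^sub>R u)" for s
  have d\<phi>: "DERIV \<phi> s :> f' (x + s *\<^sub>R u + t *\<^sub>R v) u - f' (x + s *\<^sub>R u) u" if "0 \<le> s" "s \<le> t" for s
  proof -
    have "DERIV (\<lambda>s. f ((x + t *\<^sub>R v) + s *\<^sub>R u)) s :> f' ((x + t *\<^sub>R v) + s *\<^sub>R u) u"
      using mem[of s t] that t by (intro has_real_derivative_line f) (auto simp: algebra_simps)
    moreover have "DERIV (\<lambda>s. f (x + s *\<^sub>R u)) s :> f' (x + s *\<^sub>R u) u"
      using mem[of s 0] that t by (intro has_real_derivative_line f) auto
    ultimately show ?thesis
      unfolding \<phi>_def by (auto intro!: DERIV_diff simp: algebra_simps)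
  qed
  obtain a where a: "0 < a" "a < t" "\<phi> t - \<phi> 0 = (t - 0) * (f' (x + a *\<^sub>R u + t *\<^sub>R v) u - f' (x + a *\<^sub>R u) u)"
    using MVT2[OF t d\<phi>] by blast
  have d\<psi>: "DERIV (\<lambda>r. f' (x + a *\<^sub>R u + r *\<^sub>R v) u) r :> fu (x + a *\<^sub>R u + r *\<^sub>R v) v" if "0 \<le> r" "r \<le> t" for r
    using mem[of a r] that a by (intro has_real_derivative_line[where f = "\<lambda>y. f' y u"] fu) auto
  obtain b where b: "0 < b" "b < t"
    "f' (x + a *\<^sub>R u + t *\<^sub>R v) u - f' (x + a *\<^sub>R u + 0 *\<^sub>R v) u = (t - 0) * fu (x + a *\<^sub>R u + b *\<^sub>R v) v"
    using MVT2[OF t d\<psi>] by blast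
  show thesis
    by (rule that[of a b]) (use a b in \<open>auto simp: \<phi>_def\<close>)
qed

text \<open>The second difference is symmetric in u and v, so for every small t the two mixed
  derivatives agree up to a shift of the point; continuity at x removes the shift.\<close>

lemma mixed_partials_commute:
  fixes f :: "'a::real_normed_vector \<Rightarrow> real"
  assumes U: "open U" "x \<in> U"
    and f: "\<And>y. y \<in> U \<Longrightarrow> (f has_derivative f' y) (at y)"
    and fu: "\<And>y. y \<in> U \<Longrightarrow> ((\<lambda>y. f' y u) has_derivative fu y) (at y)" "continuous_on U (\<lambda>y. fu y v)"
    and fv: "\<And>y. y \<in> U \<Longrightarrow> ((\<lambda>y. f' y v) has_derivative fv y) (at y)" "continuous_on U (\<lambda>y. fv y u)"
  shows "fu x v = fv x u"
proof -
  have "\<bar>fu x v - fv x u\<bar> < e + e" if e: "e > 0" for e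
  proof -
    have "isCont (\<lambda>y. fu y v) x" "isCont (\<lambda>y. fv y u) x"
      using U fu(2) fv(2) by (auto simp: continuous_on_eq_continuous_at)
    then obtain d1 d2 where d1: "d1 > 0" "\<And>y. dist y x < d1 \<Longrightarrow> dist (fu y v) (fu x v) < e"
      and d2: "d2 > 0" "\<And>y. dist y x < d2 \<Longrightarrow> dist (fv y u) (fv x u) < e"
      using e unfolding continuous_at_eps_delta by metis
    obtain d3 where d3: "d3 > 0" "ball x d3 \<subseteq> U" using U open_contains_ball by blast
    define d where "d = min d1 (min d2 d3)"
    \<comment> \<open>Small enough to keep the parallelogram spanned by the steps inside the ball of
      radius d; the summand 1 covers u = v = 0.\<close>
    define t where "t = d / (2 * (norm u + norm v + 1))"
    have pos: "norm u + norm v + 1 > 0" by (simp add: add_nonneg_pos)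
    have d: "d > 0" using d1 d2 d3 by (simp add: d_def)
    then have t: "t > 0" unfolding t_def using pos by simp
    have close: "norm (a *\<^sub>R u + b *\<^sub>R v) < d" if "0 \<le> a" "a \<le> t" "0 \<le> b" "b \<le> t" for a b
    proof -
      have "norm (a *\<^sub>R u + b *\<^sub>R v) \<le> a * norm u + b * norm v"
        using norm_triangle_ineq[of "a *\<^sub>R u" "b *\<^sub>R v"] that by simp
      also have "\<dots> \<le> t * norm u + t * norm v" using that by (intro add_mono mult_right_mono) auto
      also have "\<dots> \<le> t * (norm u + norm v + 1)" using t by (simp add: algebra_simps)
      also have "\<dots> = d / 2" unfolding t_def using pos by (simp add: field_simps)
      finally show ?thesis using d by simp
    qed
    have near: "dist (x + a *\<^sub>R u + b *\<^sub>R v) x < d" "dist (x + b *\<^sub>R v + a *\<^sub>R u) x < d"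
      if "0 \<le> a" "a \<le> t" "0 \<le> b" "b \<le> t" for a b
      using close[OF that] by (simp_all add: dist_norm add.assoc add.commute)
    have mem: "x + a *\<^sub>R u + b *\<^sub>R v \<in> U" "x + b *\<^sub>R v + a *\<^sub>R u \<in> U"
      if "0 \<le> a" "a \<le> t" "0 \<le> b" "b \<le> t" for a b
      using near[OF that] d3(2) by (auto simp: d_def dist_commute subset_eq)
    obtain a b where ab: "0 \<le> a" "a \<le> t" "0 \<le> b" "b \<le> t"
      "f (x + t *\<^sub>R u + t *\<^sub>R v) - f (x + t *\<^sub>R u) - f (x + t *\<^sub>R v) + f x = t * t * fu (x + a *\<^sub>R u + b *\<^sub>R v) v"
      using second_difference_mvt[OF t mem(1) f fu(1)] by blast
    obtain a' b' where ab': "0 \<le> a'" "a' \<le> t" "0 \<le> b'" "b' \<le> t"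
      "f (x + t *\<^sub>R v + t *\<^sub>R u) - f (x + t *\<^sub>R v) - f (x + t *\<^sub>R u) + f x = t * t * fv (x + a' *\<^sub>R v + b' *\<^sub>R u) u"
      using second_difference_mvt[OF t mem(2) f fv(1)] by blast
    have comm: "x + t *\<^sub>R v + t *\<^sub>R u = x + t *\<^sub>R u + t *\<^sub>R v" by simp
    have "t * t * fu (x + a *\<^sub>R u + b *\<^sub>R v) v = t * t * fv (x + a' *\<^sub>R v + b' *\<^sub>R u) u"
      using ab(5) ab'(5) unfolding comm by linarith
    then have "fu (x + a *\<^sub>R u + b *\<^sub>R v) v = fv (x + a' *\<^sub>R v + b' *\<^sub>R u) u" using t by simp
    moreover have "dist (fu (x + a *\<^sub>R u + b *\<^sub>R v) v) (fu x v) < e"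
      using near(1)[OF ab(1-4)] by (intro d1(2)) (simp add: d_def)
    moreover have "dist (fv (x + a' *\<^sub>R v + b' *\<^sub>R u) u) (fv x u) < e"
      using near(2)[OF ab'(3,4,1,2)] by (intro d2(2)) (simp add: d_def)
    ultimately show ?thesis unfolding dist_real_def by linarith
  qed
  then have "\<not> \<bar>fu x v - fv x u\<bar> / 2 > 0" by (metis field_sum_of_halves less_irrefl)
  then show ?thesis by simp
qed

text \<open>The mean value argument is real-valued, so vector-valued maps are tested by bounded
  linear functionals. For matrices these are the real and imaginary parts of the entries.\<close>

lemma Ck_on_mixed_partials:
  fixes f :: "'a::real_normed_vector \<Rightarrow> 'b::real_normed_vector" and L :: "'b \<Rightarrow> real"
  assumes U: "open U" "x \<in> U" and f: "Ck_on 2 U f" and L: "bounded_linear L"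
  shows "L (frechet_derivative (\<lambda>y. frechet_derivative f (at y) u) (at x) v) =
    L (frechet_derivative (\<lambda>y. frechet_derivative f (at y) v) (at x) u)"
proof -
  have Ck: "\<And>y. y \<in> U \<Longrightarrow> f differentiable (at y)"
    "\<And>y w. y \<in> U \<Longrightarrow> (\<lambda>y. frechet_derivative f (at y) w) differentiable (at y)"
    "\<And>w w'. continuous_on U (\<lambda>y. frechet_derivative (\<lambda>y. frechet_derivative f (at y) w) (at y) w')"
    using f by (auto simp: numeral_2_eq_2)
  have L': "((\<lambda>y. L (h y)) has_derivative (\<lambda>w. L (frechet_derivative h (at y) w))) (at y)"
    if "h differentiable (at y)" for h y
    using bounded_linear.has_derivative[OF L] that frechet_derivative_works by blast
  have Lc: "continuous_on U (\<lambda>y. L (h y))" if "continuous_on U h" for h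
    using bounded_linear.continuous_on[OF L that] .
  show ?thesis
    by (rule mixed_partials_commute[OF U, where f = "\<lambda>y. L (f y)" and f' = "\<lambda>y w. L (frechet_derivative f (at y) w)"
          and fu = "\<lambda>y w. L (frechet_derivative (\<lambda>y. frechet_derivative f (at y) u) (at y) w)"
          and fv = "\<lambda>y w. L (frechet_derivative (\<lambda>y. frechet_derivative f (at y) v) (at y) w)"])
       (auto intro: L' Lc Ck)
qed

section \<open>Bundle scalars and matrix-valued functions\<close>

lemma to_complex_0 [simp]: "to_complex 0 = 0"
  using norm_to_complex[of 0] by (metis norm_eq_zero norm_zero)

lemma to_complex_eq_0_iff [simp]: "to_complex z = 0 \<longleftrightarrow> z = 0"
  using norm_to_complex[of z] by (metis norm_eq_zero)

lemma linear_to_complex: "linear to_complex"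
  by (simp add: linear_iff to_complex_add to_complex_scaleR)

lemma bounded_linear_to_complex: "bounded_linear to_complex"
  by (rule bounded_linear_intro[where K = 1]) (simp_all add: to_complex_add to_complex_scaleR norm_to_complex)

lemma to_complex_inject [simp]: "to_complex x = to_complex y \<longleftrightarrow> x = y"
proof -
  have "to_complex (x - y) = to_complex x - to_complex y" by (rule linear_diff[OF linear_to_complex])
  then show ?thesis using to_complex_eq_0_iff[of "x - y"] by auto
qed

lemma matrix_mixed_partials:
  fixes f :: "'a::real_normed_vector \<Rightarrow> 'k::bundle_scalar ^ 'r::finite ^ 'r"
  assumes U: "open U" "x \<in> U" and f: "Ck_on 2 U f"
  shows "frechet_derivative (\<lambda>y. frechet_derivative f (at y) u) (at x) v =
    frechet_derivative (\<lambda>y. frechet_derivative f (at y) v) (at x) u" (is "?l = ?r")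
proof -
  have "to_complex (?l $ i $ j) = to_complex (?r $ i $ j)" for i j
  proof -
    have bl: "bounded_linear (\<lambda>M :: 'k ^ 'r ^ 'r. to_complex (M $ i $ j))"
      by (intro bounded_linear_compose[OF bounded_linear_to_complex] bounded_linear_compose[OF bounded_linear_vec_nth]
          bounded_linear_vec_nth)
    show ?thesis
      using Ck_on_mixed_partials[OF U f bounded_linear_compose[OF bounded_linear_Re bl], of u v]
        Ck_on_mixed_partials[OF U f bounded_linear_compose[OF bounded_linear_Im bl], of u v]
      by (simp add: complex_eq_iff)
  qed
  then show ?thesis by (simp add: vec_eq_iff)
qed

lemma norm_vec_le_sum: "norm (x :: 'b::real_normed_vector ^ 'r) \<le> (\<Sum>i\<in>UNIV. norm (x $ i))"
  unfolding norm_vec_def by (rule L2_set_le_sum) simp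

lemma bounded_bilinear_matrix_mult:
  "bounded_bilinear ((**) :: 'k::real_normed_field ^ 'r ^ 'r \<Rightarrow> 'k ^ 'r ^ 'r \<Rightarrow> 'k ^ 'r ^ 'r)"
proof
  fix A A' B B' :: "'k ^ 'r ^ 'r" and c :: real
  show "(A + A') ** B = A ** B + A' ** B" "A ** (B + B') = A ** B + A ** B'"
    "(c *\<^sub>R A) ** B = c *\<^sub>R (A ** B)" "A ** (c *\<^sub>R B) = c *\<^sub>R (A ** B)"
    by (simp_all add: vec_eq_iff matrix_matrix_mult_def algebra_simps sum.distrib scaleR_sum_right)
next
  have "norm (A ** B) \<le> norm A * norm B * (real CARD('r) * real CARD('r) * real CARD('r))" for A B :: "'k ^ 'r ^ 'r"
  proof -
    have "norm (A ** B) \<le> (\<Sum>i\<in>UNIV. \<Sum>j\<in>UNIV. norm ((A ** B) $ i $ j))"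
      by (rule order_trans[OF norm_vec_le_sum sum_mono[OF norm_vec_le_sum]])
    also have "\<dots> \<le> (\<Sum>i\<in>(UNIV :: 'r set). \<Sum>j\<in>(UNIV :: 'r set). \<Sum>k\<in>(UNIV :: 'r set). norm A * norm B)"
    proof (intro sum_mono)
      fix i j
      have entry: "norm (M $ a $ b) \<le> norm M" for M :: "'k ^ 'r ^ 'r" and a b
        by (rule order_trans[OF Finite_Cartesian_Product.norm_nth_le Finite_Cartesian_Product.norm_nth_le])
      have "norm ((A ** B) $ i $ j) \<le> (\<Sum>k\<in>UNIV. norm (A $ i $ k * B $ k $ j))"
        by (simp add: matrix_matrix_mult_def norm_sum)
      also have "\<dots> \<le> (\<Sum>k\<in>(UNIV :: 'r set). norm A * norm B)"
        by (intro sum_mono) (simp add: norm_mult entry mult_mono)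
      finally show "norm ((A ** B) $ i $ j) \<le> (\<Sum>k\<in>(UNIV :: 'r set). norm A * norm B)" .
    qed
    finally show ?thesis by (simp add: mult_ac)
  qed
  then show "\<exists>K. \<forall>(A :: 'k ^ 'r ^ 'r) (B :: 'k ^ 'r ^ 'r). norm (A ** B) \<le> norm A * norm B * K" by blast
qed

section \<open>Derivatives of determinants and inverse matrices\<close>

lemma has_derivative_vec_nth2:
  fixes M :: "'a::real_normed_vector \<Rightarrow> 'b::real_normed_vector ^ 'm ^ 'n"
  assumes "(M has_derivative M') F"
  shows "((\<lambda>y. M y $ i $ j) has_derivative (\<lambda>w. M' w $ i $ j)) F"
  by (intro bounded_linear.has_derivative[OF bounded_linear_vec_nth] assms)

text \<open>Row i of D is a combination of the rows of G with coefficients from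
  \<open>D ** matrix_inv G\<close>; in the determinant only the multiple of row i survives.\<close>

lemma sum_det_replace_row:
  fixes G D :: "real ^ 'n ^ 'n"
  assumes "invertible G"
  shows "(\<Sum>i\<in>UNIV. det (\<chi> k. if k = i then D $ i else G $ k)) = det G * trace (matrix_inv G ** D)"
proof -
  have "det (\<chi> k. if k = i then D $ i else G $ k) = (D ** matrix_inv G) $ i $ i * det G" for i
  proof -
    have d: "D $ i = (\<Sum>k\<in>UNIV. (D ** matrix_inv G) $ i $ k *s G $ k)"
    proof -
      have "D = (D ** matrix_inv G) ** G" by (simp add: matrix_inv_left[OF assms] flip: matrix_mul_assoc)
      then have "D $ i $ j = (\<Sum>k\<in>UNIV. (D ** matrix_inv G) $ i $ k * G $ k $ j)" for j
        by (metis (no_types, lifting) matrix_matrix_mult_def vec_lambda_beta sum.cong)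
      then show ?thesis by (simp add: vec_eq_iff)
    qed
    have r: "row k G = G $ k" for k by (simp add: row_def vec_eq_iff)
    show ?thesis
      using cramer_lemma_transpose[of i "(D ** matrix_inv G) $ i" G] unfolding r d[symmetric] .
  qed
  then have "(\<Sum>i\<in>UNIV. det (\<chi> k. if k = i then D $ i else G $ k)) = trace (D ** matrix_inv G) * det G"
    by (simp add: trace_def sum_distrib_right)
  then show ?thesis by (simp add: trace_mul_sym[of D])
qed

text \<open>The product rule in the permutation expansion, regrouped by rows. Stated for entries, it
  also fits the numerators in Cramer's rule.\<close>

lemma has_derivative_det_rows:
  fixes M :: "'a::real_normed_vector \<Rightarrow> real ^ 'n ^ 'n"
  assumes "\<And>i j. ((\<lambda>y. M y $ i $ j) has_derivative (\<lambda>w. M' w $ i $ j)) (at x)"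
  shows "((\<lambda>y. det (M y)) has_derivative (\<lambda>w. \<Sum>i\<in>UNIV. det (\<chi> k. if k = i then M' w $ i else M x $ k))) (at x)"
proof -
  have "((\<lambda>y. det (M y)) has_derivative (\<lambda>w. \<Sum>p | p permutes UNIV. of_int (sign p) *
      (\<Sum>i\<in>UNIV. M' w $ i $ p i * (\<Prod>j\<in>UNIV - {i}. M x $ j $ p j)))) (at x)"
    unfolding det_def by (intro has_derivative_sum has_derivative_mult_right has_derivative_prod assms)
  moreover have "(\<Sum>p | p permutes UNIV. of_int (sign p) * (\<Sum>i\<in>UNIV. M' w $ i $ p i * (\<Prod>j\<in>UNIV - {i}. M x $ j $ p j))) =
      (\<Sum>i\<in>UNIV. det (\<chi> k. if k = i then M' w $ i else M x $ k))" for w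
  proof -
    have prod: "M' w $ i $ p i * (\<Prod>j\<in>UNIV - {i}. M x $ j $ p j) =
       (\<Prod>k\<in>UNIV. (\<chi> k. if k = i then M' w $ i else M x $ k) $ k $ p k)" for i and p :: "'n \<Rightarrow> 'n"
      by (subst prod.remove[of UNIV i]) (auto intro!: prod.cong)
    show ?thesis
      unfolding prod det_def by (simp add: sum_distrib_left) (rule sum.swap)
  qed
  ultimately show ?thesis by simp
qed

lemma has_derivative_det:
  fixes g :: "'a::real_normed_vector \<Rightarrow> real ^ 'n ^ 'n"
  assumes "(g has_derivative D) (at x)" "invertible (g x)"
  shows "((\<lambda>y. det (g y)) has_derivative (\<lambda>w. det (g x) * trace (matrix_inv (g x) ** D w))) (at x)"
  using has_derivative_det_rows[OF has_derivative_vec_nth2[OF assms(1)]]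
  by (simp add: sum_det_replace_row[OF assms(2)])

lemma matrix_inv_cramer:
  fixes G :: "real ^ 'n ^ 'n"
  assumes "invertible G"
  shows "matrix_inv G $ k $ l = det (\<chi> i j. if j = k then axis l 1 $ i else G $ i $ j) / det G"
proof -
  have "G *v (matrix_inv G *v axis l 1) = axis l 1"
    by (simp add: matrix_vector_mul_assoc matrix_inv_right[OF assms])
  then have "matrix_inv G *v axis l 1 = (\<chi> k. det (\<chi> i j. if j = k then axis l 1 $ i else G $ i $ j) / det G)"
    using cramer[of G] assms by (simp add: invertible_det_nz)
  then have "(matrix_inv G *v axis l 1) $ k = det (\<chi> i j. if j = k then axis l 1 $ i else G $ i $ j) / det G"
    by simp
  then show ?thesis by (simp add: matrix_vector_mult_basis column_def)
qed

text \<open>Cramer's rule shows that the entries of the inverse are differentiable; differentiating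
  \<open>g y ** matrix_inv (g y) = mat 1\<close> then determines the derivative.\<close>

lemma has_derivative_matrix_inv:
  fixes g :: "'a::real_normed_vector \<Rightarrow> real ^ 'n ^ 'n"
  assumes g: "(g has_derivative D) (at x)" and U: "open U" "x \<in> U" and inv: "\<And>y. y \<in> U \<Longrightarrow> invertible (g y)"
  shows "((\<lambda>y. matrix_inv (g y) $ k $ l) has_derivative
    (\<lambda>w. - (matrix_inv (g x) ** D w ** matrix_inv (g x)) $ k $ l)) (at x)"
proof -
  let ?H = "matrix_inv (g x)"
  have entry: "((\<lambda>y. g y $ i $ j) has_derivative (\<lambda>w. D w $ i $ j)) (at x)" for i j
    by (rule has_derivative_vec_nth2[OF g])
  have "\<exists>n. ((\<lambda>y. matrix_inv (g y) $ k $ l) has_derivative n) (at x)" for k l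
  proof -
    let ?M = "\<lambda>y. \<chi> i j. if j = k then axis l 1 $ i else g y $ i $ j"
    have "((\<lambda>y. ?M y $ i $ j) has_derivative (\<lambda>w. (\<chi> i j. if j = k then 0 else D w $ i $ j) $ i $ j)) (at x)" for i j
      by (cases "j = k") (simp_all add: entry)
    from has_derivative_det_rows[OF this]
    have "(\<lambda>y. det (?M y)) differentiable (at x)" unfolding differentiable_def by blast
    moreover have "(\<lambda>y. det (g y)) differentiable (at x)"
      using has_derivative_det[OF g inv[OF U(2)]] unfolding differentiable_def by blast
    moreover have "det (g x) \<noteq> 0" using inv[OF U(2)] by (simp add: invertible_det_nz)
    ultimately have "(\<lambda>y. det (?M y) / det (g y)) differentiable (at x)" by (rule differentiable_divide)
    then obtain n where "((\<lambda>y. det (?M y) / det (g y)) has_derivative n) (at x)" unfolding differentiable_def by blast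
    then have "((\<lambda>y. matrix_inv (g y) $ k $ l) has_derivative n) (at x)"
      by (rule has_derivative_transform_within_open[OF _ U]) (simp add: matrix_inv_cramer inv)
    then show ?thesis by blast
  qed
  then obtain n where n: "\<And>k l. ((\<lambda>y. matrix_inv (g y) $ k $ l) has_derivative n k l) (at x)" by metis
  define N where "N w = (\<chi> k l. n k l w)" for w
  have "(D w ** ?H + g x ** N w) $ i $ l = 0" for w i l
  proof -
    have "((\<lambda>y. \<Sum>j\<in>UNIV. g y $ i $ j * matrix_inv (g y) $ j $ l) has_derivative
       (\<lambda>w. \<Sum>j\<in>UNIV. g x $ i $ j * n j l w + D w $ i $ j * ?H $ j $ l)) (at x)"
      by (intro has_derivative_sum has_derivative_mult entry n)
    moreover have "((\<lambda>y. \<Sum>j\<in>UNIV. g y $ i $ j * matrix_inv (g y) $ j $ l) has_derivative (\<lambda>w. 0)) (at x)"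
    proof (rule has_derivative_transform_within_open[OF has_derivative_const U])
      fix y assume "y \<in> U"
      then have "(g y ** matrix_inv (g y)) $ i $ l = mat 1 $ i $ l" using matrix_inv_right[OF inv] by simp
      then show "mat 1 $ i $ l = (\<Sum>j\<in>UNIV. g y $ i $ j * matrix_inv (g y) $ j $ l)"
        by (simp add: matrix_matrix_mult_def)
    qed
    ultimately have "(\<lambda>w. \<Sum>j\<in>UNIV. g x $ i $ j * n j l w + D w $ i $ j * ?H $ j $ l) = (\<lambda>w. 0)"
      by (rule has_derivative_unique)
    then have "(\<Sum>j\<in>UNIV. g x $ i $ j * n j l w + D w $ i $ j * ?H $ j $ l) = 0" by (rule fun_cong)
    then show ?thesis by (simp add: matrix_matrix_mult_def N_def sum.distrib add.commute)
  qed
  then have "D w ** ?H + g x ** N w = 0" for w by (simp add: vec_eq_iff)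
  then have "g x ** N w = - (D w ** ?H)" for w by (metis add_eq_0_iff)
  then have "?H ** (g x ** N w) = - (?H ** D w ** ?H)" for w
    using bounded_bilinear.minus_right[OF bounded_bilinear_matrix_mult] by (metis matrix_mul_assoc)
  then have "N w = - (?H ** D w ** ?H)" for w
    by (simp add: matrix_mul_assoc matrix_inv_left[OF inv[OF U(2)]])
  then have "N w $ k $ l = - (?H ** D w ** ?H) $ k $ l" for w by simp
  then have "n k l = (\<lambda>w. - (?H ** D w ** ?H) $ k $ l)" by (simp add: N_def fun_eq_iff)
  then show ?thesis using n[of k l] by simp
qed

section \<open>Covariant derivatives of two-forms\<close>

lemma bilinear_expand:
  fixes f :: "real ^ 'n \<Rightarrow> real ^ 'n \<Rightarrow> 'v::real_vector"
  assumes "bilinear f"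
  shows "f p q = (\<Sum>a\<in>UNIV. \<Sum>b\<in>UNIV. (p $ a * q $ b) *\<^sub>R f (axis a 1) (axis b 1))"
proof -
  have lin: "linear (f u)" "linear (\<lambda>u. f u v)" for u v using assms by (auto simp: bilinear_def)
  have "f p q = (\<Sum>a\<in>UNIV. p $ a *\<^sub>R f (axis a 1) q)" by (rule linear_eq_sum_axis[OF lin(2)])
  also have "\<dots> = (\<Sum>a\<in>UNIV. p $ a *\<^sub>R (\<Sum>b\<in>UNIV. q $ b *\<^sub>R f (axis a 1) (axis b 1)))"
    by (rule sum.cong[OF refl], subst linear_eq_sum_axis[OF lin(1)]) (rule refl)
  finally show ?thesis by (simp add: scaleR_sum_right)
qed

text \<open>The derivative is taken at x, while symmetry and positivity of the determinant hold on a
  neighbourhood, so that identities valid there can be differentiated.\<close>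

locale metric_germ =
  fixes g :: "real ^ 'n \<Rightarrow> real ^ 'n ^ 'n" and U and x :: "real ^ 'n" and D
  assumes U: "open U" "x \<in> U"
    and g_deriv: "(g has_derivative D) (at x)"
    and g_sym: "\<And>y. y \<in> U \<Longrightarrow> transpose (g y) = g y"
    and g_det: "\<And>y. y \<in> U \<Longrightarrow> det (g y) > 0"
begin

abbreviation "H \<equiv> matrix_inv (g x)"

lemma g_inv: "y \<in> U \<Longrightarrow> invertible (g y)"
  using g_det[of y] by (simp add: invertible_det_nz)

lemma g_sym_nth: "y \<in> U \<Longrightarrow> g y $ i $ j = g y $ j $ i"
  using arg_cong[OF g_sym, of y "\<lambda>M. M $ j $ i"] by (simp add: transpose_def)

lemma H_sym: "transpose H = H"
  by (rule transpose_matrix_inv[OF g_inv g_sym]) (rule U)+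

lemma D_eq: "frechet_derivative g (at x) = D"
  using frechet_derivative_at[OF g_deriv] by simp

lemma linear_D: "linear D"
  by (rule has_derivative_linear[OF g_deriv])

lemma D_sym: "D w $ i $ j = D w $ j $ i"
proof -
  have "((\<lambda>y. g y $ j $ i) has_derivative (\<lambda>w. D w $ i $ j)) (at x)"
    by (rule has_derivative_transform_within_open[OF has_derivative_vec_nth2[OF g_deriv] U])
       (rule g_sym_nth)
  from has_derivative_unique[OF this has_derivative_vec_nth2[OF g_deriv]]
  show ?thesis by (rule fun_cong)
qed

text \<open>The Christoffel symbols of the first kind, contracted with \<open>u\<close> and \<open>v\<close>.\<close>

definition first_kind :: "real ^ 'n \<Rightarrow> real ^ 'n \<Rightarrow> real ^ 'n" where
  "first_kind u v = (\<chi> l. (v \<bullet> (D u *v axis l 1) + u \<bullet> (D v *v axis l 1) - u \<bullet> (D (axis l 1) *v v)) / 2)"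

definition \<Gamma> :: "real ^ 'n \<Rightarrow> real ^ 'n ^ 'n" where
  "\<Gamma> u = matrix (christoffel g x u)"

lemma christoffel_eq: "christoffel g x u v = H *v first_kind u v"
  by (simp add: christoffel_def first_kind_def D_eq Let_def)

lemma linear_first_kind: "linear (first_kind u)"
proof -
  have "linear (\<lambda>v. v \<bullet> (D u *v axis l 1))" "linear (\<lambda>v. u \<bullet> (D v *v axis l 1))" "linear (\<lambda>v. u \<bullet> (D (axis l 1) *v v))" for l
    using linear_D
    by (simp_all add: linear_iff matrix_vector_mult_add_rdistrib matrix_vector_right_distrib inner_add_left
        inner_add_right matrix_vector_mult_scaleR scaleR_matrix_vector_assoc[symmetric])
  then have "linear (\<lambda>v. (1 / 2) *\<^sub>R (v \<bullet> (D u *v axis l 1) + u \<bullet> (D v *v axis l 1) - u \<bullet> (D (axis l 1) *v v)))" for l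
    by (intro linear_compose_scale_right linear_compose_sub linear_compose_add)
  then have "linear (\<lambda>v. first_kind u v $ l)" for l by (simp add: first_kind_def)
  then show ?thesis by (simp add: linear_iff vec_eq_iff)
qed

lemma \<Gamma>_mult: "\<Gamma> u *v v = christoffel g x u v"
proof -
  have "linear (christoffel g x u)"
    unfolding christoffel_eq[abs_def]
    using linear_compose[OF linear_first_kind matrix_vector_mul_linear] by (simp add: o_def)
  then show ?thesis by (simp add: \<Gamma>_def matrix_works)
qed

text \<open>Torsion-freeness of the Levi-Civita connection, inherited from the symmetry of the
  derivative of the metric.\<close>

lemma \<Gamma>_commute: "\<Gamma> u *v v = \<Gamma> v *v u"
proof -
  have "transpose (D w) = D w" for w by (simp add: vec_eq_iff transpose_def D_sym)
  then have "u \<bullet> (D w *v v) = v \<bullet> (D w *v u)" for w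
    using transpose_symmetric[of "D w"] by (metis inner_commute)
  then have "first_kind u v = first_kind v u" by (simp add: first_kind_def add.commute)
  then show ?thesis by (simp add: \<Gamma>_mult christoffel_eq)
qed

text \<open>The last two terms of the Christoffel formula are antisymmetric in the two free indices
  and drop out when the transpose is added.\<close>

lemma metric_compatible: "D w = g x ** \<Gamma> w + transpose (\<Gamma> w) ** g x"
proof -
  note sym = g_sym_nth[OF U(2)]
  have ax: "M *v axis j 1 = column j M" for M :: "real ^ 'n ^ 'n" and j by (rule matrix_vector_mult_basis)
  have entry: "(g x ** \<Gamma> w) $ i $ j = (D w $ j $ i + w \<bullet> (D (axis j 1) *v axis i 1) - w \<bullet> (D (axis i 1) *v axis j 1)) / 2" for i j
  proof -
    have "(g x ** \<Gamma> w) $ i $ j = (g x *v (\<Gamma> w *v axis j 1)) $ i"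
      by (simp only: ax) (simp add: matrix_matrix_mult_def matrix_vector_mult_def column_def)
    also have "\<dots> = first_kind w (axis j 1) $ i"
      by (simp add: \<Gamma>_mult christoffel_eq matrix_vector_mul_assoc matrix_inv_right[OF g_inv[OF U(2)]])
    finally show ?thesis by (simp add: first_kind_def inner_axis' ax column_def)
  qed
  have tr: "(transpose (\<Gamma> w) ** g x) $ i $ j = (g x ** \<Gamma> w) $ j $ i" for i j
    by (simp add: matrix_matrix_mult_def transpose_def sym[of _ j] mult.commute)
  show ?thesis
    by (simp add: vec_eq_iff tr entry) (simp add: D_sym field_simps)
qed

lemma inverse_metric_derivative: "H ** D w ** H = \<Gamma> w ** H + H ** transpose (\<Gamma> w)"
proof -
  have "H ** D w ** H = (H ** g x) ** \<Gamma> w ** H + H ** transpose (\<Gamma> w) ** (g x ** H)"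
    unfolding metric_compatible
    by (simp add: matrix_add_ldistrib bounded_bilinear.add_left[OF bounded_bilinear_matrix_mult] matrix_mul_assoc)
  then show ?thesis by (simp add: matrix_inv_left[OF g_inv[OF U(2)]] matrix_inv_right[OF g_inv[OF U(2)]])
qed

text \<open>By \<open>has_derivative_det\<close> half of the left-hand side is the logarithmic
  derivative of the density \<open>sqrt (det (g y))\<close>, so the density contributes the trace of
  \<open>\<Gamma>\<close>.\<close>

lemma trace_inverse_metric: "trace (H ** D w) = 2 * trace (\<Gamma> w)"
proof -
  have "trace (H ** D w) = trace (H ** g x ** \<Gamma> w) + trace (H ** (transpose (\<Gamma> w) ** g x))"
    unfolding metric_compatible by (simp add: matrix_add_ldistrib trace_add matrix_mul_assoc)
  also have "trace (H ** (transpose (\<Gamma> w) ** g x)) = trace ((transpose (\<Gamma> w) ** g x) ** H)"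
    by (rule trace_mul_sym)
  also have "(transpose (\<Gamma> w) ** g x) ** H = transpose (\<Gamma> w)"
    by (simp add: matrix_inv_right[OF g_inv[OF U(2)]] flip: matrix_mul_assoc)
  also have "trace (transpose (\<Gamma> w)) = trace (\<Gamma> w)" by (simp add: trace_def transpose_def)
  finally show ?thesis by (simp add: matrix_inv_left[OF g_inv[OF U(2)]])
qed

end

section \<open>Two-forms and their Levi-Civita derivative\<close>

locale two_form_germ = metric_germ g U x D
  for g :: "real ^ 'n \<Rightarrow> real ^ 'n ^ 'n" and U and x :: "real ^ 'n" and D +
  fixes f :: "real ^ 'n \<Rightarrow> real ^ 'n \<Rightarrow> real ^ 'n \<Rightarrow> 'v::real_normed_vector" and f'
  assumes f_bilinear: "\<And>y. y \<in> U \<Longrightarrow> bilinear (f y)"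
    and f_skew: "\<And>y u v. y \<in> U \<Longrightarrow> f y u v = - f y v u"
    and f_deriv: "\<And>u v. ((\<lambda>y. f y u v) has_derivative (\<lambda>w. f' w u v)) (at x)"
begin

lemma linear_f: "linear (f x u)" "linear (\<lambda>u. f x u v)"
  using f_bilinear[OF U(2)] by (auto simp: bilinear_def)

text \<open>Carries linearity and skewness from the forms near x over to the derivative at
  x.\<close>

lemma f'_unique:
  assumes "((\<lambda>y. f y u v) has_derivative F) (at x)"
  shows "f' w u v = F w"
  using has_derivative_unique[OF f_deriv assms] by metis

lemma bilinear_f': "bilinear (f' w)"
proof -
  have "f' w (a + b) v = f' w a v + f' w b v" "f' w u (a + b) = f' w u a + f' w u b"
    "f' w (c *\<^sub>R a) v = c *\<^sub>R f' w a v" "f' w u (c *\<^sub>R a) = c *\<^sub>R f' w u a" for a b c u v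
  proof -
    show "f' w (a + b) v = f' w a v + f' w b v"
      by (rule f'_unique, rule has_derivative_transform_within_open[OF has_derivative_add[OF f_deriv f_deriv] U])
         (simp add: bilinear_ladd[OF f_bilinear])
    show "f' w u (a + b) = f' w u a + f' w u b"
      by (rule f'_unique, rule has_derivative_transform_within_open[OF has_derivative_add[OF f_deriv f_deriv] U])
         (simp add: bilinear_radd[OF f_bilinear])
    show "f' w (c *\<^sub>R a) v = c *\<^sub>R f' w a v"
      by (rule f'_unique, rule has_derivative_transform_within_open[OF has_derivative_scaleR_right[OF f_deriv] U])
         (simp add: bilinear_lmul[OF f_bilinear])
    show "f' w u (c *\<^sub>R a) = c *\<^sub>R f' w u a"
      by (rule f'_unique, rule has_derivative_transform_within_open[OF has_derivative_scaleR_right[OF f_deriv] U])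
         (simp add: bilinear_rmul[OF f_bilinear])
  qed
  then show ?thesis by (simp add: bilinear_def linear_iff)
qed

lemma f'_skew: "f' w u v = - f' w v u"
  by (rule f'_unique, rule has_derivative_transform_within_open[OF has_derivative_minus[OF f_deriv] U])
     (metis f_skew minus_minus)

lemma linear_f'_direction: "linear (\<lambda>w. f' w u v)"
  by (rule has_derivative_linear[OF f_deriv])

text \<open>The Levi-Civita derivative of f in direction w, evaluated on vector fields with constant
  coordinates.\<close>

definition cov :: "real ^ 'n \<Rightarrow> real ^ 'n \<Rightarrow> real ^ 'n \<Rightarrow> 'v" where
  "cov w u v = f' w u v - f x (\<Gamma> w *v u) v - f x u (\<Gamma> w *v v)"

lemma bilinear_cov: "bilinear (cov w)"
  using bilinear_f'[of w] linear_f
  by (simp add: cov_def[abs_def] bilinear_def linear_iff matrix_vector_right_distrib matrix_vector_mult_scaleR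
      algebra_simps)

lemma linear_cov_direction: "linear (\<lambda>w. cov w u v)"
  unfolding cov_def \<Gamma>_commute[of _ u] \<Gamma>_commute[of _ v]
  using linear_f'_direction[of u v] linear_f
  by (simp add: linear_iff matrix_vector_right_distrib matrix_vector_mult_scaleR algebra_simps)

lemma cov_skew: "cov w u v = - cov w v u"
  using f'_skew[of w u v] f_skew[OF U(2), of u "\<Gamma> w *v v"] f_skew[OF U(2), of "\<Gamma> w *v u" v]
  by (simp add: cov_def)

text \<open>By torsion-freeness and skewness of f the Christoffel terms cancel in pairs: the
  exterior derivative of a two-form may be computed with the covariant derivative.\<close>

lemma cov_cyclic: "cov u v w + cov v w u + cov w u v = f' u v w + f' v w u + f' w u v"
  using f_skew[OF U(2), of w "\<Gamma> u *v v"] f_skew[OF U(2), of u "\<Gamma> v *v w"] f_skew[OF U(2), of v "\<Gamma> w *v u"]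
  by (simp add: cov_def \<Gamma>_commute[of v u] \<Gamma>_commute[of w v] \<Gamma>_commute[of u w])

text \<open>Differentiating the skewness of f with respect to J gives the claim up to terms
  containing the covariant derivative of J. Hypothesis \<open>C\<close>, skewness with respect to
  that derivative, removes them.\<close>

lemma cov_invariant:
  assumes J: "(J has_derivative J') (at x)" and N: "open N" "x \<in> N" "N \<subseteq> U"
    and inv: "\<And>y u v. y \<in> N \<Longrightarrow> f y (J y *v u) v = - f y u (J y *v v)"
    and C: "\<And>u v. f x ((J' w + \<Gamma> w ** J x - J x ** \<Gamma> w) *v u) v = - f x u ((J' w + \<Gamma> w ** J x - J x ** \<Gamma> w) *v v)"
  shows "cov w (J x *v u) v = - cov w u (J x *v v)"
proof -
  have Ju: "((\<lambda>y. (J y *v u) $ a) has_derivative (\<lambda>w. (J' w *v u) $ a)) (at x)" for u a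
    unfolding matrix_vector_mult_def vec_lambda_beta
    by (intro has_derivative_sum has_derivative_mult_left has_derivative_vec_nth2 J)
  \<comment> \<open>The argument moves with y, while \<open>f_deriv\<close> speaks of fixed
    arguments; hence the expansion over the coordinate basis.\<close>
  have left: "((\<lambda>y. f y (J y *v u) v) has_derivative (\<lambda>w. f' w (J x *v u) v + f x (J' w *v u) v)) (at x)" for u v
  proof -
    have "((\<lambda>y. \<Sum>a\<in>UNIV. (J y *v u) $ a *\<^sub>R f y (axis a 1) v) has_derivative
        (\<lambda>w. \<Sum>a\<in>UNIV. (J x *v u) $ a *\<^sub>R f' w (axis a 1) v + (J' w *v u) $ a *\<^sub>R f x (axis a 1) v)) (at x)"
      by (intro has_derivative_sum has_derivative_scaleR Ju f_deriv)
    moreover have "(\<Sum>a\<in>UNIV. (J x *v u) $ a *\<^sub>R f' w (axis a 1) v + (J' w *v u) $ a *\<^sub>R f x (axis a 1) v) =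
        f' w (J x *v u) v + f x (J' w *v u) v" for w
      using linear_eq_sum_axis[of "\<lambda>u. f' w u v" "J x *v u"] linear_eq_sum_axis[OF linear_f(2), of "J' w *v u" v]
        bilinear_f'[of w] by (simp add: bilinear_def sum.distrib)
    ultimately have "((\<lambda>y. \<Sum>a\<in>UNIV. (J y *v u) $ a *\<^sub>R f y (axis a 1) v) has_derivative
        (\<lambda>w. f' w (J x *v u) v + f x (J' w *v u) v)) (at x)" by simp
    then show ?thesis
    proof (rule has_derivative_transform_within_open[OF _ U])
      fix y assume "y \<in> U"
      then have "linear (\<lambda>u. f y u v)" using f_bilinear by (simp add: bilinear_def)
      from linear_eq_sum_axis[OF this, of "J y *v u"]
      show "(\<Sum>a\<in>UNIV. (J y *v u) $ a *\<^sub>R f y (axis a 1) v) = f y (J y *v u) v" by simp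
    qed
  qed
  have "((\<lambda>y. - f y u (J y *v v)) has_derivative (\<lambda>w. f' w (J x *v v) u + f x (J' w *v v) u)) (at x)"
    by (rule has_derivative_transform_within_open[OF left[of v u] U]) (metis f_skew)
  then have "((\<lambda>y. f y (J y *v u) v) has_derivative (\<lambda>w. f' w (J x *v v) u + f x (J' w *v v) u)) (at x)"
    by (rule has_derivative_transform_within_open[OF _ N(1,2)]) (simp add: inv)
  from has_derivative_unique[OF this left]
  have "f' w (J x *v v) u + f x (J' w *v v) u = f' w (J x *v u) v + f x (J' w *v u) v" by metis
  then have 1: "f' w (J x *v u) v + f x (J' w *v u) v = - f' w u (J x *v v) - f x u (J' w *v v)"
    using f'_skew[of w u "J x *v v"] f_skew[OF U(2), of u "J' w *v v"] by simp
  have 2: "f x (J' w *v u) v + f x (\<Gamma> w *v (J x *v u)) v - f x (J x *v (\<Gamma> w *v u)) v =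
      - f x u (J' w *v v) - f x u (\<Gamma> w *v (J x *v v)) + f x u (J x *v (\<Gamma> w *v v))"
    using C[of u v] linear_f
    by (simp add: matrix_vector_mult_add_rdistrib matrix_vector_mult_diff_rdistrib linear_add linear_diff
        linear_add[OF linear_f(2)] linear_diff[OF linear_f(2)] flip: matrix_vector_mul_assoc)
  \<comment> \<open>P collects the terms with the derivative of J. It is computed once from the
    differentiated identity and once from \<open>C\<close>.\<close>
  define P where "P = f x u (J' w *v v) + f x (J' w *v u) v"
  have P1: "f' w (J x *v u) v + f' w u (J x *v v) = - P"
    using 1 by (simp add: P_def algebra_simps eq_neg_iff_add_eq_0)
  have P2: "P = f x u (J x *v (\<Gamma> w *v v)) + f x (J x *v (\<Gamma> w *v u)) v
      - f x (\<Gamma> w *v (J x *v u)) v - f x u (\<Gamma> w *v (J x *v v))"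
    using 2 unfolding P_def by (simp add: algebra_simps)
  have "cov w (J x *v u) v + cov w u (J x *v v) = (f' w (J x *v u) v + f' w u (J x *v v))
      - f x (\<Gamma> w *v (J x *v u)) v - f x (J x *v u) (\<Gamma> w *v v) - f x (\<Gamma> w *v u) (J x *v v) - f x u (\<Gamma> w *v (J x *v v))"
    by (simp add: cov_def)
  also have "\<dots> = 0"
    unfolding P1 P2 using inv[OF N(2), of "\<Gamma> w *v u" v] inv[OF N(2), of u "\<Gamma> w *v v"] by simp
  finally show ?thesis by (simp add: eq_neg_iff_add_eq_0)
qed

text \<open>The coefficients of the Hodge dual of \<open>f\<close> with respect to the coordinate volume form.\<close>

definition R :: "real ^ 'n \<Rightarrow> 'n \<Rightarrow> 'n \<Rightarrow> 'v" where
  "R y j k = (sqrt (det (g y)) / 2) *\<^sub>R f y (matrix_inv (g y) *v axis j 1) (matrix_inv (g y) *v axis k 1)"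

definition R' :: "real ^ 'n \<Rightarrow> 'n \<Rightarrow> 'n \<Rightarrow> 'v" where
  "R' w j k = (sqrt (det (g x)) / 2) *\<^sub>R
     (trace (\<Gamma> w) *\<^sub>R f x (H *v axis j 1) (H *v axis k 1) + f' w (H *v axis j 1) (H *v axis k 1)
       - f x ((H ** D w ** H) *v axis j 1) (H *v axis k 1) - f x (H *v axis j 1) ((H ** D w ** H) *v axis k 1))"

text \<open>Three product-rule contributions: the density gives the trace of
  \<open>\<Gamma>\<close>, the form gives \<open>f'\<close>, and each raised index gives minus
  \<open>H ** D w ** H\<close>.\<close>

lemma R_deriv: "((\<lambda>y. R y j k) has_derivative (\<lambda>w. R' w j k)) (at x)"
proof -
  have inv: "invertible (g x)" by (rule g_inv[OF U(2)])
  have det: "det (g x) > 0" by (rule g_det[OF U(2)])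
  let ?N = "\<lambda>y a j. matrix_inv (g y) $ a $ j" and ?n = "\<lambda>w a j. - (H ** D w ** H) $ a $ j"
  have N: "((\<lambda>y. ?N y a j) has_derivative (\<lambda>w. ?n w a j)) (at x)" for a j
    by (rule has_derivative_matrix_inv[OF g_deriv U g_inv])
  have S: "((\<lambda>y. \<Sum>a\<in>UNIV. \<Sum>b\<in>UNIV. (?N y a j * ?N y b k) *\<^sub>R f y (axis a 1) (axis b 1)) has_derivative
     (\<lambda>w. \<Sum>a\<in>UNIV. \<Sum>b\<in>UNIV. (?N x a j * ?N x b k) *\<^sub>R f' w (axis a 1) (axis b 1) +
        (?N x a j * ?n w b k + ?n w a j * ?N x b k) *\<^sub>R f x (axis a 1) (axis b 1))) (at x)"
    by (intro has_derivative_sum has_derivative_scaleR has_derivative_mult N f_deriv)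
  have col: "(M *v axis j 1) $ a = M $ a $ j" for M :: "real ^ 'n ^ 'n" and a j
    by (simp add: matrix_vector_mult_basis column_def)
  have expand: "(\<Sum>a\<in>UNIV. \<Sum>b\<in>UNIV. (M $ a $ j * L $ b $ k) *\<^sub>R h (axis a 1) (axis b 1)) = h (M *v axis j 1) (L *v axis k 1)"
    if "bilinear h" for h :: "real ^ 'n \<Rightarrow> real ^ 'n \<Rightarrow> 'v" and M L :: "real ^ 'n ^ 'n" and j k
    using bilinear_expand[OF that, of "M *v axis j 1" "L *v axis k 1"] by (simp add: col)
  have S': "(\<Sum>a\<in>UNIV. \<Sum>b\<in>UNIV. (?N x a j * ?N x b k) *\<^sub>R f' w (axis a 1) (axis b 1) +
        (?N x a j * ?n w b k + ?n w a j * ?N x b k) *\<^sub>R f x (axis a 1) (axis b 1)) =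
      f' w (H *v axis j 1) (H *v axis k 1) - f x (H *v axis j 1) ((H ** D w ** H) *v axis k 1)
        - f x ((H ** D w ** H) *v axis j 1) (H *v axis k 1)" for w
    unfolding expand[OF bilinear_f', symmetric] expand[OF f_bilinear[OF U(2)], symmetric]
    by (simp add: sum.distrib sum_subtractf sum_negf scaleR_left_distrib scaleR_left_diff_distrib algebra_simps)
  have sq: "((\<lambda>y. sqrt (det (g y)) / 2) has_derivative (\<lambda>w. sqrt (det (g x)) / 2 * trace (\<Gamma> w))) (at x)"
  proof -
    have "((\<lambda>y. sqrt (det (g y))) has_derivative
        (\<lambda>w. det (g x) * trace (H ** D w) * (inverse (sqrt (det (g x))) / 2))) (at x)"
      by (rule DERIV_compose_FDERIV[OF DERIV_real_sqrt[OF det] has_derivative_det[OF g_deriv inv]])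
    then have "((\<lambda>y. sqrt (det (g y)) * (1 / 2)) has_derivative
        (\<lambda>w. det (g x) * trace (H ** D w) * (inverse (sqrt (det (g x))) / 2) * (1 / 2))) (at x)"
      by (rule has_derivative_mult_left)
    moreover have "det (g x) * trace (H ** D w) * (inverse (sqrt (det (g x))) / 2) * (1 / 2) =
        sqrt (det (g x)) / 2 * trace (\<Gamma> w)" for w
    proof -
      have "det (g x) * inverse (sqrt (det (g x))) = sqrt (det (g x))"
        using real_div_sqrt[of "det (g x)"] det by (simp add: divide_inverse)
      then have "det (g x) * (2 * trace (\<Gamma> w)) * (inverse (sqrt (det (g x))) / 2) * (1 / 2) =
        sqrt (det (g x)) * trace (\<Gamma> w) / 2"
        by (simp add: mult.assoc mult.left_commute mult.commute)
      then show ?thesis by (simp add: trace_inverse_metric)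
    qed
    ultimately have "((\<lambda>y. sqrt (det (g y)) * (1 / 2)) has_derivative (\<lambda>w. sqrt (det (g x)) / 2 * trace (\<Gamma> w))) (at x)"
      by (simp only:)
    then show ?thesis by simp
  qed
  have "((\<lambda>y. (sqrt (det (g y)) / 2) *\<^sub>R (\<Sum>a\<in>UNIV. \<Sum>b\<in>UNIV. (?N y a j * ?N y b k) *\<^sub>R f y (axis a 1) (axis b 1)))
      has_derivative (\<lambda>w. R' w j k)) (at x)"
    using has_derivative_scaleR[OF sq S] unfolding S' expand[OF f_bilinear[OF U(2)]]
    by (rule has_derivative_eq_rhs) (simp add: R'_def fun_eq_iff algebra_simps)
  then show ?thesis
  proof (rule has_derivative_transform_within_open[OF _ U])
    fix y assume "y \<in> U"
    then show "(sqrt (det (g y)) / 2) *\<^sub>R (\<Sum>a\<in>UNIV. \<Sum>b\<in>UNIV. (?N y a j * ?N y b k) *\<^sub>R f y (axis a 1) (axis b 1)) = R y j k"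
      by (simp add: R_def expand[OF f_bilinear])
  qed
qed

text \<open>The divergence of a skew tensor with two raised indices, multiplied by the volume
  density, is given by ordinary coordinate derivatives without Christoffel terms.\<close>

lemma divergence_R:
  "(\<Sum>k\<in>UNIV. R' (axis k 1) j k) = (sqrt (det (g x)) / 2) *\<^sub>R (\<Sum>k\<in>UNIV. cov (axis k 1) (H *v axis j 1) (H *v axis k 1))"
proof -
  let ?e = "\<lambda>k. axis k 1 :: real ^ 'n"
  let ?c = "\<lambda>w a k. (\<Gamma> w *v ?e a) $ k"
  have col: "(M *v axis j 1) $ a = M $ a $ j" for M :: "real ^ 'n ^ 'n" and a j
    by (simp add: matrix_vector_mult_basis column_def)
  have HDH: "(H ** D w ** H) *v v = \<Gamma> w *v (H *v v) + H *v (transpose (\<Gamma> w) *v v)" for w v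
    by (simp add: inverse_metric_derivative matrix_vector_mult_add_rdistrib flip: matrix_vector_mul_assoc)
  have tr: "(\<Sum>a\<in>UNIV. ?c w a j *\<^sub>R \<psi> (H *v ?e a)) = \<psi> (H *v (transpose (\<Gamma> w) *v ?e j))"
    if "linear \<psi>" for \<psi> :: "real ^ 'n \<Rightarrow> 'v" and w j
    using sum_nth_scaleR_linear[OF that, of "transpose (\<Gamma> w) *v ?e j" H] by (simp add: col transpose_def)
  \<comment> \<open>Christoffel symbols symmetric in their lower indices are contracted here with a
    skew tensor.\<close>
  have 1: "(\<Sum>k\<in>UNIV. f x (H *v (transpose (\<Gamma> (?e k)) *v ?e j)) (H *v ?e k)) = 0"
  proof -
    let ?X = "\<Sum>k\<in>UNIV. \<Sum>a\<in>UNIV. ?c (?e k) a j *\<^sub>R f x (H *v ?e a) (H *v ?e k)"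
    have "?X = (\<Sum>a\<in>UNIV. \<Sum>k\<in>UNIV. ?c (?e k) a j *\<^sub>R f x (H *v ?e a) (H *v ?e k))" by (rule sum.swap)
    also have "\<dots> = (\<Sum>a\<in>UNIV. \<Sum>k\<in>UNIV. - (?c (?e a) k j *\<^sub>R f x (H *v ?e k) (H *v ?e a)))"
    proof (rule sum.cong[OF refl], rule sum.cong[OF refl])
      fix a k
      show "?c (?e k) a j *\<^sub>R f x (H *v ?e a) (H *v ?e k) = - (?c (?e a) k j *\<^sub>R f x (H *v ?e k) (H *v ?e a))"
        by (subst f_skew[OF U(2)]) (simp add: \<Gamma>_commute[of "?e k"])
    qed
    also have "\<dots> = - ?X" by (simp add: sum_negf)
    finally have "?X = - ?X" .
    then have "?X = 0" by (rule eq_uminus_self_imp_0)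
    then show ?thesis by (simp add: tr[OF linear_f(2)])
  qed
  \<comment> \<open>Torsion-freeness turns this contraction into the trace of
    \<open>\<Gamma>\<close>, which cancels the derivative of the density.\<close>
  have 2: "(\<Sum>k\<in>UNIV. f x (H *v ?e j) (H *v (transpose (\<Gamma> (?e k)) *v ?e k))) =
      (\<Sum>k\<in>UNIV. trace (\<Gamma> (?e k)) *\<^sub>R f x (H *v ?e j) (H *v ?e k))"
  proof -
    have "(\<Sum>k\<in>UNIV. f x (H *v ?e j) (H *v (transpose (\<Gamma> (?e k)) *v ?e k))) =
      (\<Sum>k\<in>UNIV. \<Sum>a\<in>UNIV. ?c (?e k) a k *\<^sub>R f x (H *v ?e j) (H *v ?e a))"
      by (simp only: tr[OF linear_f(1)])
    also have "\<dots> = (\<Sum>a\<in>UNIV. \<Sum>k\<in>UNIV. ?c (?e a) k k *\<^sub>R f x (H *v ?e j) (H *v ?e a))"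
      by (subst sum.swap, rule sum.cong[OF refl], rule sum.cong[OF refl], subst \<Gamma>_commute, rule refl)
    also have "\<dots> = (\<Sum>a\<in>UNIV. trace (\<Gamma> (?e a)) *\<^sub>R f x (H *v ?e j) (H *v ?e a))"
      by (simp add: trace_def col scaleR_sum_left)
    finally show ?thesis .
  qed
  have "(\<Sum>k\<in>UNIV. R' (?e k) j k) = (sqrt (det (g x)) / 2) *\<^sub>R (\<Sum>k\<in>UNIV.
      cov (?e k) (H *v ?e j) (H *v ?e k) + trace (\<Gamma> (?e k)) *\<^sub>R f x (H *v ?e j) (H *v ?e k)
      - f x (H *v (transpose (\<Gamma> (?e k)) *v ?e j)) (H *v ?e k) - f x (H *v ?e j) (H *v (transpose (\<Gamma> (?e k)) *v ?e k)))"
    unfolding scaleR_sum_right R'_def HDH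
    by (rule sum.cong[OF refl]) (simp add: cov_def linear_add[OF linear_f(1)] linear_add[OF linear_f(2)] algebra_simps)
  then show ?thesis unfolding sum.distrib sum_subtractf 1 2 by simp
qed

end

section \<open>Connection forms and their curvature\<close>

locale connection_germ =
  fixes A :: "real ^ 'n \<Rightarrow> ('n::finite, 'k::bundle_scalar ^ 'r::finite ^ 'r) form" and U
  assumes U_open: "open U"
    and A_smooth: "\<And>u. smooth_on U (\<lambda>y. A y [u])"
    and A_linear: "\<And>y. y \<in> U \<Longrightarrow> linear (\<lambda>u. A y [u])"
begin

text \<open>The argument of the one-form comes first and the direction of differentiation last, so
  that \<open>dA v y\<close> is itself a derivative map.\<close>

definition dA :: "real ^ 'n \<Rightarrow> real ^ 'n \<Rightarrow> real ^ 'n \<Rightarrow> 'k ^ 'r ^ 'r" where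
  "dA v y u = frechet_derivative (\<lambda>y. A y [v]) (at y) u"

definition ddA :: "real ^ 'n \<Rightarrow> real ^ 'n \<Rightarrow> real ^ 'n \<Rightarrow> real ^ 'n \<Rightarrow> 'k ^ 'r ^ 'r" where
  "ddA v u y w = frechet_derivative (\<lambda>y. dA v y u) (at y) w"

lemma A_Ck2: "Ck_on 2 U (\<lambda>y. A y [v])"
  using A_smooth by (simp add: smooth_on_def)

lemma A_deriv: "y \<in> U \<Longrightarrow> ((\<lambda>y. A y [v]) has_derivative dA v y) (at y)"
  using A_Ck2[of v] unfolding dA_def[abs_def] by (auto simp: numeral_2_eq_2 frechet_derivative_works[symmetric])

lemma dA_deriv: "y \<in> U \<Longrightarrow> ((\<lambda>y. dA v y u) has_derivative ddA v u y) (at y)"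
  using A_Ck2[of v] unfolding ddA_def[abs_def] dA_def by (auto simp: numeral_2_eq_2 frechet_derivative_works[symmetric])

lemma ddA_commute: "y \<in> U \<Longrightarrow> ddA v u y w = ddA v w y u"
  unfolding ddA_def dA_def by (rule matrix_mixed_partials[OF U_open _ A_Ck2])

lemma linear_dA: "y \<in> U \<Longrightarrow> linear (dA v y)"
  by (rule has_derivative_linear[OF A_deriv])

lemma linear_dA_form:
  assumes "y \<in> U" shows "linear (\<lambda>v. dA v y u)"
proof -
  have unique: "dA v y u = h u" if "((\<lambda>y. A y [v]) has_derivative h) (at y)" for v h
    using has_derivative_unique[OF A_deriv[OF assms] that] by simp
  have "dA (v + w) y u = dA v y u + dA w y u" "dA (c *\<^sub>R v) y u = c *\<^sub>R dA v y u" for v w c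
  proof -
    show "dA (v + w) y u = dA v y u + dA w y u"
      by (rule unique, rule has_derivative_transform_within_open[OF has_derivative_add[OF A_deriv A_deriv] U_open])
         (use assms linear_add[OF A_linear] in auto)
    show "dA (c *\<^sub>R v) y u = c *\<^sub>R dA v y u"
      by (rule unique, rule has_derivative_transform_within_open[OF has_derivative_scaleR_right[OF A_deriv] U_open])
         (use assms linear_cmul[OF A_linear] in auto)
  qed
  then show ?thesis by (simp add: linear_iff)
qed

lemma curvature_eq: "curvature A y [u, v] = dA v y u - dA u y v + A y [u] ** A y [v] - A y [v] ** A y [u]"
proof -
  have set2: "{..<2} = {0, 1 :: nat}" by auto
  have "wedge (**) 1 1 (A y) (A y) [u, v] = A y [u] ** A y [v] - A y [v] ** A y [u]"
  proof -
    have f: "finite {1 :: nat}" "0 \<notin> {1 :: nat}" by auto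
    show ?thesis
      unfolding wedge_def one_add_one set2 sum_over_permutations_insert[OF f] permutes_sing
      by (simp add: sign_swap_id Transposition.transpose_def upt_rec)
  qed
  moreover have "ext_deriv 1 A y [u, v] = dA v y u - dA u y v"
    by (simp add: ext_deriv_def dA_def atMost_Suc)
  ultimately show ?thesis by (simp add: curvature_def)
qed

lemma curvature_skew: "curvature A y [u, v] = - curvature A y [v, u]"
  by (simp add: curvature_eq)

lemmas matrix_distribs = matrix_add_ldistrib bounded_bilinear.add_left[OF bounded_bilinear_matrix_mult]
  bounded_bilinear.diff_left[OF bounded_bilinear_matrix_mult] bounded_bilinear.diff_right[OF bounded_bilinear_matrix_mult]
  bounded_bilinear.minus_left[OF bounded_bilinear_matrix_mult] bounded_bilinear.minus_right[OF bounded_bilinear_matrix_mult]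
  bounded_bilinear.scaleR_left[OF bounded_bilinear_matrix_mult] bounded_bilinear.scaleR_right[OF bounded_bilinear_matrix_mult]

lemma bilinear_curvature:
  assumes "y \<in> U" shows "bilinear (\<lambda>u v. curvature A y [u, v])"
  unfolding curvature_eq
  using linear_dA[OF assms] linear_dA_form[OF assms] A_linear[OF assms]
  by (simp add: bilinear_def linear_iff matrix_distribs algebra_simps)

definition curv' :: "real ^ 'n \<Rightarrow> real ^ 'n \<Rightarrow> real ^ 'n \<Rightarrow> real ^ 'n \<Rightarrow> 'k ^ 'r ^ 'r" where
  "curv' y w u v = ddA v u y w - ddA u v y w + (A y [u] ** dA v y w + dA u y w ** A y [v])
     - (A y [v] ** dA u y w + dA v y w ** A y [u])"

lemma curvature_deriv:
  assumes "y \<in> U"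
  shows "((\<lambda>y. curvature A y [u, v]) has_derivative (\<lambda>w. curv' y w u v)) (at y)"
  unfolding curvature_eq curv'_def
  by (intro has_derivative_add has_derivative_diff bounded_bilinear.FDERIV[OF bounded_bilinear_matrix_mult]
      A_deriv dA_deriv assms)

text \<open>Second derivatives of A cancel because they are symmetric, the terms with one derivative
  cancel in pairs, and the cubic ones by associativity of the matrix product.\<close>

lemma bianchi:
  assumes "y \<in> U"
  shows "(curv' y u v w + (A y [u] ** curvature A y [v, w] - curvature A y [v, w] ** A y [u]))
    + (curv' y v w u + (A y [v] ** curvature A y [w, u] - curvature A y [w, u] ** A y [v]))
    + (curv' y w u v + (A y [w] ** curvature A y [u, v] - curvature A y [u, v] ** A y [w])) = 0"
  unfolding curvature_eq curv'_def
  using ddA_commute[OF assms, of u v w] ddA_commute[OF assms, of v w u] ddA_commute[OF assms, of w u v]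
  by (simp add: matrix_distribs matrix_mul_assoc algebra_simps)

end

text \<open>The determinant has no zero on the segment from the identity to \<open>G\<close>.\<close>

lemma positive_definite_det:
  fixes G :: "real ^ 'n ^ 'n"
  assumes pos: "\<And>v. v \<noteq> 0 \<Longrightarrow> v \<bullet> (G *v v) > 0"
  shows "det G > 0"
proof -
  define M where "M t = (1 - t) *\<^sub>R mat 1 + t *\<^sub>R G" for t
  have "det (M t) \<noteq> 0" if t: "0 \<le> t" "t \<le> 1" for t
  proof -
    have "v = 0" if v: "M t *v v = 0" for v
    proof (rule ccontr)
      assume "v \<noteq> 0"
      have "v \<bullet> (M t *v v) = (1 - t) * (v \<bullet> v) + t * (v \<bullet> (G *v v))"
        by (simp add: M_def matrix_vector_mult_add_rdistrib inner_add_right scaleR_matrix_vector_assoc[symmetric])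
      moreover have "(1 - t) * (v \<bullet> v) + t * (v \<bullet> (G *v v)) > 0"
      proof (cases "t = 0")
        case False
        then show ?thesis using t pos[OF \<open>v \<noteq> 0\<close>] by (simp add: add_nonneg_pos)
      qed (use \<open>v \<noteq> 0\<close> in simp)
      ultimately show False using v by simp
    qed
    then have "\<exists>B. B ** M t = mat 1" unfolding matrix_left_invertible_ker by blast
    then show ?thesis by (simp add: invertible_left_inverse[symmetric] invertible_det_nz)
  qed
  moreover have "continuous_on {0..1} (\<lambda>t. det (M t))"
    unfolding det_def M_def by (auto intro!: continuous_intros)
  moreover have "det (M 0) = 1" "det (M 1) = det G" by (simp_all add: M_def)
  ultimately show ?thesis
    using IVT2'[of "\<lambda>t. det (M t)" 1 0 0] by (metis atLeastAtMost_iff less_eq_real_def not_less zero_le_one zero_less_one)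
qed

text \<open>The choice operator picks the fundamental form of some admissible basis; statements
  about self-duality are then made for that basis.\<close>

lemma fundamental_form_triple:
  assumes "\<exists>J1 J2 J3. admissible_basis G Q J1 J2 J3" "transpose G = G" "det G > 0"
  obtains J1 J2 J3 where "quaternionic_triple G Q J1 J2 J3"
    "fundamental_form G Q = quaternionic_triple.triple_form G J1 J2 J3"
proof -
  define P where "P \<Omega> \<longleftrightarrow> (\<exists>J1 J2 J3. admissible_basis G Q J1 J2 J3 \<and>
      \<Omega> = (\<lambda>vs. - (1/6) * (\<Sum>J\<leftarrow>[J1, J2, J3]. wedge (*) 2 2 (kaehler_form G J) (kaehler_form G J) vs)))" for \<Omega>
  have "\<exists>\<Omega>. P \<Omega>" unfolding P_def using assms(1) by blast
  then have "P (fundamental_form G Q)"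
    unfolding fundamental_form_def P_def[symmetric] by (rule someI_ex)
  then obtain J1 J2 J3 where J: "admissible_basis G Q J1 J2 J3"
      "fundamental_form G Q = (\<lambda>vs. - (1/6) * (\<Sum>J\<leftarrow>[J1, J2, J3]. wedge (*) 2 2 (kaehler_form G J) (kaehler_form G J) vs))"
    unfolding P_def by blast
  interpret quaternionic_triple G Q J1 J2 J3 using assms J(1) by unfold_locales
  show thesis
    by (rule that[of J1 J2 J3]) (use J(2) in \<open>auto simp: triple_form_def fun_eq_iff quaternionic_triple_axioms\<close>)
qed

context quaternionic_triple
begin

text \<open>The scalar result applied to every matrix entry, with \<open>to_complex\<close> treating
  real and complex bundles alike. Invariance under J3 follows from that under J1 and J2, of which it
  is the product.\<close>

lemma invariant_iff_flat:
  fixes f :: "real ^ 'n \<Rightarrow> real ^ 'n \<Rightarrow> 'k::bundle_scalar ^ 'r::finite ^ 'r" and \<theta> :: "'e::finite \<Rightarrow> 2 \<Rightarrow> complex ^ 'n"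
  assumes frame: "grassmann_frame \<theta>"
    and act: "\<And>J. J \<in> Q \<Longrightarrow> \<exists>j. grassmann_frame.H_action \<theta> j J"
    and f: "bilinear f" "\<And>u v. f u v = - f v u"
  shows "(\<forall>J\<in>{J1, J2, J3}. \<forall>u v. f (J *v u) (J *v v) = f u v) \<longleftrightarrow>
    (\<exists>C :: 'e \<Rightarrow> 'e \<Rightarrow> 2 \<Rightarrow> 2 \<Rightarrow> complex ^ 'r ^ 'r.
      (\<forall>a b A B. C a b A B = C b a A B \<and> C a b A B = - C a b B A) \<and>
      (\<forall>u v i j. to_complex (f u v $ i $ j) =
         (\<Sum>a\<in>UNIV. \<Sum>b\<in>UNIV. \<Sum>A\<in>UNIV. \<Sum>B\<in>UNIV.
            C a b A B $ i $ j * coval (\<theta> a A) u * coval (\<theta> b B) v)))" (is "?inv \<longleftrightarrow> ?flat")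
proof -
  interpret grassmann_frame \<theta> by (rule frame)
  define \<phi> where "\<phi> i j u v = to_complex (f u v $ i $ j)" for i j u v
  obtain j1 j2 where j: "H_action j1 J1" "H_action j2 J2" using act J_in_Q by blast
  have bil: "bilinear (\<phi> i j)" for i j
    using f(1) by (simp add: \<phi>_def[abs_def] bilinear_def linear_iff to_complex_add to_complex_scaleR)
  have skew: "\<phi> i j u v = - \<phi> i j v u" for i j u v
    unfolding \<phi>_def by (subst f(2)) (simp add: linear_neg[OF linear_to_complex])
  note iff = invariant_iff_skew_H[OF bil skew j(1) mult_J(1) j(2) mult_J(2)]
  have anti: "J1 *v (J2 *v u) = - (J2 *v (J1 *v u))" for u by (simp add: mult_J)
  have J3: "f (J3 *v u) (J3 *v v) = f (J1 *v (J2 *v u)) (J1 *v (J2 *v v))" for u v by (simp add: mult_J)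
  define P where "P i j C \<longleftrightarrow> (\<forall>a b A B. C a b A B = C b a A B \<and> C a b A B = - C a b B A) \<and>
      (\<forall>u v. \<phi> i j u v = frame_sum C u v)" for i j C
  have regroup: "(\<forall>i j. (\<forall>a b A B. X i j a b A B \<and> Y i j a b A B) \<and> (\<forall>u v. Z i j u v)) \<longleftrightarrow>
      (\<forall>a b A B. (\<forall>i j. X i j a b A B) \<and> (\<forall>i j. Y i j a b A B)) \<and> (\<forall>u v i j. Z i j u v)"
    for X Y :: "'r \<Rightarrow> 'r \<Rightarrow> 'e \<Rightarrow> 'e \<Rightarrow> 2 \<Rightarrow> 2 \<Rightarrow> bool" and Z :: "'r \<Rightarrow> 'r \<Rightarrow> real ^ 'n \<Rightarrow> real ^ 'n \<Rightarrow> bool"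
    by blast
  have "?inv \<longleftrightarrow> (\<forall>u v. f (J1 *v u) (J1 *v v) = f u v \<and> f (J2 *v u) (J2 *v v) = f u v)"
    using J3 by auto
  also have "\<dots> \<longleftrightarrow> (\<forall>i j u v. \<phi> i j (J1 *v u) (J1 *v v) = \<phi> i j u v \<and> \<phi> i j (J2 *v u) (J2 *v v) = \<phi> i j u v)"
    by (auto simp: \<phi>_def vec_eq_iff)
  also have "\<dots> \<longleftrightarrow> (\<forall>i j. \<exists>C. P i j C)"
    by (simp only: iff[OF anti] P_def)
  also have "\<dots> \<longleftrightarrow> (\<exists>C :: 'e \<Rightarrow> 'e \<Rightarrow> 2 \<Rightarrow> 2 \<Rightarrow> complex ^ 'r ^ 'r. \<forall>i j. P i j (\<lambda>a b A B. C a b A B $ i $ j))"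
  proof
    assume "\<forall>i j. \<exists>C. P i j C"
    then obtain C where C: "\<And>i j. P i j (C i j)" by metis
    show "\<exists>C :: 'e \<Rightarrow> 'e \<Rightarrow> 2 \<Rightarrow> 2 \<Rightarrow> complex ^ 'r ^ 'r. \<forall>i j. P i j (\<lambda>a b A B. C a b A B $ i $ j)"
      by (rule exI[of _ "\<lambda>a b A B. \<chi> i j. C i j a b A B"]) (simp add: C)
  qed blast
  also have "\<dots> \<longleftrightarrow> ?flat"
    unfolding P_def vec_eq_iff vector_uminus_component \<phi>_def regroup ..
  finally show ?thesis .
qed

text \<open>For J with square -1 invariance amounts to skewness of f with respect to J. Unlike
  invariance, skewness is linear in J and passes to the span.\<close>

lemma invariant_imp_skew_span:
  assumes f: "bilinear f" and inv: "\<And>J u v. J \<in> {J1, J2, J3} \<Longrightarrow> f (J *v u) (J *v v) = f u v" and K: "K \<in> Q"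
  shows "f (K *v u) v = - f u (K *v v)"
proof -
  have lin: "linear (f u)" "linear (\<lambda>u. f u v)" for u v using f by (auto simp: bilinear_def)
  have J: "f (J *v u) v = - f u (J *v v)" if "J \<in> {J1, J2, J3}" for J u v
  proof -
    have "J *v (J *v u) = - u" using that by (auto simp: mult_J)
    then have "f (J *v u) v = f (- u) (J *v v)" using inv[OF that, of "J *v u" v] by simp
    then show ?thesis by (simp add: linear_neg[OF lin(2)])
  qed
  have "K \<in> span {J1, J2, J3}" using K admissible by (simp add: admissible_basis_def)
  then show ?thesis
  proof (induction rule: span_induct_alt)
    case base
    show ?case using lin by (simp add: linear_0 linear_0[OF lin(2)])
  next
    case (step c x y)
    then show ?case
      using J[of x] lin
      by (simp add: matrix_vector_mult_add_rdistrib scaleR_matrix_vector_assoc[symmetric]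
          linear_add linear_cmul linear_add[OF lin(2)] linear_cmul[OF lin(2)])
  qed
qed

end

text \<open>Separates the constant \<open>vol\<close> from the coefficients \<open>R\<close> of
  \<open>two_form_germ\<close>, so that differentiation concerns the latter alone.\<close>

lemma hodge_2_eq:
  fixes \<alpha> :: "('n::{finite, linorder}, 'v::real_vector) form"
  assumes "multilinear 2 \<alpha>"
  shows "hodge G 2 \<alpha> ws = (\<Sum>j\<in>UNIV. \<Sum>l\<in>UNIV. vol (axis j 1 # axis l 1 # ws) *\<^sub>R
    ((sqrt (det G) / 2) *\<^sub>R \<alpha> [matrix_inv G *v axis j 1, matrix_inv G *v axis l 1]))"
  unfolding hodge_eq[OF assms] unfolding numeral_2_eq_2 sum_lists_Suc sum_lists_0
  by (simp add: scaleR_sum_right mult.commute)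

section \<open>The divergence of the curvature\<close>

locale chart_connection =
  two_form_germ g U x D "\<lambda>y u v. curvature A y [u, v]" "connection_germ.curv' A x" + connection_germ A U
  for g :: "(real, 'n::{finite, linorder}) vec \<Rightarrow> ((real, 'n) vec, 'n) vec" and U x D
    and A :: "(real, 'n) vec \<Rightarrow> ('n, 'k::bundle_scalar ^ 'r::finite ^ 'r) form"
begin

text \<open>The covariant derivative of the curvature at \<open>x\<close> with respect to both the Levi-Civita connection and \<open>A\<close>.\<close>

definition gauge_cov :: "(real, 'n) vec \<Rightarrow> (real, 'n) vec \<Rightarrow> (real, 'n) vec \<Rightarrow> 'k ^ 'r ^ 'r" where
  "gauge_cov w u v = cov w u v + (A x [w] ** curvature A x [u, v] - curvature A x [u, v] ** A x [w])"

lemma gauge_cov_bianchi: "gauge_cov u v w + gauge_cov v w u + gauge_cov w u v = 0"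
  using bianchi[OF U(2), of u v w] cov_cyclic[of u v w]
  by (simp add: gauge_cov_def) (simp add: algebra_simps)

lemma linear_gauge_cov: "linear (\<lambda>w. gauge_cov w u v)"
  using linear_cov_direction[of u v] A_linear[OF U(2)]
  by (simp add: gauge_cov_def linear_iff matrix_distribs algebra_simps)

lemma bilinear_gauge_cov: "bilinear (gauge_cov w)"
  using bilinear_cov[of w] f_bilinear[OF U(2)]
  by (simp add: gauge_cov_def[abs_def] bilinear_def linear_iff matrix_distribs algebra_simps)

lemma gauge_cov_skew: "gauge_cov w u v = - gauge_cov w v u"
  using cov_skew[of w u v] f_skew[OF U(2), of u v] by (simp add: gauge_cov_def matrix_distribs)

text \<open>The exterior derivative and both wedge products take the same shape, by
  \<open>cramer_vol\<close> and its alternated version. Together they contract a derivative of the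
  coefficients \<open>R\<close>, and this contraction is a multiple of the covariant
  divergence.\<close>

lemma ext_cov_deriv_hodge_eq_0:
  assumes n: "CARD('n) = Suc (Suc k)" "even k" and vs: "length vs = Suc k"
    and div: "\<And>v. (\<Sum>p\<in>UNIV. gauge_cov (axis p 1) (H *v axis p 1) v) = 0"
  shows "ext_cov_deriv k A (\<lambda>y. hodge (g y) 2 (curvature A y)) x vs = 0"
proof -
  let ?e = "\<lambda>k. axis k 1 :: (real, 'n) vec"
  have hodge: "hodge (g y) 2 (curvature A y) ws = (\<Sum>j\<in>UNIV. \<Sum>l\<in>UNIV. vol (?e j # ?e l # ws) *\<^sub>R R y j l)"
    if "y \<in> U" for y ws
    using hodge_2_eq[of "curvature A y"] f_bilinear[OF that] by (simp add: multilinear_2_iff R_def)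
  \<comment> \<open>The derivative of the coefficients with respect to A alone; the Christoffel
    terms enter after contraction, through \<open>divergence_R\<close>.\<close>
  define \<Phi> where "\<Phi> j l w = R' w j l + (A x [w] ** R x j l - R x j l ** A x [w])" for j l w
  have linR': "linear (\<lambda>w. R' w j l)" for j l by (rule has_derivative_linear[OF R_deriv])
  have "ext_deriv k (\<lambda>y. hodge (g y) 2 (curvature A y)) x vs =
      (\<Sum>i<Suc k. (-1) ^ i *\<^sub>R (\<Sum>j\<in>UNIV. \<Sum>l\<in>UNIV. vol (?e j # ?e l # remove_nth i vs) *\<^sub>R R' (vs ! i) j l))"
    unfolding ext_deriv_def lessThan_Suc_atMost
  proof (rule sum.cong[OF refl])
    fix i
    have "((\<lambda>y. \<Sum>j\<in>UNIV. \<Sum>l\<in>UNIV. vol (?e j # ?e l # remove_nth i vs) *\<^sub>R R y j l) has_derivative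
        (\<lambda>w. \<Sum>j\<in>UNIV. \<Sum>l\<in>UNIV. vol (?e j # ?e l # remove_nth i vs) *\<^sub>R R' w j l)) (at x)"
      by (intro has_derivative_sum has_derivative_scaleR_right R_deriv)
    then have "((\<lambda>y. hodge (g y) 2 (curvature A y) (remove_nth i vs)) has_derivative
        (\<lambda>w. \<Sum>j\<in>UNIV. \<Sum>l\<in>UNIV. vol (?e j # ?e l # remove_nth i vs) *\<^sub>R R' w j l)) (at x)"
      by (rule has_derivative_transform_within_open[OF _ U]) (simp add: hodge)
    from fun_cong[OF frechet_derivative_at[OF this], of "vs ! i"]
    show "(-1) ^ i *\<^sub>R frechet_derivative (\<lambda>y. hodge (g y) 2 (curvature A y) (take i vs @ drop (Suc i) vs)) (at x) (vs ! i) =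
      (-1) ^ i *\<^sub>R (\<Sum>j\<in>UNIV. \<Sum>l\<in>UNIV. vol (?e j # ?e l # remove_nth i vs) *\<^sub>R R' (vs ! i) j l)"
      by (simp only: remove_nth_def)
  qed
  also have "\<dots> = (\<Sum>j\<in>UNIV. \<Sum>l\<in>UNIV. \<Sum>i<Suc k. (-1) ^ i *\<^sub>R (vol (?e j # ?e l # remove_nth i vs) *\<^sub>R R' (vs ! i) j l))"
    unfolding scaleR_sum_right by (rule trans[OF sum.swap], rule sum.cong[OF refl], rule sum.swap)
  also have "\<dots> = (\<Sum>j\<in>UNIV. \<Sum>l\<in>UNIV. vol (?e j # vs) *\<^sub>R R' (?e l) j l - vol (?e l # vs) *\<^sub>R R' (?e j) j l)"
    using cramer_vol[OF linR', of vs] vs n by simp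
  finally have d: "ext_deriv k (\<lambda>y. hodge (g y) 2 (curvature A y)) x vs =
      (\<Sum>j\<in>UNIV. \<Sum>l\<in>UNIV. vol (?e j # vs) *\<^sub>R R' (?e l) j l - vol (?e l # vs) *\<^sub>R R' (?e j) j l)" .
  have bil: "bilinear ((**) :: 'k ^ 'r ^ 'r \<Rightarrow> 'k ^ 'r ^ 'r \<Rightarrow> 'k ^ 'r ^ 'r)"
    by (simp add: bilinear_def linear_iff matrix_distribs)
  \<comment> \<open>Since k is even, the last term of \<open>ext_cov_deriv\<close> carries a minus
    sign and completes the commutator with A.\<close>
  have "ext_cov_deriv k A (\<lambda>y. hodge (g y) 2 (curvature A y)) x vs =
      (\<Sum>j\<in>UNIV. \<Sum>l\<in>UNIV. vol (?e j # vs) *\<^sub>R \<Phi> j l (?e l) - vol (?e l # vs) *\<^sub>R \<Phi> j l (?e j))"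
    unfolding ext_cov_deriv_def d
      wedge_1_vol[where R = "R x", OF hodge[OF U(2)] A_linear[OF U(2)] vs n(1) bil]
      wedge_vol_1[where R = "R x", OF hodge[OF U(2)] A_linear[OF U(2)] vs n(1) bil n(2)]
    using n(2) by (simp add: \<Phi>_def sum.distrib sum_subtractf algebra_simps)
  also have "\<dots> = (\<Sum>j\<in>UNIV. vol (?e j # vs) *\<^sub>R (\<Sum>l\<in>UNIV. \<Phi> j l (?e l)))
      - (\<Sum>l\<in>UNIV. vol (?e l # vs) *\<^sub>R (\<Sum>j\<in>UNIV. \<Phi> j l (?e j)))"
    unfolding sum_subtractf scaleR_sum_right by (subst (2) sum.swap) (rule refl)
  also have "\<dots> = 0"
  proof -
    have 1: "(\<Sum>l\<in>UNIV. \<Phi> j l (?e l)) = 0" for j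
    proof -
      have "(\<Sum>l\<in>UNIV. \<Phi> j l (?e l)) = (sqrt (det (g x)) / 2) *\<^sub>R (\<Sum>l\<in>UNIV. gauge_cov (?e l) (H *v ?e j) (H *v ?e l))"
        by (simp add: \<Phi>_def sum.distrib divergence_R gauge_cov_def scaleR_add_right) (simp add: R_def scaleR_sum_right matrix_distribs algebra_simps)
      also have "(\<Sum>l\<in>UNIV. gauge_cov (?e l) (H *v ?e j) (H *v ?e l)) = - (\<Sum>l\<in>UNIV. gauge_cov (?e l) (H *v ?e l) (H *v ?e j))"
        unfolding sum_negf[symmetric] by (rule sum.cong[OF refl], rule gauge_cov_skew)
      finally show ?thesis by (simp add: div)
    qed
    have "\<Phi> j l w = - \<Phi> l j w" for j l w
    proof -
      have R: "R x j l = - R x l j" unfolding R_def by (subst f_skew[OF U(2)]) simp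
      have "R' w j l = - R' w l j"
        unfolding R'_def
        using f_skew[OF U(2), of "H *v ?e j" "H *v ?e l"] f_skew[OF U(2), of "H *v ?e j" "(H ** D w ** H) *v ?e l"]
          f_skew[OF U(2), of "(H ** D w ** H) *v ?e j" "H *v ?e l"] f'_skew[of w "H *v ?e j" "H *v ?e l"]
        by (simp add: scaleR_diff_right scaleR_add_right algebra_simps)
      with R show ?thesis by (simp add: \<Phi>_def matrix_distribs)
    qed
    \<comment> \<open>Skewness reduces the contraction of the first index to that of the second,
      computed before.\<close>
    then have "(\<Sum>j\<in>UNIV. \<Phi> j l (?e j)) = - (\<Sum>j\<in>UNIV. \<Phi> l j (?e j))" for l
      unfolding sum_negf[symmetric] by (intro sum.cong refl)
    then show ?thesis by (simp add: 1)
  qed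
  finally show ?thesis .
qed

end

section \<open>Half-flat connections on quaternionic Kaehler manifolds\<close>

locale qk_connection =
  fixes \<A> :: "('a::{t2_space, second_countable_topology}, 'n::{finite, linorder}) chart set"
    and g :: "('a, 'n) metric"
    and Q :: "('a, 'n) endo_bundle"
    and \<G> :: "('a, 'n) chart \<Rightarrow> ('n, 'e::finite) grassmann set"
    and \<pi> :: "'w \<Rightarrow> 'a"
    and \<T> :: "('a, 'w, 'k::bundle_scalar, 'r::finite) triv set"
    and A :: "('a, 'n, 'w, 'k, 'r) conn"
    and m :: nat
  assumes dim: "CARD('n) = 4 * m"
    and qk: "quaternionic_kaehler \<A> g Q"
    and gr: "grassmann_structure \<A> g Q \<G>"
    and vb: "vector_bundle \<A> \<pi> \<T>"
    and conn: "connection \<A> \<pi> \<T> A"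
begin

definition trivial_dom where "trivial_dom c t = coord c ` (cdom c \<inter> tdom t)"

definition flat_at where
  "flat_at c t \<Gamma> x \<longleftrightarrow> (\<exists>C :: 'e \<Rightarrow> 'e \<Rightarrow> 2 \<Rightarrow> 2 \<Rightarrow> complex ^ 'r ^ 'r.
      (\<forall>a b A B. C a b A B = C b a A B \<and> C a b A B = - C a b B A) \<and>
      (\<forall>u v i j. to_complex (curvature (A c t) x [u, v] $ i $ j) =
         (\<Sum>a\<in>UNIV. \<Sum>b\<in>UNIV. \<Sum>A\<in>UNIV. \<Sum>B\<in>UNIV.
            C a b A B $ i $ j * coval (theta \<Gamma> x a A) u * coval (theta \<Gamma> x b B) v)))"

definition invariant_at where
  "invariant_at c t x J \<longleftrightarrow> (\<forall>u v. curvature (A c t) x [J *v u, J *v v] = curvature (A c t) x [u, v])"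

definition self_dual_at where
  "self_dual_at c t x \<longleftrightarrow> (\<forall>u v. B_op (g c x) (fundamental_form (g c x) (Q c x)) (curvature (A c t) x) [u, v] = curvature (A c t) x [u, v])"

lemma half_flat_iff: "half_flat \<A> \<G> \<T> A \<longleftrightarrow>
    (\<forall>c\<in>\<A>. \<forall>\<Gamma>\<in>\<G> c. \<forall>t\<in>\<T>. \<forall>x\<in>gdom \<Gamma> \<inter> trivial_dom c t. flat_at c t \<Gamma> x)"
  unfolding half_flat_def flat_at_def trivial_dom_def ..

lemma self_dual_iff: "self_dual 1 \<A> g Q \<T> A \<longleftrightarrow> (\<forall>c\<in>\<A>. \<forall>t\<in>\<T>. \<forall>x\<in>trivial_dom c t. self_dual_at c t x)"
  unfolding self_dual_def self_dual_at_def trivial_dom_def scaleR_one ..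

text \<open>The index type is nonempty, hence m is positive.\<close>

lemma dim_ge: "CARD('n) \<ge> 4"
  using dim zero_less_card_finite[where 'a = 'n] by simp

lemma img_open: "c \<in> \<A> \<Longrightarrow> open (img c)"
  using qk by (simp add: quaternionic_kaehler_def smooth_atlas_def)

lemma trivial_dom_subset: "trivial_dom c t \<subseteq> img c"
  by (auto simp: trivial_dom_def img_def)

lemma trivial_dom_open:
  assumes "c \<in> \<A>" "t \<in> \<T>" shows "open (trivial_dom c t)"
proof -
  have hom: "homeomorphism (cdom c) (img c) (coord c) (param c)" and "open (cdom c)"
    using qk assms(1) by (simp_all add: quaternionic_kaehler_def smooth_atlas_def)
  have "open (tdom t)" using vb assms(2) by (simp add: vector_bundle_def)
  then have "openin (top_of_set (cdom c)) (cdom c \<inter> tdom t)" by (simp add: openin_open_Int)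
  then have "openin (top_of_set (img c)) (trivial_dom c t)"
    unfolding trivial_dom_def by (rule homeomorphism_imp_open_map[OF hom])
  then show ?thesis using img_open[OF assms(1)] openin_open_trans by blast
qed

lemma metric_sym: "c \<in> \<A> \<Longrightarrow> y \<in> img c \<Longrightarrow> transpose (g c y) = g c y"
  using qk by (simp add: quaternionic_kaehler_def riemannian_metric_def)

lemma metric_det: "c \<in> \<A> \<Longrightarrow> y \<in> img c \<Longrightarrow> det (g c y) > 0"
  by (rule positive_definite_det) (use qk in \<open>simp add: quaternionic_kaehler_def riemannian_metric_def\<close>)

lemma triple:
  "c \<in> \<A> \<Longrightarrow> y \<in> img c \<Longrightarrow> admissible_basis (g c y) (Q c y) J1 J2 J3 \<Longrightarrow>
    quaternionic_triple (g c y) (Q c y) J1 J2 J3"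
  by unfold_locales (auto simp: metric_sym metric_det)

lemma germ_of_connection:
  assumes "c \<in> \<A>" "t \<in> \<T>"
  shows "connection_germ (A c t) (trivial_dom c t)"
proof -
  note 1 = conjunct1[OF conn[unfolded connection_def], rule_format, OF assms, folded trivial_dom_def]
  show ?thesis
  proof (rule connection_germ.intro)
    show "open (trivial_dom c t)" by (rule trivial_dom_open[OF assms])
    show "smooth_on (trivial_dom c t) (\<lambda>y. A c t y [u])" for u using conjunct1[OF 1] by blast
    show "linear (\<lambda>u. A c t y [u])" if "y \<in> trivial_dom c t" for y using conjunct2[OF 1] that by blast
  qed
qed

lemma chart_connection_at:
  assumes c: "c \<in> \<A>" and t: "t \<in> \<T>" and x: "x \<in> trivial_dom c t"
  shows "chart_connection (g c) (trivial_dom c t) x (frechet_derivative (g c) (at x)) (A c t)"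
proof -
  interpret connection_germ "A c t" "trivial_dom c t" by (rule germ_of_connection[OF c t])
  have xi: "x \<in> img c" using x trivial_dom_subset[of c t] by blast
  have "smooth_on (img c) (g c)"
    using qk c by (simp add: quaternionic_kaehler_def riemannian_metric_def)
  then have "Ck_on 1 (img c) (g c)" by (simp add: smooth_on_def)
  then have "g c differentiable (at x)" using xi by simp
  then have deriv: "(g c has_derivative frechet_derivative (g c) (at x)) (at x)"
    by (simp add: frechet_derivative_works)
  have sub: "y \<in> img c" if "y \<in> trivial_dom c t" for y using that trivial_dom_subset[of c t] by blast
  have "metric_germ (g c) (trivial_dom c t) x (frechet_derivative (g c) (at x))"
    by (rule metric_germ.intro[OF U_open x deriv metric_sym[OF c sub] metric_det[OF c sub]])
  then have "two_form_germ (g c) (trivial_dom c t) x (frechet_derivative (g c) (at x))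
      (\<lambda>y u v. curvature (A c t) y [u, v]) (curv' x)"
    by (rule two_form_germ.intro[OF _ two_form_germ_axioms.intro[OF bilinear_curvature curvature_skew curvature_deriv[OF x]]])
  then show ?thesis by (rule chart_connection.intro[OF _ connection_germ_axioms])
qed

lemma curvature_form:
  assumes "c \<in> \<A>" "t \<in> \<T>" "x \<in> trivial_dom c t"
  shows "bilinear (\<lambda>u v. curvature (A c t) x [u, v])"
    and "curvature (A c t) x [u, v] = - curvature (A c t) x [v, u]"
proof -
  interpret connection_germ "A c t" "trivial_dom c t" by (rule germ_of_connection[OF assms(1,2)])
  show "bilinear (\<lambda>u v. curvature (A c t) x [u, v])" by (rule bilinear_curvature[OF assms(3)])
  show "curvature (A c t) x [u, v] = - curvature (A c t) x [v, u]" by (rule curvature_skew)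
qed

text \<open>The basis on the right is an arbitrary admissible one while the left mentions none, so
  invariance can be transferred from one admissible basis to another.\<close>

lemma flat_iff:
  assumes c: "c \<in> \<A>" and t: "t \<in> \<T>" and \<Gamma>: "\<Gamma> \<in> \<G> c" and x: "x \<in> gdom \<Gamma> \<inter> trivial_dom c t"
    and J: "admissible_basis (g c x) (Q c x) J1 J2 J3"
  shows "flat_at c t \<Gamma> x \<longleftrightarrow> (\<forall>J\<in>{J1, J2, J3}. invariant_at c t x J)"
proof -
  have xd: "x \<in> trivial_dom c t" and xi: "x \<in> img c" using x trivial_dom_subset[of c t] by auto
  interpret quaternionic_triple "g c x" "Q c x" J1 J2 J3 by (rule triple[OF c xi J])
  have lg: "local_grassmann \<A> g Q c \<Gamma>" using gr c \<Gamma> by (simp add: grassmann_structure_def)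
  interpret grassmann_frame "theta \<Gamma> x"
    using lg x by unfold_locales (simp add: local_grassmann_def)
  have "\<exists>j. H_action j J" if "J \<in> Q c x" for J
    using lg x that unfolding local_grassmann_def H_action_def by blast
  from invariant_iff_flat[OF grassmann_frame_axioms this curvature_form[OF c t xd]]
  show ?thesis unfolding flat_at_def invariant_at_def by (rule sym)
qed

text \<open>The basis is the one hidden in \<open>fundamental_form\<close>, which is why it appears
  existentially.\<close>

lemma self_dual_at_iff:
  assumes c: "c \<in> \<A>" and t: "t \<in> \<T>" and x: "x \<in> trivial_dom c t"
  shows "\<exists>J1 J2 J3. admissible_basis (g c x) (Q c x) J1 J2 J3 \<and>
    (self_dual_at c t x \<longleftrightarrow> (\<forall>J\<in>{J1, J2, J3}. invariant_at c t x J))"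
proof -
  have xi: "x \<in> img c" using x trivial_dom_subset[of c t] by auto
  have "\<exists>J1 J2 J3. admissible_basis (g c x) (Q c x) J1 J2 J3"
    using qk c xi unfolding quaternionic_kaehler_def by blast
  then obtain J1 J2 J3 where tr: "quaternionic_triple (g c x) (Q c x) J1 J2 J3"
    and ff: "fundamental_form (g c x) (Q c x) = quaternionic_triple.triple_form (g c x) J1 J2 J3"
    by (rule fundamental_form_triple[OF _ metric_sym[OF c xi] metric_det[OF c xi]])
  interpret quaternionic_triple "g c x" "Q c x" J1 J2 J3 by (rule tr)
  note F = curvature_form[OF c t x]
  have B: "B_op (g c x) (fundamental_form (g c x) (Q c x)) (curvature (A c t) x) [u, v] =
      kaehler_operator (\<lambda>u v. curvature (A c t) x [u, v]) u v" for u v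
    unfolding ff by (rule B_op_triple_form[where \<alpha> = "curvature (A c t) x", OF tr dim_ge _ F(2)]) (simp add: multilinear_2_iff F(1))
  have "self_dual_at c t x \<longleftrightarrow> (\<forall>J\<in>{J1, J2, J3}. invariant_at c t x J)"
    unfolding self_dual_at_def invariant_at_def B by (rule kaehler_operator_fixed_iff[OF F(1)])
  then show ?thesis using admissible by blast
qed

lemma grassmann_cover:
  assumes "c \<in> \<A>" "x \<in> trivial_dom c t"
  obtains \<Gamma> where "\<Gamma> \<in> \<G> c" "x \<in> gdom \<Gamma> \<inter> trivial_dom c t"
  using assms gr trivial_dom_subset[of c t] unfolding grassmann_structure_def by blast

lemma half_flat_iff_self_dual: "half_flat \<A> \<G> \<T> A \<longleftrightarrow> self_dual 1 \<A> g Q \<T> A"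
proof -
  have "flat_at c t \<Gamma> x \<longleftrightarrow> self_dual_at c t x"
    if "c \<in> \<A>" "t \<in> \<T>" "\<Gamma> \<in> \<G> c" "x \<in> gdom \<Gamma> \<inter> trivial_dom c t" for c t \<Gamma> x
    using self_dual_at_iff[OF that(1,2), of x] flat_iff[OF that] that(4) by blast
  then show ?thesis
    unfolding half_flat_iff self_dual_iff using grassmann_cover by (meson IntD2)
qed

lemma half_flat_skew:
  assumes hf: "half_flat \<A> \<G> \<T> A" and c: "c \<in> \<A>" and t: "t \<in> \<T>" and x: "x \<in> trivial_dom c t"
    and J: "admissible_basis (g c x) (Q c x) J1 J2 J3" and K: "K \<in> Q c x"
  shows "curvature (A c t) x [K *v u, v] = - curvature (A c t) x [u, K *v v]"
proof -
  have xi: "x \<in> img c" using x trivial_dom_subset[of c t] by auto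
  interpret quaternionic_triple "g c x" "Q c x" J1 J2 J3 by (rule triple[OF c xi J])
  obtain \<Gamma> where \<Gamma>: "\<Gamma> \<in> \<G> c" "x \<in> gdom \<Gamma> \<inter> trivial_dom c t" by (rule grassmann_cover[OF c x])
  have "flat_at c t \<Gamma> x" using hf c t \<Gamma> unfolding half_flat_iff by blast
  then have inv: "\<forall>J\<in>{J1, J2, J3}. invariant_at c t x J" using flat_iff[OF c t \<Gamma> J] by blast
  show ?thesis
    by (rule invariant_imp_skew_span[where f = "\<lambda>u v. curvature (A c t) x [u, v]",
          OF curvature_form(1)[OF c t x] inv[rule_format, unfolded invariant_at_def, rule_format] K])
qed

lemma half_flat_imp_yang_mills:
  assumes hf: "half_flat \<A> \<G> \<T> A"
  shows "yang_mills \<A> g \<T> A"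
  unfolding yang_mills_def trivial_dom_def[symmetric]
proof (intro ballI allI impI)
  fix c t x and vs :: "(real, 'n) vec list"
  assume c: "c \<in> \<A>" and tt: "t \<in> \<T>" and x: "x \<in> trivial_dom c t" and vs: "length vs = CARD('n) - 1"
  \<comment> \<open>The dimension is a multiple of 4, so k is even, as the signs in
    \<open>ext_cov_deriv\<close> demand.\<close>
  obtain k where k: "CARD('n) = Suc (Suc k)" "even k"
    using dim dim_ge by (intro that[of "4 * m - 2"]) auto
  have xi: "x \<in> img c" using x trivial_dom_subset[of c t] by auto
  interpret chart_connection "g c" "trivial_dom c t" x "frechet_derivative (g c) (at x)" "A c t"
    by (rule chart_connection_at[OF c tt x])
  have "quaternionic_bundle \<A> g Q" using qk by (simp add: quaternionic_kaehler_def)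
  from conjunct2[OF this[unfolded quaternionic_bundle_def], rule_format, OF c xi]
  obtain N J1 J2 J3 where N: "open N" "x \<in> N" "N \<subseteq> img c"
    and sm: "smooth_on N J1" "smooth_on N J2"
    and adm: "\<forall>y\<in>N. admissible_basis (g c y) (Q c y) (J1 y) (J2 y) (J3 y)"
    by (elim exE conjE)
  note adm = adm[rule_format]
  interpret q: quaternionic_triple "g c x" "Q c x" "J1 x" "J2 x" "J3 x"
    by (rule triple[OF c xi adm[OF N(2)]])
  have skew: "curvature (A c t) y [K *v u, v] = - curvature (A c t) y [u, K *v v]"
    if "y \<in> N \<inter> trivial_dom c t" "K \<in> Q c y" for y K u v
    using half_flat_skew[OF hf c tt _ adm that(2)] that(1) by blast
  have inv: "gauge_cov w (J x *v u) v = 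
      - gauge_cov w u (J x *v v)"
    if J: "smooth_on N J" "\<And>y. y \<in> N \<Longrightarrow> J y \<in> Q c y" for J w u v
  proof -
    have "Ck_on 1 N J" using J(1) by (simp add: smooth_on_def)
    then have "J differentiable (at x)" using N(2) by simp
    then have J': "(J has_derivative frechet_derivative J (at x)) (at x)" by (simp add: frechet_derivative_works)
    \<comment> \<open>J itself may fail to be parallel, but parallelism of Q keeps its covariant
      derivative in Q, where half-flatness applies again.\<close>
    have "cov_deriv_endo (g c) J x w \<in> Q c x"
      using qk c N J unfolding quaternionic_kaehler_def parallel_subbundle_def by blast
    then have C: "frechet_derivative J (at x) w + \<Gamma> w ** J x - J x ** \<Gamma> w \<in> Q c x"
      by (simp add: cov_deriv_endo_def \<Gamma>_def)
    have "cov w (J x *v u) v = - cov w u (J x *v v)" for u v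
    proof (rule cov_invariant[OF J', of "N \<inter> trivial_dom c t"])
      show "open (N \<inter> trivial_dom c t)" "x \<in> N \<inter> trivial_dom c t" "N \<inter> trivial_dom c t \<subseteq> trivial_dom c t"
        using N(1,2) U by auto
      show "curvature (A c t) y [J y *v u, v] = - curvature (A c t) y [u, J y *v v]" if "y \<in> N \<inter> trivial_dom c t" for y u v
        using skew[OF that] J(2) that by blast
      show "curvature (A c t) x [(frechet_derivative J (at x) w + \<Gamma> w ** J x - J x ** \<Gamma> w) *v u, v] =
          - curvature (A c t) x [u, (frechet_derivative J (at x) w + \<Gamma> w ** J x - J x ** \<Gamma> w) *v v]" for u v
        using skew[OF _ C] N(2) x by blast
    qed
    moreover have "curvature (A c t) x [J x *v u, v] = - curvature (A c t) x [u, J x *v v]"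
      using skew[of x "J x"] J(2) N(2) x by blast
    ultimately show ?thesis by (simp add: gauge_cov_def matrix_distribs)
  qed
  have mem: "J1 y \<in> Q c y" "J2 y \<in> Q c y" if "y \<in> N" for y
    using adm[OF that] by (auto simp: admissible_basis_def intro: span_base)
  have div: "(\<Sum>p\<in>UNIV. gauge_cov (axis p 1) (matrix_inv (g c x) *v axis p 1) v) = 0" for v
    by (rule q.divergence_eq_0[OF linear_gauge_cov bilinear_gauge_cov gauge_cov_skew inv[OF sm(1) mem(1)] inv[OF sm(2) mem(2)] gauge_cov_bianchi])
  have "ext_cov_deriv k (A c t) (\<lambda>y. hodge (g c y) 2 (curvature (A c t) y)) x vs = 0"
    by (rule ext_cov_deriv_hodge_eq_0[OF k _ div]) (simp add: vs k)
  then show "ext_cov_deriv (CARD('n) - 2) (A c t) (\<lambda>y. hodge (g c y) 2 (curvature (A c t) y)) x vs = 0"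
    by (simp add: k)
qed

end

theorem proposition1:
  fixes \<A> :: "('a::{t2_space, second_countable_topology}, 'n::{finite, linorder}) chart set"
    and g :: "('a, 'n) metric"
    and Q :: "('a, 'n) endo_bundle"
    and \<G> :: "('a, 'n) chart \<Rightarrow> ('n, 'e::finite) grassmann set"
    and \<pi> :: "'w \<Rightarrow> 'a"
    and \<T> :: "('a, 'w, 'k::bundle_scalar, 'r::finite) triv set"
    and A :: "('a, 'n, 'w, 'k, 'r) conn"
    and m :: nat
  assumes "CARD('n) = 4 * m" and "CARD('e) = 2 * m"
    and "quaternionic_kaehler \<A> g Q"
    and "grassmann_structure \<A> g Q \<G>"
    and "vector_bundle \<A> \<pi> \<T>"
    and "connection \<A> \<pi> \<T> A"
  shows "(half_flat \<A> \<G> \<T> A \<longleftrightarrow> self_dual 1 \<A> g Q \<T> A) \<and>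
         (half_flat \<A> \<G> \<T> A \<longrightarrow> yang_mills \<A> g \<T> A)"
proof -
  interpret qk_connection \<A> g Q \<G> \<pi> \<T> A m
    using assms by unfold_locales
  show ?thesis
    using half_flat_iff_self_dual half_flat_imp_yang_mills by blast
qed

end
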